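(* Let $K$ be a field with a non-archimedean absolute value $|\cdot|$ and residue characteristic $p\geq 0$, and let $\phi\in K(z)$ be a rational function of degree $d\geq 2$. Define $$B = B(p,d) := \begin{cases} p^e (d-1) & \text{if } d\geq 3 \text{ and } d=mp^e \text{ for integers } e,m\geq 1 \text{ with } p\nmid m,\\ dp^e & \text{if } d\geq 3 \text{ and } d=1 + mp^e \text{ for integers } e,m\geq 1 \text{ with } p\nmid m,\\ d+1 & \text{otherwise}.\end{cases}$$ If $\phi$ has potentially good reduction, then there is an extension $L/K$ (inside $\overline{K}$) with $[L:K] \leq B$ such that $\phi$ is conjugate over $L$ to a map of good reduction, i.e. there is $h\in\mathrm{PGL}(2,L)$ such that $h\circ\phi\circ h^{-1}$ has good reduction.
   Context: $\overline{K}$ is an algebraic closure of $K$, and $|\cdot|$ is extended to a non-archimedean absolute value on $\overline{K}$. For a field $F$ with this absolute value, $\mathcal{O}_F=\{x\in F:|x|\le 1\}$, $\mathcal{M}_F=\{x\in F:|x|<1\}$, and the residue field is $\mathcal{O}_F/\mathcal{M}_F$; $p$ is the characteristic of the residue field of $K$. When $p=0$, the conditions "$d=mp^e$ with $e\ge1$, $p\nmid m$" and "$d=1+mp^e$ with $e\ge1$, $p\nmid m$" are regarded as never holding. The degree of $\phi=f/g$ (with $f,g$ coprime polynomials) is $\max\{\deg f,\deg g\}$. Good reduction: write $\phi=f/g$ with $f,g\in\mathcal{O}_F[z]$ and at least one coefficient of $f$ or $g$ of absolute value $1$; let $\overline{\phi}=\overline{f}/\overline{g}$ be obtained by reducing coefficients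 modulo $\mathcal{M}_F$; $\phi$ has good reduction if $\deg\overline{\phi}=\deg\phi$. $\phi\in K(z)$ has potentially good reduction if there exist a finite extension $L/K$ in $\overline{K}$ and $h\in\mathrm{PGL}(2,L)$ such that $h\circ\phi\circ h^{-1}\in L(z)$ has good reduction. *)

theory Defs
  imports "HOL-Computational_Algebra.Computational_Algebra"
begin

section \<open>Fields with a non-archimedean absolute value\<close>

class nonarch_field = field +
  fixes absv :: "'a \<Rightarrow> real"
  assumes absv_nonneg: "absv x \<ge> 0"
    and absv_eq_0_iff: "absv x = 0 \<longleftrightarrow> x = 0"
    and absv_mult: "absv (x * y) = absv x * absv y"
    and absv_ultrametric: "absv (x + y) \<le> max (absv x) (absv y)"

lemma absv_0 [simp]: "absv (0::'a::nonarch_field) = 0"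
  by (simp add: absv_eq_0_iff)

lemma absv_1 [simp]: "absv (1::'a::nonarch_field) = 1"
proof -
  have "absv (1::'a) * absv (1::'a) = absv (1::'a) * 1"
    using absv_mult[of "1::'a" 1] by simp
  thus ?thesis
    using absv_eq_0_iff[of "1::'a"] by (metis mult_cancel_left one_neq_zero)
qed

lemma absv_minus [simp]: "absv (- x :: 'a::nonarch_field) = absv x"
proof -
  have "absv (- 1 :: 'a) ^ 2 = 1"
    using absv_mult[of "- 1 :: 'a" "- 1"] by (simp add: power2_eq_square)
  hence "absv (- 1 :: 'a) = 1"
    using absv_nonneg[of "- 1 :: 'a"] by (simp add: power2_eq_1_iff)
  thus ?thesis
    using absv_mult[of "- 1" x] by simp
qed

lemma absv_inverse: "absv (inverse x) = inverse (absv x)"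
proof (cases "x = 0")
  case False
  hence "absv x * absv (inverse x) = 1"
    using absv_mult[of x "inverse x"] by simp
  thus ?thesis
    by (rule inverse_unique[symmetric])
qed simp

lemma absv_minus_commute: "absv (x - y) = absv (y - x)"
  by (metis absv_minus minus_diff_eq)

lemma absv_add_le: "absv x \<le> c \<Longrightarrow> absv y \<le> c \<Longrightarrow> absv (x + y) \<le> c"
  using absv_ultrametric[of x y] by linarith

lemma absv_add_less: "absv x < c \<Longrightarrow> absv y < c \<Longrightarrow> absv (x + y) < c"
  using absv_ultrametric[of x y] by linarith

lemma absv_mult_le_1: "absv x \<le> 1 \<Longrightarrow> absv y \<le> 1 \<Longrightarrow> absv (x * y) \<le> 1"
  by (simp add: absv_mult absv_nonneg mult_le_one)

lemma absv_mult_less_1: "absv x \<le> 1 \<Longrightarrow> absv y < 1 \<Longrightarrow> absv (x * y) < 1"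
  by (metis absv_mult absv_nonneg less_eq_real_def mult_left_le_one_le order_le_less_trans)

definition residue_rel :: "'a::nonarch_field \<Rightarrow> 'a \<Rightarrow> bool" where
  "residue_rel x y \<longleftrightarrow> absv x \<le> 1 \<and> absv y \<le> 1 \<and> absv (x - y) < 1"

lemma part_equivp_residue_rel: "part_equivp residue_rel"
proof (rule part_equivpI)
  show "\<exists>x. residue_rel x x"
    by (rule exI[of _ 0]) (simp add: residue_rel_def)
  show "symp residue_rel"
    by (rule sympI) (auto simp: residue_rel_def absv_minus_commute)
  show "transp residue_rel"
  proof (rule transpI)
    fix x y z assume "residue_rel x y" "residue_rel y z"
    thus "residue_rel x z"
      using absv_add_less[of "x - y" 1 "y - z"] by (simp add: residue_rel_def)
  qed
qed

lemma residue_rel_mult: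
  assumes "residue_rel x x'" "residue_rel y y'"
  shows "residue_rel (x * y) (x' * y')"
proof -
  have "x * y - x' * y' = y * (x - x') + x' * (y - y')"
    by (simp add: algebra_simps)
  moreover have "absv (y * (x - x')) < 1" "absv (x' * (y - y')) < 1"
    using assms by (auto simp: residue_rel_def intro: absv_mult_less_1)
  ultimately show ?thesis
    using assms by (simp add: residue_rel_def absv_mult_le_1 absv_add_less)
qed

lemma residue_rel_add:
  assumes "residue_rel x x'" "residue_rel y y'"
  shows "residue_rel (x + y) (x' + y')"
proof -
  have "x + y - (x' + y') = (x - x') + (y - y')"
    by (simp add: algebra_simps)
  also have "absv \<dots> < 1"
    using assms by (intro absv_add_less) (auto simp: residue_rel_def)
  finally show ?thesis
    using assms by (simp add: residue_rel_def absv_add_le)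
qed

lemma residue_rel_minus: "residue_rel x x' \<Longrightarrow> residue_rel (- x) (- x')"
  by (simp add: residue_rel_def) (metis absv_minus_commute)

lemma residue_rel_absv_less_1_iff:
  assumes "residue_rel x y"
  shows "absv x < 1 \<longleftrightarrow> absv y < 1"
  using assms absv_add_less[of "x - y" 1 y] absv_add_less[of "y - x" 1 x]
  by (auto simp: residue_rel_def absv_minus_commute)

lemma residue_rel_inverse:
  assumes "residue_rel x y"
  shows "residue_rel (if absv x < 1 then 0 else inverse x) (if absv y < 1 then 0 else inverse y)"
proof (cases "absv x < 1")
  case True
  thus ?thesis
    using residue_rel_absv_less_1_iff[OF assms] by (simp add: residue_rel_def)
next
  case False
  hence x: "absv x = 1" and y: "absv y = 1"
    using assms residue_rel_absv_less_1_iff[OF assms] by (auto simp: residue_rel_def)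
  hence nz: "x \<noteq> 0" "y \<noteq> 0"
    by auto
  have "inverse x - inverse y = inverse x * inverse y * (y - x)"
    using nz by (simp add: field_simps)
  hence "absv (inverse x - inverse y) = absv (x - y)"
    by (simp add: absv_mult absv_inverse x y absv_minus_commute)
  thus ?thesis
    using assms x y by (simp add: residue_rel_def absv_inverse)
qed

text \<open>
  The residue field: elements of absolute value at most 1, modulo those of absolute value
  less than 1.
\<close>
quotient_type (overloaded) 'a residue = "'a::nonarch_field" / partial: residue_rel
  by (rule part_equivp_residue_rel)

lift_definition reduction :: "'a::nonarch_field \<Rightarrow> 'a residue"
  is "\<lambda>x. if absv x \<le> 1 then x else 0"
  by (simp add: residue_rel_def)

instantiation residue :: (nonarch_field) field
begin

lift_definition zero_residue :: "'a residue" is 0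
  by (simp add: residue_rel_def)

lift_definition one_residue :: "'a residue" is 1
  by (simp add: residue_rel_def)

lift_definition plus_residue :: "'a residue \<Rightarrow> 'a residue \<Rightarrow> 'a residue" is "(+)"
  by (rule residue_rel_add)

lift_definition uminus_residue :: "'a residue \<Rightarrow> 'a residue" is uminus
  by (rule residue_rel_minus)

definition minus_residue :: "'a residue \<Rightarrow> 'a residue \<Rightarrow> 'a residue" where
  "minus_residue x y = x + - y"

lift_definition times_residue :: "'a residue \<Rightarrow> 'a residue \<Rightarrow> 'a residue" is "(*)"
  by (rule residue_rel_mult)

lift_definition inverse_residue :: "'a residue \<Rightarrow> 'a residue"
  is "\<lambda>x. if absv x < 1 then 0 else inverse x"
  by (rule residue_rel_inverse)

definition divide_residue :: "'a residue \<Rightarrow> 'a residue \<Rightarrow> 'a residue" where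
  "divide_residue x y = x * inverse y"

instance
proof
  fix a b c :: "'a residue"
  show "a * b * c = a * (b * c)"
    by transfer (auto simp: residue_rel_def mult.assoc absv_mult_le_1)
  show "a * b = b * a"
    by transfer (auto simp: residue_rel_def mult.commute absv_mult_le_1)
  show "1 * a = a"
    by transfer (auto simp: residue_rel_def)
  show "a + b + c = a + (b + c)"
    by transfer (auto simp: residue_rel_def add.assoc absv_add_le)
  show "a + b = b + a"
    by transfer (auto simp: residue_rel_def add.commute absv_add_le)
  show "0 + a = a"
    by transfer (auto simp: residue_rel_def)
  show "- a + a = 0"
    by transfer (auto simp: residue_rel_def)
  show "a - b = a + - b"
    by (rule minus_residue_def)
  show "(a + b) * c = a * c + b * c"
    by transfer (auto simp: residue_rel_def algebra_simps absv_mult_le_1 absv_add_le)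
  show "(0::'a residue) \<noteq> 1"
    by transfer (auto simp: residue_rel_def)
  show "a div b = a * inverse b"
    by (rule divide_residue_def)
  show "inverse (0::'a residue) = 0"
    by transfer (auto simp: residue_rel_def)
  show "inverse a * a = 1" if "a \<noteq> 0"
    using that
  proof transfer
    fix x :: 'a
    assume x: "residue_rel x x" and nz: "\<not> residue_rel x 0"
    hence "absv x = 1"
      by (auto simp: residue_rel_def)
    moreover from this have "x \<noteq> 0"
      by auto
    ultimately show "residue_rel ((if absv x < 1 then 0 else inverse x) * x) 1"
      by (simp add: residue_rel_def)
  qed
qed

end

lemma reduction_0 [simp]: "reduction 0 = 0"
  by transfer (simp add: residue_rel_def)

lemma reduction_1 [simp]: "reduction 1 = 1"
  by transfer (simp add: residue_rel_def)

lemma reduction_add: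
  "absv x \<le> 1 \<Longrightarrow> absv y \<le> 1 \<Longrightarrow> reduction (x + y) = reduction x + reduction y"
  by transfer (auto simp: residue_rel_def absv_add_le)

lemma reduction_mult:
  "absv x \<le> 1 \<Longrightarrow> absv y \<le> 1 \<Longrightarrow> reduction (x * y) = reduction x * reduction y"
  by transfer (auto simp: residue_rel_def absv_mult_le_1)

lemma reduction_eq_0_iff: "absv x \<le> 1 \<Longrightarrow> reduction x = 0 \<longleftrightarrow> absv x < 1"
  by transfer (auto simp: residue_rel_def)

lemma reduction_surj: "\<exists>x. absv x \<le> 1 \<and> reduction x = y"
proof (induction y rule: residue.abs_induct)
  case (1 x)
  thus ?case
    by (intro exI[of _ x]) (simp add: reduction.abs_eq residue_rel_def)
qed


section \<open>Subfields and extensions\<close>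

text \<open>
  \<open>'a\<close> plays the role of an algebraic closure of \<open>'k\<close>, with \<open>\<iota>\<close> the embedding;
  the absolute value on \<open>'a\<close> extends that on \<open>'k\<close>.
\<close>
definition is_valued_alg_closure ::
    "('k::nonarch_field \<Rightarrow> 'a::{nonarch_field, alg_closed_field}) \<Rightarrow> bool" where
  "is_valued_alg_closure \<iota> \<longleftrightarrow>
     \<iota> 1 = 1 \<and> (\<forall>x y. \<iota> (x + y) = \<iota> x + \<iota> y) \<and> (\<forall>x y. \<iota> (x * y) = \<iota> x * \<iota> y) \<and>
     (\<forall>x. absv (\<iota> x) = absv x) \<and>
     (\<forall>z. \<exists>f. f \<noteq> 0 \<and> poly (map_poly \<iota> f) z = 0)"

definition is_subfield :: "'a::field set \<Rightarrow> bool" where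
  "is_subfield F \<longleftrightarrow> 0 \<in> F \<and> 1 \<in> F \<and>
     (\<forall>x\<in>F. \<forall>y\<in>F. x + y \<in> F \<and> x * y \<in> F) \<and> (\<forall>x\<in>F. - x \<in> F \<and> inverse x \<in> F)"

definition finite_extension :: "('k::field \<Rightarrow> 'a::field) \<Rightarrow> 'a set \<Rightarrow> bool" where
  "finite_extension \<iota> L \<longleftrightarrow> is_subfield L \<and> range \<iota> \<subseteq> L \<and>
     (\<exists>S. finite S \<and> L \<subseteq> module.span (\<lambda>c x. \<iota> c * x) S)"

definition extension_degree :: "('k::field \<Rightarrow> 'a::field) \<Rightarrow> 'a set \<Rightarrow> nat" where
  "extension_degree \<iota> L = vector_space.dim (\<lambda>c x. \<iota> c * x) L"

lemma vector_space_embedding: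
  assumes "is_valued_alg_closure \<iota>"
  shows "vector_space (\<lambda>c x. \<iota> c * x)"
  using assms by unfold_locales (auto simp: is_valued_alg_closure_def algebra_simps)


section \<open>Rational functions\<close>

definition ratfuns_over :: "'a::field set \<Rightarrow> 'a poly fract set" where
  "ratfuns_over F = {Fract f g | f g. set (coeffs f) \<subseteq> F \<and> set (coeffs g) \<subseteq> F \<and> g \<noteq> 0}"

definition ratfun_degree :: "'a::field poly fract \<Rightarrow> nat" where
  "ratfun_degree \<phi> = (THE n. \<exists>f g. g \<noteq> 0 \<and> coprime f g \<and> \<phi> = Fract f g \<and>
                              n = max (degree f) (degree g))"

text \<open>
  \<open>\<phi> \<circ> \<psi>\<close>. Meaningful unless \<open>\<psi>\<close> is a constant pole of \<open>\<phi>\<close>: the point at infinity is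
  not an element of the type.
\<close>
definition ratfun_comp :: "'a::field poly fract \<Rightarrow> 'a poly fract \<Rightarrow> 'a poly fract" where
  "ratfun_comp \<phi> \<psi> = (THE \<chi>. \<exists>f g. g \<noteq> 0 \<and> coprime f g \<and> \<phi> = Fract f g \<and>
     \<chi> = poly (map_poly (\<lambda>c. to_fract [:c:]) f) \<psi> / poly (map_poly (\<lambda>c. to_fract [:c:]) g) \<psi>)"

definition moebius :: "'a::field \<Rightarrow> 'a \<Rightarrow> 'a \<Rightarrow> 'a \<Rightarrow> 'a poly fract" where
  "moebius a b c d = Fract [:b, a:] [:d, c:]"

text \<open>
  \<open>\<psi> = h \<circ> \<phi> \<circ> h\<inverse>\<close> with \<open>h \<in> PGL(2,F)\<close> given by the matrix with rows \<open>(a, b)\<close> and \<open>(c, d)\<close>;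
  the inverse is represented by the adjugate matrix.
\<close>
definition conjugate_over :: "'a::field set \<Rightarrow> 'a poly fract \<Rightarrow> 'a poly fract \<Rightarrow> bool" where
  "conjugate_over F \<phi> \<psi> \<longleftrightarrow> (\<exists>a\<in>F. \<exists>b\<in>F. \<exists>c\<in>F. \<exists>d\<in>F. a * d - b * c \<noteq> 0 \<and>
     \<psi> = ratfun_comp (moebius a b c d) (ratfun_comp \<phi> (moebius d (- b) (- c) a)))"

lemma ex_coprime_Fract:
  fixes \<phi> :: "'a::field poly fract"
  shows "\<exists>f g. g \<noteq> 0 \<and> coprime f g \<and> \<phi> = Fract f g"
proof -
  have "g \<noteq> 0 \<Longrightarrow> \<exists>f' g'. g' \<noteq> 0 \<and> coprime f' g' \<and> Fract f g = Fract f' g'" for f g :: "'a poly"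
  proof (induction "degree g" arbitrary: f g rule: less_induct)
    case less
    show ?case
    proof (cases "coprime f g")
      case True
      thus ?thesis using less.prems by blast
    next
      case False
      then obtain h where h: "h dvd f" "h dvd g" "\<not> is_unit h"
        by (auto simp: coprime_def)
      obtain f1 g1 where fg: "f = h * f1" "g = h * g1"
        using h by (auto elim!: dvdE)
      have nz: "h \<noteq> 0" "g1 \<noteq> 0"
        using less.prems fg by auto
      have "degree h \<noteq> 0"
        using h(3) nz(1) by (simp add: is_unit_iff_degree)
      hence "degree g1 < degree g"
        using nz by (simp add: fg degree_mult_eq)
      moreover have "Fract f g = Fract f1 g1"
        using nz by (simp add: fg mult_fract_cancel)
      ultimately show ?thesis
        using less.hyps[of g1 f1] nz by simp
    qed
  qed
  thus ?thesis
    by (cases \<phi>) auto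
qed

lemma coprime_poly_bezout:
  fixes f g :: "'a::field poly"
  assumes "coprime f g"
  shows "\<exists>u v. u * f + v * g = 1"
  using assms
proof (induction "euclidean_size g" arbitrary: f g rule: less_induct)
  case less
  show ?case
  proof (cases "g = 0")
    case True
    hence "f dvd 1"
      using less.prems by simp
    then obtain u where "1 = f * u"
      by (rule dvdE)
    thus ?thesis
      using True by (intro exI[of _ u] exI[of _ 0]) (simp add: mult.commute)
  next
    case False
    have "coprime g (f mod g)"
    proof (rule coprimeI)
      fix h assume h: "h dvd g" "h dvd f mod g"
      hence "h dvd f"
        by (simp add: dvd_mod_iff)
      thus "is_unit h"
        using less.prems h(1) by (rule_tac coprime_common_divisor)
    qed
    then obtain u v where uv: "u * g + v * (f mod g) = 1"
      using less.hyps[of "f mod g" g] False mod_size_less[of g f] by blast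
    have "v * f + (u - v * (f div g)) * g = u * g + v * (f - f div g * g)"
      by (simp add: algebra_simps)
    also have "\<dots> = 1"
      using uv by (simp add: minus_div_mult_eq_mod)
    finally show ?thesis
      by blast
  qed
qed

lemma coprime_poly_dvd_mult:
  fixes f g h :: "'a::field poly"
  assumes "coprime f g" "f dvd g * h"
  shows "f dvd h"
proof -
  obtain u v where uv: "u * f + v * g = 1"
    using coprime_poly_bezout[OF assms(1)] by blast
  have "h = (u * f + v * g) * h"
    by (simp add: uv)
  also have "\<dots> = f * (u * h) + v * (g * h)"
    by (simp add: algebra_simps)
  finally show ?thesis
    using assms(2) by (metis dvd_add dvd_mult dvd_triv_left)
qed

lemma coprime_Fract_unique:
  fixes f g f' g' :: "'a::field poly"
  assumes "g \<noteq> 0" "g' \<noteq> 0" "coprime f g" "coprime f' g'" "Fract f g = Fract f' g'"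
  obtains c where "c \<noteq> 0" "f' = smult c f" "g' = smult c g"
proof -
  have eq: "f * g' = f' * g"
    using assms by (simp add: eq_fract)
  have "g dvd g'"
  proof -
    have "g dvd f * g'" "coprime g f"
      using eq assms(3) by (simp_all add: coprime_commute)
    thus ?thesis
      by (rule coprime_poly_dvd_mult[rotated])
  qed
  moreover have "g' dvd g"
  proof -
    have "g' dvd f' * g" "coprime g' f'"
      using assms(4) by (simp_all add: coprime_commute flip: eq)
    thus ?thesis
      by (rule coprime_poly_dvd_mult[rotated])
  qed
  ultimately obtain u w where u: "g' = g * u" and w: "g = g' * w"
    by (metis dvdE)
  have "g * (u * w) = g * 1"
    using w unfolding u by (simp only: mult.assoc mult_1_right)
  hence "u * w = 1"
    using assms(1) mult_left_cancel by blast
  hence "is_unit u"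
    by (metis dvd_triv_left)
  moreover have "u \<noteq> 0"
    using \<open>u * w = 1\<close> by auto
  ultimately have "u \<noteq> 0" "degree u = 0"
    using is_unit_iff_degree[of u] by auto
  then obtain c where c: "u = [:c:]" "c \<noteq> 0"
    by (auto elim: degree_eq_zeroE)
  have g': "g' = smult c g"
    using u c by simp
  have "f' * g = smult c f * g"
    using eq g' by simp
  hence "f' = smult c f"
    using assms(1) mult_right_cancel by blast
  thus ?thesis
    using that c(2) g' by blast
qed

lemma ratfun_degree_Fract:
  fixes f g :: "'a::field poly"
  assumes "g \<noteq> 0" "coprime f g"
  shows "ratfun_degree (Fract f g) = max (degree f) (degree g)"
  unfolding ratfun_degree_def
proof (rule the_equality)
  fix n assume "\<exists>f' g'. g' \<noteq> 0 \<and> coprime f' g' \<and> Fract f g = Fract f' g' \<and>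
                        n = max (degree f') (degree g')"
  then obtain f' g' where *: "g' \<noteq> 0" "coprime f' g'" "Fract f g = Fract f' g'"
      "n = max (degree f') (degree g')"
    by blast
  obtain c where "c \<noteq> 0" "f' = smult c f" "g' = smult c g"
    using coprime_Fract_unique[OF assms(1) *(1) assms(2) *(2) *(3)] .
  thus "n = max (degree f) (degree g)"
    using *(4) by simp
qed (use assms in blast)

lemma ratfun_comp_Fract:
  fixes f g :: "'a::field poly"
  assumes "g \<noteq> 0" "coprime f g"
  shows "ratfun_comp (Fract f g) \<psi> =
    poly (map_poly (\<lambda>c. to_fract [:c:]) f) \<psi> / poly (map_poly (\<lambda>c. to_fract [:c:]) g) \<psi>"
  unfolding ratfun_comp_def
proof (rule the_equality)
  let ?m = "map_poly (\<lambda>c::'a. to_fract [:c:])"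
  fix \<chi> assume "\<exists>f' g'. g' \<noteq> 0 \<and> coprime f' g' \<and> Fract f g = Fract f' g' \<and>
                        \<chi> = poly (?m f') \<psi> / poly (?m g') \<psi>"
  then obtain f' g' where *: "g' \<noteq> 0" "coprime f' g'" "Fract f g = Fract f' g'"
      "\<chi> = poly (?m f') \<psi> / poly (?m g') \<psi>"
    by blast
  obtain c where c: "c \<noteq> 0" "f' = smult c f" "g' = smult c g"
    using coprime_Fract_unique[OF assms(1) *(1) assms(2) *(2) *(3)] .
  have m: "?m (smult c q) = smult (to_fract [:c:]) (?m q)" for q
    by (rule poly_eqI) (simp add: coeff_map_poly flip: to_fract_mult)
  have "to_fract [:c:] \<noteq> 0"
    using c(1) by simp
  thus "\<chi> = poly (?m f) \<psi> / poly (?m g) \<psi>"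
    by (simp add: *(4) c(2,3) m)
qed (use assms in blast)

lemma ratfun_comp_moebius_inverse:
  fixes a b c d :: "'a::field"
  assumes det: "a * d - b * c \<noteq> 0"
  shows "ratfun_comp (moebius a b c d) (moebius d (- b) (- c) a) = to_fract [:0, 1:]"
proof -
  have nz: "[:d, c:] \<noteq> 0" "[:a, - c:] \<noteq> 0"
    using det by auto
  have "coprime [:b, a:] [:d, c:]"
  proof (rule coprimeI)
    fix h assume h: "h dvd [:b, a:]" "h dvd [:d, c:]"
    have "h dvd smult a [:d, c:] - smult c [:b, a:]"
      by (intro dvd_diff dvd_smult h)
    also have "smult a [:d, c:] - smult c [:b, a:] = [:a * d - b * c:]"
      by (simp add: mult.commute)
    finally have "h dvd [:a * d - b * c:]" .
    moreover have "is_unit [:a * d - b * c:]"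
      using det by (simp add: is_unit_const_poly_iff dvd_field_iff)
    ultimately show "is_unit h"
      by (rule dvd_unit_imp_unit)
  qed
  note comp = ratfun_comp_Fract[OF nz(1) this]
  let ?X = "Fract [:- b, d:] [:a, - c:]"
  have P: "poly (map_poly (\<lambda>c. to_fract [:c:]) [:u, v:]) ?X =
          Fract ([:u:] * [:a, - c:] + [:v:] * [:- b, d:]) [:a, - c:]" for u v :: 'a
  proof -
    have "map_poly (\<lambda>c. to_fract [:c:]) [:u, v:] = [:to_fract [:u:], to_fract [:v:]:]"
      by (rule poly_eqI) (simp add: coeff_map_poly coeff_pCons split: nat.split)
    hence "poly (map_poly (\<lambda>c. to_fract [:c:]) [:u, v:]) ?X = to_fract [:u:] + ?X * to_fract [:v:]"
      by simp
    also have "\<dots> = Fract ([:u:] * [:a, - c:] + [:v:] * [:- b, d:]) [:a, - c:]"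
    proof -
      have "Fract u' 1 + Fract p q * Fract v' 1 = Fract (u' * q + v' * p) q"
        if "q \<noteq> 0" for p q u' v' :: "'a poly"
        using that by (simp add: mult.commute)
      from this[OF nz(2)] show ?thesis
        unfolding to_fract_def .
    qed
    finally show ?thesis .
  qed
  have 1: "[:b:] * [:a, - c:] + [:a:] * [:- b, d:] = [:0, a * d - b * c:]"
    and 2: "[:d:] * [:a, - c:] + [:c:] * [:- b, d:] = [:a * d - b * c:]"
    by (simp_all add: mult.commute)
  have 3: "[:0, D:] * q * 1 = [:0, 1:] * (q * [:D:])" for D :: 'a and q
    by simp
  show ?thesis
    unfolding moebius_def comp P 1 2
    unfolding divide_fract to_fract_def
  proof (subst eq_fract(1))
    show "[:a, - c:] * [:a * d - b * c:] \<noteq> 0"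
      using nz(2) det by (intro no_zero_divisors) simp_all
    show "[:0, a * d - b * c:] * [:a, - c:] * 1 = [:0, 1:] * ([:a, - c:] * [:a * d - b * c:])"
      by (rule 3)
  qed simp
qed


section \<open>Good reduction\<close>

text \<open>
  The coefficients are reduced into the residue field of the whole ambient field, which contains
  that of \<open>F\<close>; the degree of the reduced function does not depend on this. If the reduction of
  \<open>g\<close> vanishes, the reduced function is the constant \<open>\<infinity>\<close>; then \<open>Fract _ 0 = 0\<close>, which likewise
  has degree 0.
\<close>
definition good_reduction :: "'a::nonarch_field set \<Rightarrow> 'a poly fract \<Rightarrow> bool" where
  "good_reduction F \<phi> \<longleftrightarrow> (\<exists>f g.
     set (coeffs f) \<subseteq> {x\<in>F. absv x \<le> 1} \<and> set (coeffs g) \<subseteq> {x\<in>F. absv x \<le> 1} \<and>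
     g \<noteq> 0 \<and> \<phi> = Fract f g \<and>
     (\<exists>x\<in>set (coeffs f) \<union> set (coeffs g). absv x = 1) \<and>
     ratfun_degree (Fract (map_poly reduction f) (map_poly reduction g)) = ratfun_degree \<phi>)"

definition potentially_good_reduction ::
    "('k::nonarch_field \<Rightarrow> 'a::nonarch_field) \<Rightarrow> 'a poly fract \<Rightarrow> bool" where
  "potentially_good_reduction \<iota> \<phi> \<longleftrightarrow>
     (\<exists>L. finite_extension \<iota> L \<and> (\<exists>\<psi>. conjugate_over L \<phi> \<psi> \<and> good_reduction L \<psi>))"


section \<open>The degree bound\<close>

definition has_p_exponent :: "nat \<Rightarrow> nat \<Rightarrow> nat \<Rightarrow> bool" where
  "has_p_exponent p n e \<longleftrightarrow> p > 0 \<and> e \<ge> 1 \<and> (\<exists>m\<ge>1. n = m * p ^ e \<and> \<not> p dvd m)"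

definition degree_bound :: "nat \<Rightarrow> nat \<Rightarrow> nat" where
  "degree_bound p d =
     (if d \<ge> 3 \<and> (\<exists>e. has_p_exponent p d e) then p ^ (THE e. has_p_exponent p d e) * (d - 1)
      else if d \<ge> 3 \<and> (\<exists>e. has_p_exponent p (d - 1) e)
        then d * p ^ (THE e. has_p_exponent p (d - 1) e)
      else d + 1)"

lemma has_p_exponent_unique:
  assumes "has_p_exponent p n e" "has_p_exponent p n e'"
  shows "e = e'"
proof -
  have le: "e \<le> e'" if *: "has_p_exponent p n e" "has_p_exponent p n e'" for e e'
  proof (rule ccontr)
    assume "\<not> e \<le> e'"
    then obtain k where k: "e = e' + Suc k"
      using less_imp_Suc_add[of e' e] by auto
    obtain m m' where m: "m * p ^ e = m' * p ^ e'" "\<not> p dvd m'" "p > 0"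
      using * unfolding has_p_exponent_def by metis
    have "(m * p ^ k * p) * p ^ e' = m' * p ^ e'"
      using m(1) by (simp add: k power_add mult_ac)
    hence "m * p ^ k * p = m'"
      using m(3) by simp
    thus False
      using m(2) by auto
  qed
  show ?thesis
    using le[of e e'] le[of e' e] assms by simp
qed

end

theory Submission
  imports Defs "HOL-Algebra.Exponent"
begin

text \<open>
  Good reduction of the conjugate of \<open>\<phi> = f / g\<close> by a matrix \<open>M\<close> is equivalent to a norm identity for
  the homogeneous lift of \<open>\<phi>\<close>, which depends only on the norm \<open>v \<mapsto> \<parallel>M v\<parallel>\<close> up to scaling, that is, on a
  disc with centre \<open>a\<close> and radius \<open>\<bar>c\<bar>\<close>. One has to find a centre in the disc and a scalar of
  absolute value \<open>\<bar>c\<bar>\<close> over a small extension.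

  A polynomial of degree \<open>n = m p ^ e\<close> over the field all of whose roots lie in the disc has a Hasse
  derivative of degree \<open>p ^ e\<close> with the same property, hence gives a centre of degree at most \<open>p ^ e\<close>. Once
  the centre is rational, comparing two coefficients of maximal absolute value of the conjugate map
  expresses a power of \<open>\<bar>c\<bar>\<close> as the absolute value of an element of the field. If the reduction does not
  fix \<open>\<infinity>\<close>, the centre comes from the poles or from the fixed points, and the radius from a
  fixed point; in the remaining case \<open>\<infinity>\<close> is moved into the class of a fixed point. If
  the reduction fixes \<open>\<infinity>\<close> with nonzero multiplier, the \<open>d - 1\<close> other preimages of \<open>\<phi>(\<infinity>)\<close> are used.
  If the multiplier is 0, iterating \<open>\<phi>\<close> from \<open>\<infinity>\<close> gives a rational point that a small translate of
  \<open>\<phi>\<close> fixes, and the \<open>d\<close> other fixed points of that translate are used.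
\<close>

section \<open>Ultrametric estimates\<close>

text \<open>The bound is the cost of a centre times the cost of a radius. If the reduction does not
  fix \<infinity>, a centre is free; unless it reduces to a fixed point, comparing coefficients of
  degree d and 0 gives a radius by a root of order \<open>d + 1\<close>. If \<infinity> is fixed
  with nonzero multiplier, it is unramified in the reduction, so the other \<open>d - 1\<close>
  preimages of \<phi>(\<infinity>) all lie in the disc: the centre costs at most the p-part of
  \<open>d - 1\<close>, the radius at most d. If the multiplier is 0, ramification leaves an
  uncontrolled number of preimages in the disc, but \<infinity> is a simple fixed point of the
  reduction because its multiplier is not 1. So exactly one fixed point of \<phi> reduces to it, and
  d others lie in the disc: the centre costs at most the p-part of d, and ramification lowers the
  radius to at most \<open>d - 1\<close>. The obstacle is that the exceptional fixed point has to be
  divided out over the ground field, which need not be complete, so that point need not be rational.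
  A translation smaller than the radius does not change the reduced map fixing \<infinity> enough to
  matter, and it can move the exceptional fixed point to a nearby rational point.\<close>

lemma absv_power: "absv (x ^ n :: 'a::nonarch_field) = absv x ^ n"
  by (induction n) (simp_all add: absv_mult)

lemma absv_divide: "absv (x / y) = absv x / absv (y :: 'a::nonarch_field)"
  by (simp add: divide_inverse absv_mult absv_inverse)

lemma absv_pos_iff: "absv x > 0 \<longleftrightarrow> x \<noteq> (0::'a::nonarch_field)"
  using absv_nonneg[of x] absv_eq_0_iff[of x] by linarith

lemma absv_diff_le: "absv x \<le> c \<Longrightarrow> absv y \<le> c \<Longrightarrow> absv (x - y :: 'a::nonarch_field) \<le> c"
  using absv_add_le[of x c "- y"] by simp

lemma absv_add_dominant:
  fixes x y :: "'a::nonarch_field"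
  assumes "absv y < absv x"
  shows "absv (x + y) = absv x"
proof (rule antisym)
  show "absv (x + y) \<le> absv x"
    using assms by (intro absv_add_le) auto
  show "absv x \<le> absv (x + y)"
    using absv_ultrametric[of "x + y" "- y"] assms by simp
qed

lemma absv_diff_dominant: "absv y < absv x \<Longrightarrow> absv (x - y :: 'a::nonarch_field) = absv x"
  using absv_add_dominant[of "- y" x] by simp

lemma absv_sum_le:
  fixes f :: "'b \<Rightarrow> 'a::nonarch_field"
  assumes "\<And>i. i \<in> A \<Longrightarrow> absv (f i) \<le> c" "c \<ge> 0"
  shows "absv (sum f A) \<le> c"
  using assms by (induction A rule: infinite_finite_induct) (auto intro: absv_add_le)

lemma absv_sum_less:
  fixes f :: "'b \<Rightarrow> 'a::nonarch_field"
  assumes "\<And>i. i \<in> A \<Longrightarrow> absv (f i) < c" "c > 0"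
  shows "absv (sum f A) < c"
  using assms by (induction A rule: infinite_finite_induct) (auto intro: absv_add_less)

lemma absv_of_nat_le_1: "absv (of_nat n :: 'a::nonarch_field) \<le> 1"
  by (induction n) (auto intro: absv_add_le)

lemma absv_mult_le:
  "absv (x :: 'a::nonarch_field) \<le> a \<Longrightarrow> absv y \<le> b \<Longrightarrow> absv (x * y) \<le> a * b"
  unfolding absv_mult by (metis absv_nonneg mult_mono order_trans)

lemma poly_altdef_le:
  fixes P :: "'a::comm_semiring_1 poly"
  assumes "degree P \<le> n"
  shows "poly P x = (\<Sum>i\<le>n. coeff P i * x ^ i)"
  unfolding poly_altdef using assms
  by (intro sum.mono_neutral_left) (auto simp: coeff_eq_0)

lemma absv_poly_le:
  fixes P :: "'a::nonarch_field poly"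
  assumes "\<And>i. absv (coeff P i) \<le> S" "absv x \<le> 1"
  shows "absv (poly P x) \<le> S"
proof -
  have S: "S \<ge> 0"
    using assms(1)[of 0] absv_nonneg[of "coeff P 0"] by linarith
  have "absv (coeff P i * x ^ i) \<le> S * 1" for i
    by (intro absv_mult_le assms) (simp add: absv_power absv_nonneg assms power_le_one)
  thus ?thesis
    unfolding poly_altdef using S by (intro absv_sum_le) auto
qed

lemma absv_poly_dominant:
  fixes P :: "'a::nonarch_field poly"
  assumes "degree P \<le> n" "\<And>i. absv (coeff P i) \<le> S" "absv (coeff P n) = S" "S > 0" "absv x > 1"
  shows "absv (poly P x) = S * absv x ^ n"
proof -
  have "poly P x = coeff P n * x ^ n + (\<Sum>i<n. coeff P i * x ^ i)"
    using poly_altdef_le[OF assms(1), of x] by (simp flip: lessThan_Suc_atMost)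
  moreover have "absv (\<Sum>i<n. coeff P i * x ^ i) < S * absv x ^ n"
  proof (rule absv_sum_less)
    fix i assume "i \<in> {..<n}"
    hence "absv x ^ i < absv x ^ n"
      using assms(5) by simp
    hence "S * absv x ^ i < S * absv x ^ n"
      using assms(4) by simp
    moreover have "absv (coeff P i * x ^ i) \<le> S * absv x ^ i"
      by (intro absv_mult_le assms) (simp add: absv_power)
    ultimately show "absv (coeff P i * x ^ i) < S * absv x ^ n"
      by linarith
  qed (use assms in simp)
  ultimately show ?thesis
    using absv_add_dominant[of "\<Sum>i<n. coeff P i * x ^ i" "coeff P n * x ^ n"]
    by (simp add: absv_mult absv_power assms)
qed

section \<open>The residue field of an algebraically closed field\<close>

definition integral_poly :: "'a::nonarch_field poly \<Rightarrow> bool" where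
  "integral_poly P \<longleftrightarrow> (\<forall>i. absv (coeff P i) \<le> 1)"

lemma integral_poly_mult: "integral_poly P \<Longrightarrow> integral_poly Q \<Longrightarrow> integral_poly (P * Q)"
  unfolding integral_poly_def coeff_mult
  by (auto intro!: absv_sum_le absv_mult_le_1)

lemma integral_poly_eval: "integral_poly P \<Longrightarrow> absv x \<le> 1 \<Longrightarrow> absv (poly P x) \<le> 1"
  unfolding integral_poly_def by (rule absv_poly_le) auto

abbreviation reduce :: "'a::nonarch_field poly \<Rightarrow> 'a residue poly" where
  "reduce \<equiv> map_poly reduction"

lemma coeff_reduce [simp]: "coeff (reduce P) i = reduction (coeff P i)"
  by (simp add: coeff_map_poly)

lemma reduction_sum:
  assumes "\<And>i. i \<in> A \<Longrightarrow> absv (f i :: 'a::nonarch_field) \<le> 1"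
  shows "reduction (sum f A) = (\<Sum>i\<in>A. reduction (f i))"
  using assms
  by (induction A rule: infinite_finite_induct) (auto simp: reduction_add absv_sum_le)

lemma reduction_power: "absv x \<le> 1 \<Longrightarrow> reduction (x ^ n) = reduction (x::'a::nonarch_field) ^ n"
  by (induction n) (auto simp: reduction_mult absv_power absv_nonneg power_le_one)

lemma reduce_mult:
  assumes "integral_poly P" "integral_poly Q"
  shows "reduce (P * Q) = reduce P * reduce (Q :: 'a::nonarch_field poly)"
proof (rule poly_eqI)
  fix n
  have "absv (coeff P i) \<le> 1" "absv (coeff Q i) \<le> 1" for i
    using assms by (auto simp: integral_poly_def)
  thus "coeff (reduce (P * Q)) n = coeff (reduce P * reduce Q) n"
    by (simp add: coeff_mult reduction_sum reduction_mult absv_mult_le_1)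
qed

lemma poly_reduce:
  assumes "integral_poly P" "absv x \<le> 1"
  shows "poly (reduce P) (reduction x) = reduction (poly P (x::'a::nonarch_field))"
proof -
  have "absv (coeff P i) \<le> 1" "absv (x ^ i) \<le> 1" for i
    using assms by (auto simp: integral_poly_def absv_power absv_nonneg power_le_one)
  moreover have "degree (reduce P) \<le> degree P"
    by (intro degree_le) (simp add: coeff_eq_0)
  ultimately show ?thesis
    using assms(2)
    by (simp add: poly_altdef_le[of _ "degree P"] reduction_sum reduction_mult reduction_power
          absv_mult_le_1)
qed

lemma reduce_eq_0_iff:
  "integral_poly P \<Longrightarrow> reduce P = 0 \<longleftrightarrow> (\<forall>i. absv (coeff P i) < 1)"
  by (auto simp: poly_eq_iff integral_poly_def reduction_eq_0_iff)

text \<open>The residue field is again algebraically closed: Q divided by its leading coefficient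
  lifts to a monic integral polynomial, and a root of the lift is integral and reduces to a root of
  Q.\<close>

lemma ex_root_residue:
  fixes Q :: "'a::{nonarch_field, alg_closed_field} residue poly"
  assumes "degree Q > 0"
  obtains z :: 'a where "absv z \<le> 1" "poly Q (reduction z) = 0"
proof -
  define n where "n = degree Q"
  define l where "l = (\<lambda>i. SOME x::'a. absv x \<le> 1 \<and> reduction x = coeff Q i / lead_coeff Q)"
  have l: "absv (l i) \<le> 1" "reduction (l i) = coeff Q i / lead_coeff Q" for i
    using someI_ex[OF reduction_surj[of "coeff Q i / lead_coeff Q"]] by (auto simp: l_def)
  define P where "P = monom 1 n + (\<Sum>i<n. monom (l i) i)"
  have cP: "coeff P i = (if i = n then 1 else if i < n then l i else 0)" for i
    by (simp add: P_def coeff_sum)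
  have n: "n > 0" "lead_coeff Q \<noteq> 0"
    using assms by (auto simp: n_def)
  have le: "degree P \<le> n"
    by (intro degree_le) (auto simp: cP)
  moreover have "n \<le> degree P"
    by (intro le_degree) (auto simp: cP)
  ultimately have "degree P > 0"
    using n by simp
  then obtain z where z: "poly P z = 0"
    using alg_closed_imp_poly_has_root by blast
  have int: "integral_poly P"
    by (auto simp: integral_poly_def cP l)
  have z1: "absv z \<le> 1"
  proof (rule ccontr)
    assume "\<not> absv z \<le> 1"
    hence "absv (poly P z) = 1 * absv z ^ n"
      using int le by (intro absv_poly_dominant) (auto simp: cP integral_poly_def)
    thus False
      using z \<open>\<not> absv z \<le> 1\<close> by auto
  qed
  have "smult (lead_coeff Q) (reduce P) = Q"
    using n by (intro poly_eqI) (auto simp: cP l n_def coeff_eq_0)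
  hence "poly Q (reduction z) = lead_coeff Q * poly (reduce P) (reduction z)"
    by (metis poly_smult)
  also have "\<dots> = 0"
    using int z1 z by (simp add: poly_reduce)
  finally show ?thesis
    using that z1 by blast
qed

text \<open>A nonconstant common factor of the reductions would have a root in the residue field,
  and at a lift of that root both values would have absolute value below 1.\<close>

lemma coprime_reduceI:
  fixes P Q :: "'a::{nonarch_field, alg_closed_field} poly"
  assumes "integral_poly P" "integral_poly Q" "reduce P \<noteq> 0 \<or> reduce Q \<noteq> 0"
    and "\<And>z. absv z \<le> 1 \<Longrightarrow> absv (poly P z) = 1 \<or> absv (poly Q z) = 1"
  shows "coprime (reduce P) (reduce Q)"
proof (rule coprimeI)
  fix h assume h: "h dvd reduce P" "h dvd reduce Q"
  have "h \<noteq> 0"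
    using h assms(3) by auto
  moreover have "degree h = 0"
  proof (rule ccontr)
    assume "degree h \<noteq> 0"
    then obtain z :: 'a where z: "absv z \<le> 1" "poly h (reduction z) = 0"
      using ex_root_residue by blast
    have "poly (reduce P) (reduction z) = 0" "poly (reduce Q) (reduction z) = 0"
      using h z(2) by (auto elim!: dvdE)
    hence "reduction (poly P z) = 0" "reduction (poly Q z) = 0"
      using assms(1,2) z(1) by (simp_all add: poly_reduce)
    hence "absv (poly P z) < 1" "absv (poly Q z) < 1"
      using assms(1,2) z(1) by (simp_all add: reduction_eq_0_iff integral_poly_eval)
    thus False
      using assms(4)[OF z(1)] by auto
  qed
  ultimately show "is_unit h"
    by (simp add: is_unit_iff_degree)
qed

text \<open>The largest coefficient is scaled to 1, so the reduction is a nonzero polynomial; over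
  the algebraically closed residue field it takes a nonzero value.\<close>

lemma gauss_norm_attained:
  fixes P :: "'a::{nonarch_field, alg_closed_field} poly"
  obtains z where "absv z \<le> 1" "\<And>i. absv (coeff P i) \<le> absv (poly P z)"
proof (cases "P = 0")
  case True
  thus ?thesis using that[of 0] by simp
next
  case False
  define M where "M = Max ((\<lambda>i. absv (coeff P i)) ` {..degree P})"
  have "M \<in> (\<lambda>i. absv (coeff P i)) ` {..degree P}"
    unfolding M_def by (intro Max_in) auto
  then obtain k where k: "M = absv (coeff P k)"
    by auto
  have M: "absv (coeff P i) \<le> M" for i
  proof (cases "i \<le> degree P")
    case True
    thus ?thesis unfolding M_def by (intro Max_ge) auto
  next
    case False
    thus ?thesis using k absv_nonneg by (simp add: coeff_eq_0)
  qed
  define m where "m = coeff P k"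
  have m: "m \<noteq> 0" "absv m = M"
    using M[of "degree P"] False k absv_pos_iff[of "lead_coeff P"] absv_pos_iff[of m]
    by (auto simp: m_def)
  define Q where "Q = smult (inverse m) P"
  have int: "integral_poly Q"
    using M m absv_pos_iff[of m]
    by (auto simp: integral_poly_def Q_def absv_divide divide_inverse_commute[symmetric] divide_le_eq)
  have "coeff Q k = 1"
    using m by (simp add: Q_def m_def)
  hence nz: "reduce Q \<noteq> 0"
    by (metis coeff_0 coeff_reduce reduction_1 zero_neq_one)
  obtain z :: 'a where z: "absv z \<le> 1" "poly (reduce Q) (reduction z) \<noteq> 0"
  proof (cases "degree (reduce Q) = 0")
    case True
    then obtain c where "reduce Q = [:c:]"
      by (auto elim: degree_eq_zeroE)
    thus ?thesis using that[of 0] nz by auto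
  next
    case False
    \<comment> \<open>A root of \<open>reduce Q - 1\<close> is a point where the reduction takes the
      value 1.\<close>
    hence "degree (reduce Q - 1) > 0"
      using degree_add_eq_left[of "- 1" "reduce Q"] by simp
    then obtain z :: 'a where "absv z \<le> 1" "poly (reduce Q - 1) (reduction z) = 0"
      using ex_root_residue by blast
    thus ?thesis using that[of z] by auto
  qed
  have "absv (poly Q z) = 1"
    using z int integral_poly_eval[OF int z(1)]
    by (simp add: poly_reduce reduction_eq_0_iff)
  hence "absv (poly P z) = M"
    using m absv_pos_iff[of m] by (auto simp: Q_def absv_divide divide_inverse_commute[symmetric])
  thus ?thesis
    using that[OF z(1)] M by simp
qed

section \<open>Finite extensions\<close>

lemma subfield_sum:
  "is_subfield F \<Longrightarrow> (\<And>i. i \<in> A \<Longrightarrow> f i \<in> F) \<Longrightarrow> sum f A \<in> F"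
  by (induction A rule: infinite_finite_induct) (auto simp: is_subfield_def)

lemma subfield_diff: "is_subfield F \<Longrightarrow> x \<in> F \<Longrightarrow> y \<in> F \<Longrightarrow> x - y \<in> F"
  unfolding is_subfield_def by (metis diff_conv_add_uminus)

lemma subfield_divide: "is_subfield F \<Longrightarrow> x \<in> F \<Longrightarrow> y \<in> F \<Longrightarrow> x / y \<in> F"
  unfolding is_subfield_def by (metis divide_inverse)

lemma subfield_power: "is_subfield F \<Longrightarrow> x \<in> F \<Longrightarrow> x ^ n \<in> F"
  by (induction n) (auto simp: is_subfield_def)

lemma subfield_of_nat: "is_subfield F \<Longrightarrow> of_nat n \<in> F"
  by (induction n) (auto simp: is_subfield_def)

definition poly_over :: "'a::field set \<Rightarrow> 'a poly \<Rightarrow> bool" where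
  "poly_over F P \<longleftrightarrow> (\<forall>i. coeff P i \<in> F)"

lemma poly_over_iff_coeffs: "is_subfield F \<Longrightarrow> poly_over F P \<longleftrightarrow> set (coeffs P) \<subseteq> F"
  unfolding poly_over_def using forall_coeffs_conv[of "\<lambda>c. c \<in> F" P]
  by (auto simp: is_subfield_def)

lemma poly_over_mono: "poly_over F P \<Longrightarrow> F \<subseteq> L \<Longrightarrow> poly_over L P"
  by (auto simp: poly_over_def)

context
  fixes F :: "'a::field set"
  assumes F: "is_subfield F"
begin

lemma poly_over_add: "poly_over F P \<Longrightarrow> poly_over F Q \<Longrightarrow> poly_over F (P + Q)"
  using F by (auto simp: poly_over_def is_subfield_def)

lemma poly_over_diff: "poly_over F P \<Longrightarrow> poly_over F Q \<Longrightarrow> poly_over F (P - Q)"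
  using F by (auto simp: poly_over_def intro: subfield_diff)

lemma poly_over_mult: "poly_over F P \<Longrightarrow> poly_over F Q \<Longrightarrow> poly_over F (P * Q)"
  using F by (auto simp: poly_over_def is_subfield_def intro!: coeff_mult_semiring_closed)

lemma poly_over_smult: "c \<in> F \<Longrightarrow> poly_over F P \<Longrightarrow> poly_over F (smult c P)"
  using F by (auto simp: poly_over_def is_subfield_def)

lemma poly_over_pCons: "c \<in> F \<Longrightarrow> poly_over F P \<Longrightarrow> poly_over F (pCons c P)"
  by (auto simp: poly_over_def coeff_pCons split: nat.splits)

lemma poly_over_0: "poly_over F 0"
  using F by (auto simp: poly_over_def is_subfield_def)

lemma poly_over_power: "poly_over F P \<Longrightarrow> poly_over F (P ^ n)"
  using F
proof (induction n)
  case 0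
  thus ?case by (auto simp: poly_over_def is_subfield_def)
next
  case (Suc n)
  thus ?case by (simp add: poly_over_mult)
qed

lemma poly_over_sum: "(\<And>i. i \<in> A \<Longrightarrow> poly_over F (f i)) \<Longrightarrow> poly_over F (sum f A)"
  by (induction A rule: infinite_finite_induct) (auto intro: poly_over_add poly_over_0)

lemma poly_over_pcompose: "poly_over F P \<Longrightarrow> poly_over F Q \<Longrightarrow> poly_over F (pcompose P Q)"
  using F by (auto simp: poly_over_def is_subfield_def intro!: coeff_pcompose_semiring_closed)

lemma poly_over_eval: "poly_over F P \<Longrightarrow> x \<in> F \<Longrightarrow> poly P x \<in> F"
  using F subfield_power[OF F, of x] unfolding poly_altdef
  by (intro subfield_sum) (auto simp: poly_over_def is_subfield_def)

end

lemmas poly_over_intros = poly_over_add poly_over_diff poly_over_mult poly_over_smult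
  poly_over_pCons poly_over_0 poly_over_power poly_over_sum poly_over_pcompose

text \<open>A spanning set with at most n elements stands in for a basis: products of spanning sets
  bound the degree of a tower, even when the polynomial whose root is adjoined is reducible.\<close>

definition ext_of_degree_le :: "('k::field \<Rightarrow> 'a::field) \<Rightarrow> nat \<Rightarrow> 'a set \<Rightarrow> bool" where
  "ext_of_degree_le \<iota> n L \<longleftrightarrow> is_subfield L \<and> range \<iota> \<subseteq> L \<and>
     (\<exists>S. finite S \<and> card S \<le> n \<and> L \<subseteq> {\<Sum>s\<in>S. \<iota> (c s) * s | c. True})"

lemma ext_of_degree_le_mono: "ext_of_degree_le \<iota> m L \<Longrightarrow> m \<le> n \<Longrightarrow> ext_of_degree_le \<iota> n L"
  unfolding ext_of_degree_le_def by (meson order_trans)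

lemma ext_of_degree_le_subfield: "ext_of_degree_le \<iota> m L \<Longrightarrow> is_subfield L"
  unfolding ext_of_degree_le_def by simp

context
  fixes \<iota> :: "'k::nonarch_field \<Rightarrow> 'a::{nonarch_field, alg_closed_field}"
  assumes closure: "is_valued_alg_closure \<iota>"
begin

lemma embedding_simps:
  "\<iota> 1 = 1" "\<iota> (x + y) = \<iota> x + \<iota> y" "\<iota> (x * y) = \<iota> x * \<iota> y" "absv (\<iota> x) = absv x"
  "\<iota> 0 = 0" "\<iota> (- x) = - \<iota> x" "\<iota> (inverse x) = inverse (\<iota> x)" "\<iota> x = 0 \<longleftrightarrow> x = 0"
proof -
  show 1: "\<iota> 1 = 1" "\<iota> (x + y) = \<iota> x + \<iota> y" "\<iota> (x * y) = \<iota> x * \<iota> y" "absv (\<iota> x) = absv x" for x y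
    using closure by (auto simp: is_valued_alg_closure_def)
  show 0: "\<iota> 0 = 0"
    using 1(2)[of 0 0] by (metis add_cancel_left_left add_0)
  show "\<iota> (- x) = - \<iota> x"
    using 1(2)[of x "- x"] 0 by (simp add: eq_neg_iff_add_eq_0 add.commute)
  show *: "\<iota> x = 0 \<longleftrightarrow> x = 0" for x
    using 1(4)[of x] by (metis absv_eq_0_iff)
  show "\<iota> (inverse x) = inverse (\<iota> x)"
  proof (cases "x = 0")
    case False
    thus ?thesis
      using 1(3)[of x "inverse x"] 1(1) inverse_unique[of "\<iota> x" "\<iota> (inverse x)"] by simp
  qed (simp add: 0)
qed

lemma subfield_range: "is_subfield (range \<iota>)"
  unfolding is_subfield_def
proof (intro conjI ballI)
  show "0 \<in> range \<iota>" "1 \<in> range \<iota>"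
    by (rule range_eqI[of _ _ 0], simp add: embedding_simps, rule range_eqI[of _ _ 1], simp add: embedding_simps)
  fix x y assume "x \<in> range \<iota>" "y \<in> range \<iota>"
  then obtain u v where "x = \<iota> u" "y = \<iota> v" by blast
  thus "x + y \<in> range \<iota>" "x * y \<in> range \<iota>" "- x \<in> range \<iota>" "inverse x \<in> range \<iota>"
    by (simp_all flip: embedding_simps)
qed

lemma ext_of_degree_le_range: "ext_of_degree_le \<iota> 1 (range \<iota>)"
  unfolding ext_of_degree_le_def using subfield_range
  by (auto intro!: exI[of _ "{1}"])

text \<open>Every element of the ambient field is algebraic, so inverses come for free.\<close>
lemma subfield_if_subring:
  assumes "range \<iota> \<subseteq> R" "\<And>x y. x \<in> R \<Longrightarrow> y \<in> R \<Longrightarrow> x + y \<in> R \<and> x * y \<in> R"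
  shows "is_subfield R"
proof -
  have const: "\<iota> x \<in> R" for x
    using assms(1) by auto
  have minus: "- x \<in> R" if "x \<in> R" for x
  proof -
    have "\<iota> (- 1) * x \<in> R"
      using assms(2) const that by blast
    thus ?thesis by (simp add: embedding_simps)
  qed
  have eval: "poly (map_poly \<iota> f) x \<in> R" if "x \<in> R" for f x
  proof (induction f)
    case 0
    show ?case using const[of 0] by (simp add: embedding_simps)
  next
    case (pCons c f)
    thus ?case using that const assms(2) by (simp add: map_poly_pCons embedding_simps)
  qed
  have inverse: "inverse x \<in> R" if "x \<in> R" "x \<noteq> 0" for x
  proof -
    have "f \<noteq> 0 \<Longrightarrow> poly (map_poly \<iota> f) x = 0 \<Longrightarrow> inverse x \<in> R" for f
    proof (induction f)
      case (pCons c f)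
      show ?case
      proof (cases "c = 0")
        case True
        thus ?thesis using pCons that(2) by (simp add: map_poly_pCons embedding_simps)
      next
        case False
        define y where "y = poly (map_poly \<iota> f) x"
        have "\<iota> c + x * y = 0"
          using pCons.prems by (simp add: map_poly_pCons embedding_simps y_def)
        hence "x * y = - \<iota> c"
          by (simp add: eq_neg_iff_add_eq_0 add.commute)
        moreover have "x * (\<iota> (- inverse c) * y) = - (inverse (\<iota> c) * (x * y))"
          by (simp add: embedding_simps del: inverse_eq_divide)
        ultimately have "x * (\<iota> (- inverse c) * y) = 1"
          using False by (simp add: embedding_simps)
        hence "inverse x = \<iota> (- inverse c) * y"
          by (rule inverse_unique)
        thus ?thesis using assms(2) const eval[OF that(1)] by (simp add: y_def)
      qed
    qed simp
    thus ?thesis using closure unfolding is_valued_alg_closure_def by blast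
  qed
  have "0 \<in> R" "1 \<in> R"
    using const[of 0] const[of 1] by (simp_all add: embedding_simps)
  moreover have "inverse x \<in> R" if "x \<in> R" for x
    using inverse[OF that] \<open>0 \<in> R\<close> by (cases "x = 0") auto
  ultimately show ?thesis
    using assms(2) minus by (auto simp: is_subfield_def)
qed

text \<open>\<open>F[b]\<close> is a field because every element is algebraic, and division by P
  leaves only the powers of b below \<open>degree P\<close> as generators over F.\<close>

lemma adjoin_root:
  assumes "ext_of_degree_le \<iota> n F" "poly_over F P" "degree P > 0" "poly P b = 0"
  obtains L where "ext_of_degree_le \<iota> (n * degree P) L" "F \<subseteq> L" "b \<in> L"
proof -
  let ?q = "degree P"
  obtain S where S: "finite S" "card S \<le> n" "F \<subseteq> {\<Sum>s\<in>S. \<iota> (c s) * s | c. True}"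
    and F: "is_subfield F" "range \<iota> \<subseteq> F"
    using assms(1) unfolding ext_of_degree_le_def by auto
  define L where "L = {poly f b | f. poly_over F f}"
  have L_I: "poly_over F f \<Longrightarrow> x = poly f b \<Longrightarrow> x \<in> L" for f x
    by (auto simp: L_def)
  have FL: "F \<subseteq> L"
    using F(1) by (auto intro!: L_I[OF poly_over_pCons[OF F(1) _ poly_over_0[OF F(1)]]])
  have bL: "b \<in> L"
    using F(1) by (intro L_I[of "[:0, 1:]"])
      (auto intro!: poly_over_pCons poly_over_0 simp: is_subfield_def)
  have sub: "is_subfield L"
  proof (rule subfield_if_subring)
    show "range \<iota> \<subseteq> L" using F FL by simp
    fix x y assume "x \<in> L" "y \<in> L"
    then obtain f g where "poly_over F f" "x = poly f b" "poly_over F g" "y = poly g b"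
      unfolding L_def by blast
    thus "x + y \<in> L \<and> x * y \<in> L"
      using L_I[OF poly_over_add[OF F(1)]] L_I[OF poly_over_mult[OF F(1)]]
      by (metis poly_add poly_mult)
  qed
  have red: "\<exists>f. poly_over F f \<and> degree f < ?q \<and> poly f b = x" if "x \<in> L" for x
  proof -
    have "poly_over F f \<Longrightarrow> \<exists>h. poly_over F h \<and> degree h < ?q \<and> poly h b = poly f b" for f
    proof (induction f)
      case 0
      show ?case using poly_over_0[OF F(1)] assms(3) by (intro exI[of _ 0]) auto
    next
      case (pCons c f)
      have c: "c \<in> F" "poly_over F f"
        using pCons.prems unfolding poly_over_def by (metis coeff_pCons_0, metis coeff_pCons_Suc)
      then obtain h where h: "poly_over F h" "degree h < ?q" "poly h b = poly f b"
        using pCons.IH by blast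
      \<comment> \<open>The coefficient of \<open>pCons c h\<close> in degree \<open>?q\<close> is
        that of h in degree \<open>?q - 1\<close>; subtracting \<open>smult k P\<close> cancels
        it.\<close>
      define k where "k = coeff h (?q - 1) / lead_coeff P"
      have k: "k \<in> F"
        using h(1) assms(2) F(1) by (auto simp: k_def poly_over_def intro!: subfield_divide)
      let ?h = "pCons c h - smult k P"
      have "poly_over F ?h"
        using c h k assms(2) by (intro poly_over_intros F(1)) auto
      moreover have "poly ?h b = poly (pCons c f) b"
        using h assms(4) by simp
      moreover have "degree ?h < ?q"
      proof (rule le_less_trans[OF degree_le[of "?q - 1"]])
        show "\<forall>i>?q - 1. coeff ?h i = 0"
        proof (intro allI impI)
          fix i assume "i > ?q - 1"
          hence i: "i \<ge> ?q" using assms(3) by simp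
          show "coeff ?h i = 0"
          proof (cases "i = ?q")
            case True
            thus ?thesis using assms(3) by (auto simp: k_def coeff_pCons split: nat.splits)
          next
            case False
            hence "i > ?q" using i by simp
            thus ?thesis using h(2) assms(3)
              by (auto simp: coeff_pCons coeff_eq_0 split: nat.splits)
          qed
        qed
      qed (use assms(3) in simp)
      ultimately show ?case by blast
    qed
    thus ?thesis using that by (auto simp: L_def)
  qed
  \<comment> \<open>Different pairs may give the same product, so coefficients are summed below over
    the fibres of this map.\<close>
  define S' where "S' = (\<lambda>(s, i). s * b ^ i) ` (S \<times> {..<?q})"
  have spanned: "x \<in> {\<Sum>s\<in>S'. \<iota> (c s) * s | c. True}" if x: "x \<in> L" for x
  proof -
    obtain f where f: "poly_over F f" "degree f < ?q" "poly f b = x"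
      using red[OF x] by blast
    have "\<exists>c. coeff f i = (\<Sum>s\<in>S. \<iota> (c s) * s)" for i
      using f(1) S(3) by (fastforce simp: poly_over_def)
    then obtain c where c: "\<And>i. coeff f i = (\<Sum>s\<in>S. \<iota> (c i s) * s)"
      by metis
    have "x = (\<Sum>i<?q. coeff f i * b ^ i)"
      using poly_altdef_le[of f "?q - 1" b] f assms(3) by (simp add: lessThan_Suc_atMost[symmetric])
    also have "\<dots> = (\<Sum>i<?q. \<Sum>s\<in>S. \<iota> (c i s) * (s * b ^ i))"
      by (simp add: c sum_distrib_right mult.assoc)
    also have "\<dots> = (\<Sum>(s,i)\<in>S \<times> {..<?q}. \<iota> (c i s) * (s * b ^ i))"
      by (subst sum.swap) (simp add: sum.cartesian_product)
    also have "\<dots> = (\<Sum>t\<in>S'. \<Sum>(s,i)\<in>{u \<in> S \<times> {..<?q}. (\<lambda>(s, i). s * b ^ i) u = t}.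
        \<iota> (c i s) * (s * b ^ i))"
      unfolding S'_def using S(1) by (intro sum.image_gen) auto
    also have "\<dots> = (\<Sum>t\<in>S'. \<iota> (\<Sum>(s,i)\<in>{u \<in> S \<times> {..<?q}. (\<lambda>(s, i). s * b ^ i) u = t}. c i s) * t)"
    proof (rule sum.cong)
      fix t assume "t \<in> S'"
      have hom: "\<iota> (sum h A) = (\<Sum>a\<in>A. \<iota> (h a))" for h and A :: "('a \<times> nat) set"
        by (induction A rule: infinite_finite_induct) (auto simp: embedding_simps)
      show "(\<Sum>(s,i)\<in>{u \<in> S \<times> {..<?q}. (\<lambda>(s, i). s * b ^ i) u = t}. \<iota> (c i s) * (s * b ^ i)) =
        \<iota> (\<Sum>(s,i)\<in>{u \<in> S \<times> {..<?q}. (\<lambda>(s, i). s * b ^ i) u = t}. c i s) * t"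
        unfolding hom sum_distrib_right by (intro sum.cong) auto
    qed simp
    finally show ?thesis by auto
  qed
  have "card S' \<le> card (S \<times> {..<?q})"
    unfolding S'_def using S(1) by (intro card_image_le) auto
  also have "\<dots> \<le> n * ?q"
    using S(2) by (simp add: card_cartesian_product)
  finally have "ext_of_degree_le \<iota> (n * ?q) L"
    unfolding ext_of_degree_le_def using sub F FL S(1) spanned
    by (intro conjI exI[of _ S']) (auto simp: S'_def)
  thus ?thesis
    using that FL bL by blast
qed

lemma adjoin_nth_root:
  assumes "ext_of_degree_le \<iota> m F" "y \<in> F" "n > 0"
  obtains L c where "ext_of_degree_le \<iota> (m * n) L" "F \<subseteq> L" "c \<in> L" "c ^ n = y"
proof -
  obtain c where c: "c ^ n = y"
    using nth_root_exists[OF assms(3)] by blast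
  have F: "is_subfield F"
    using assms(1) by (rule ext_of_degree_le_subfield)
  let ?P = "monom 1 n - [:y:]"
  have cP: "coeff ?P i = (if i = n then 1 else 0) - (if i = 0 then y else 0)" for i
    by (simp add: coeff_pCons split: nat.split)
  have deg: "degree ?P = n"
  proof (rule antisym)
    show "degree ?P \<le> n"
      by (rule degree_le) (use assms(3) in \<open>simp only: cP, auto\<close>)
    show "n \<le> degree ?P"
      by (rule le_degree) (use assms(3) in \<open>simp only: cP, auto\<close>)
  qed
  have over: "poly_over F ?P"
    using F assms(2) unfolding poly_over_def cP
    by (auto intro!: subfield_diff simp: is_subfield_def)
  have "poly ?P c = 0"
    using c by (simp add: poly_monom)
  thus ?thesis
    using adjoin_root[OF assms(1) over] deg assms(3) c that by metis
qed

lemma ext_of_degree_le_imp_finite_extension: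
  assumes "ext_of_degree_le \<iota> n L"
  shows "finite_extension \<iota> L \<and> extension_degree \<iota> L \<le> n"
proof -
  interpret vector_space "\<lambda>c x. \<iota> c * x"
    by (rule vector_space_embedding[OF closure])
  obtain S where S: "finite S" "card S \<le> n" "L \<subseteq> {\<Sum>s\<in>S. \<iota> (c s) * s | c. True}"
    using assms unfolding ext_of_degree_le_def by auto
  have "L \<subseteq> span S"
  proof
    fix x assume "x \<in> L"
    then obtain c where x: "x = (\<Sum>s\<in>S. \<iota> (c s) * s)"
      using S(3) by blast
    show "x \<in> span S"
      unfolding x by (intro span_sum span_scale span_base)
  qed
  moreover from this have "dim L \<le> n"
    using dim_le_card[of L S] S by simp
  ultimately show ?thesis
    using assms S(1)
    unfolding finite_extension_def extension_degree_def ext_of_degree_le_def by auto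
qed

end

section \<open>Binomial coefficients prime to the residue characteristic\<close>

text \<open>For p dividing n, q is the exact power of p in n: by \<open>const_p_fac\<close>, the
  fact behind Sylow's theorem, \<open>n choose q\<close> is divisible by p exactly as often as the
  cofactor m, that is, not at all.\<close>

lemma has_p_exponent_choose:
  assumes "prime p" "n > 0"
  obtains q where "q \<ge> 1" "q \<le> n" "\<not> p dvd (n choose q)"
    "q = 1 \<and> \<not> p dvd n \<or> (\<exists>e. has_p_exponent p n e \<and> q = p ^ e)"
proof (cases "p dvd n")
  case False
  thus ?thesis using that[of 1] assms by auto
next
  case True
  define e where "e = multiplicity p n"
  obtain m where m: "n = p ^ e * m"
    unfolding e_def using multiplicity_dvd by (rule dvdE)
  have nd: "\<not> p dvd m"
    using assms m multiplicity_decompose[of n p] unfolding e_def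
    by (metis nonzero_mult_div_cancel_left not_prime_unit power_eq_0_iff not_gr0 mult_zero_left)
  have m0: "m > 0"
    using m assms by (cases m) auto
  have "multiplicity p (n choose p ^ e) = 0"
    using const_p_fac[OF m0 assms(1), of e] m nd by (simp add: not_dvd_imp_multiplicity_0)
  moreover have le: "p ^ e \<le> n"
    using m m0 by simp
  ultimately have "\<not> p dvd (n choose p ^ e)"
    using assms(1) by (metis multiplicity_eq_zero_iff binomial_eq_0_iff not_less not_prime_unit)
  moreover have "e \<ge> 1"
    using True assms unfolding e_def
    by (metis multiplicity_eq_zero_iff not_prime_unit less_one not_less neq0_conv)
  moreover from this have "has_p_exponent p n e"
    unfolding has_p_exponent_def using prime_gt_0_nat[OF assms(1)] m m0 nd
    by (auto intro!: exI[of _ m])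
  ultimately show ?thesis
    using that[of "p ^ e"] le prime_gt_0_nat[OF assms(1)] by auto
qed

lemma absv_of_nat_eq_1_iff:
  "absv (of_nat n :: 'k::nonarch_field) = 1 \<longleftrightarrow> \<not> CHAR('k residue) dvd n"
proof -
  have "reduction (of_nat n :: 'k) = of_nat n"
    by (induction n) (auto simp: reduction_add absv_of_nat_le_1)
  hence "CHAR('k residue) dvd n \<longleftrightarrow> absv (of_nat n :: 'k) < 1"
    by (metis of_nat_eq_0_iff_char_dvd reduction_eq_0_iff absv_of_nat_le_1)
  thus ?thesis
    using absv_of_nat_le_1[of n, where 'a = 'k] by linarith
qed

text \<open>In residue characteristic 0 every positive integer has absolute value 1, so
  \<open>q = 1\<close> serves.\<close>

lemma ex_choose_unit:
  assumes "n > 0"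
  obtains q where "q \<ge> 1" "q \<le> n" "absv (of_nat (n choose q) :: 'k::nonarch_field) = 1"
    "q = 1 \<and> \<not> CHAR('k residue) dvd n \<or> (\<exists>e. has_p_exponent CHAR('k residue) n e \<and> q = CHAR('k residue) ^ e)"
proof (cases "CHAR('k residue) = 0")
  case True
  thus ?thesis using that[of 1] assms by (auto simp: absv_of_nat_eq_1_iff)
next
  case False
  hence "prime CHAR('k residue)"
    by (intro prime_CHAR_semidom) simp
  from has_p_exponent_choose[OF this assms] show ?thesis
    using that by (metis absv_of_nat_eq_1_iff)
qed

text \<open>In the first two cases \<open>p ^ e \<ge> 2\<close>, and both \<open>2 * (d - 1)\<close>
  and \<open>2 * d\<close> are at least \<open>d + 1\<close> for \<open>d \<ge> 3\<close>.\<close>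

lemma degree_bound_ge:
  assumes "d \<ge> 2"
  shows "d + 1 \<le> degree_bound p d"
proof -
  have *: "d + 1 \<le> p ^ e * (d - 1) \<and> d + 1 \<le> d * p ^ e \<and> (THE e. has_p_exponent p n e) = e"
    if "has_p_exponent p n e" "d \<ge> 3" for n e
  proof -
    have "p \<noteq> 1" "p > 0" "e \<ge> 1"
      using that(1) by (auto simp: has_p_exponent_def)
    hence "2 \<le> p ^ e"
      using power_increasing[of 1 e p] by simp
    hence "2 * (d - 1) \<le> p ^ e * (d - 1)" "d * 2 \<le> d * p ^ e"
      by (auto intro!: mult_le_mono)
    moreover have "(THE e. has_p_exponent p n e) = e"
      using that(1) has_p_exponent_unique by blast
    ultimately show ?thesis
      using that(2) by linarith
  qed
  show ?thesis
    unfolding degree_bound_def using * by (auto simp del: One_nat_def)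
qed

text \<open>The definition sends \<open>d = 2\<close> to the value \<open>d + 1 = 3\<close>; there
  \<open>p ^ e\<close> divides 2, so the claim still holds.\<close>

lemma degree_bound_dvd:
  assumes "d \<ge> 2" "has_p_exponent p d e"
  shows "p ^ e * (d - 1) \<le> degree_bound p d"
proof (cases "d = 2")
  case True
  have "p ^ e \<le> d"
    using assms(2) unfolding has_p_exponent_def by (metis dvd_imp_le dvd_triv_right assms(1) not_numeral_le_zero not_gr0)
  thus ?thesis using True by (simp add: degree_bound_def)
next
  case False
  have "(THE e. has_p_exponent p d e) = e"
    using assms(2) has_p_exponent_unique by blast
  thus ?thesis using False assms unfolding degree_bound_def by auto
qed

text \<open>As p divides \<open>d - 1\<close>, it does not divide d, which excludes the first case
  of the bound; and \<open>d \<noteq> 2\<close> since p does not divide 1.\<close>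

lemma degree_bound_dvd_pred:
  assumes "d \<ge> 2" "has_p_exponent p (d - 1) e"
  shows "d * p ^ e \<le> degree_bound p d"
proof -
  have p1: "p \<noteq> 1"
    using assms(2) by (auto simp: has_p_exponent_def)
  have dvd: "p dvd n" if "has_p_exponent p n e" for n e
    using that unfolding has_p_exponent_def by (metis dvd_mult dvd_power less_le_trans zero_less_one)
  have "\<not> has_p_exponent p d e'" for e'
  proof
    assume "has_p_exponent p d e'"
    hence "p dvd d - (d - 1)"
      using dvd assms(2) by (meson dvd_diff_nat)
    thus False using p1 assms(1) by auto
  qed
  moreover have "d \<noteq> 2"
    using dvd[OF assms(2)] p1 by auto
  moreover have "(THE e. has_p_exponent p (d - 1) e) = e"
    using assms(2) has_p_exponent_unique by blast
  ultimately show ?thesis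
    using assms unfolding degree_bound_def by auto
qed

section \<open>Homogeneous pairs and conjugation\<close>

text \<open>The form has degree d rather than \<open>degree f\<close>, so that numerator and
  denominator of a map have a common degree and \<infinity> becomes the point (1, 0).\<close>

definition hval :: "nat \<Rightarrow> 'a::field poly \<Rightarrow> 'a \<Rightarrow> 'a \<Rightarrow> 'a" where
  "hval d f x y = (\<Sum>i\<le>d. coeff f i * x ^ i * y ^ (d - i))"

definition hsubst :: "nat \<Rightarrow> 'a::field poly \<Rightarrow> 'a poly \<Rightarrow> 'a poly \<Rightarrow> 'a poly" where
  "hsubst d f p q = (\<Sum>i\<le>d. smult (coeff f i) (p ^ i * q ^ (d - i)))"

lemma hval_smult: "hval d (smult k f) x y = k * hval d f x y"
  by (simp add: hval_def sum_distrib_left mult.assoc)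

lemma hval_add: "hval d (f + g) x y = hval d f x y + hval d g x y"
  by (simp add: hval_def sum.distrib algebra_simps)

lemma hval_scale: "hval d f (k * x) (k * y) = k ^ d * hval d f x y"
proof -
  have "k ^ i * k ^ (d - i) = k ^ d" if "i \<le> d" for i
    using that by (simp flip: power_add)
  thus ?thesis
    unfolding hval_def sum_distrib_left
    by (intro sum.cong refl) (simp add: power_mult_distrib mult_ac)
qed

lemma hval_1: "degree f \<le> d \<Longrightarrow> hval d f x 1 = poly f x"
  by (simp add: hval_def poly_altdef_le)

lemma hval_0: "hval d f x 0 = coeff f d * x ^ d"
proof -
  have "hval d f x 0 = (\<Sum>i\<in>{d}. coeff f i * x ^ i * 0 ^ (d - i))"
    unfolding hval_def by (intro sum.mono_neutral_right) (auto simp: power_0_left)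
  thus ?thesis by simp
qed

lemma hval_nonzero: "degree f \<le> d \<Longrightarrow> y \<noteq> 0 \<Longrightarrow> hval d f x y = y ^ d * poly f (x / y)"
  using hval_scale[of d f y "x / y" 1] by (simp add: hval_1)

lemma degree_linear_power: "degree ([:b, a:] ^ n :: 'a::comm_semiring_1 poly) \<le> n"
  using degree_power_le[of "[:b, a:]" n] by (simp split: if_splits)

lemma coeff_mult_degree_bounds:
  fixes p q :: "'a::idom poly"
  assumes "degree p \<le> m" "degree q \<le> n"
  shows "coeff (p * q) (m + n) = coeff p m * coeff q n"
proof (cases "degree p = m \<and> degree q = n")
  case True
  thus ?thesis using coeff_mult_degree_sum[of p q] by simp
next
  case False
  hence "degree p + degree q < m + n"
    using assms by linarith
  hence "coeff (p * q) (m + n) = 0"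
    by (intro coeff_eq_0 le_less_trans[OF degree_mult_le])
  moreover have "coeff p m = 0 \<or> coeff q n = 0"
    using False assms by (auto intro!: coeff_eq_0)
  ultimately show ?thesis by auto
qed

lemma degree_map_poly_bound: "h 0 = 0 \<Longrightarrow> degree f \<le> d \<Longrightarrow> degree (map_poly h f) \<le> d"
  by (rule degree_le) (simp add: coeff_map_poly coeff_eq_0)

lemma poly_hsubst: "poly (hsubst d f p q) z = hval d f (poly p z) (poly q z)"
  by (simp add: hsubst_def hval_def poly_sum mult.assoc)

lemma degree_linear_power_mult:
  assumes "i \<le> d"
  shows "degree ([:b, a:] ^ i * [:b', a':] ^ (d - i) :: 'a::field poly) \<le> d"
proof -
  have "degree ([:b, a:] ^ i * [:b', a':] ^ (d - i)) \<le> i + (d - i)"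
    by (intro order_trans[OF degree_mult_le] add_mono degree_linear_power)
  thus ?thesis using assms by simp
qed

lemma degree_hsubst: "degree (hsubst d f [:b, a:] [:b', a':]) \<le> d"
  unfolding hsubst_def
  by (intro degree_sum_le order_trans[OF degree_smult_le] degree_linear_power_mult) auto

lemma coeff_hsubst:
  "coeff (hsubst d f [:b, a:] [:b', a':]) d = hval d f a a'"
proof -
  have "coeff ([:b, a:] ^ i * [:b', a':] ^ (d - i)) d = a ^ i * a' ^ (d - i)" if "i \<le> d" for i
    using coeff_mult_degree_bounds[of "[:b, a:] ^ i" i "[:b', a':] ^ (d - i)" "d - i"] that
    by (simp add: degree_linear_power coeff_linear_poly_power)
  thus ?thesis
    unfolding hsubst_def hval_def coeff_sum by (intro sum.cong) (auto simp: mult.assoc)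
qed

lemma hval_hsubst:
  "hval d (hsubst d f [:b, a:] [:b', a':]) x y = hval d f (a * x + b * y) (a' * x + b' * y)"
proof (cases "y = 0")
  case True
  thus ?thesis
    using hval_scale[of d f x a a'] by (simp add: hval_0 coeff_hsubst mult.commute)
next
  case False
  have "hval d (hsubst d f [:b, a:] [:b', a':]) x y =
      y ^ d * hval d f (b + x / y * a) (b' + x / y * a')"
    using False by (simp add: hval_nonzero degree_hsubst poly_hsubst)
  also have "\<dots> = hval d f (y * (b + x / y * a)) (y * (b' + x / y * a'))"
    by (simp add: hval_scale)
  also have "y * (b + x / y * a) = a * x + b * y"
    using False by (simp add: field_simps)
  also have "y * (b' + x / y * a') = a' * x + b' * y"
    using False by (simp add: field_simps)
  finally show ?thesis .
qed

lemma hsubst_affine: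
  assumes "degree f \<le> d"
  shows "hsubst d f [:a, c:] 1 = pcompose f [:a, c:]"
proof -
  have "degree (map_poly (\<lambda>x. [:x:]) f) \<le> d"
    using assms by (intro degree_map_poly_bound) auto
  thus ?thesis
    by (simp add: pcompose_altdef poly_altdef_le hsubst_def coeff_map_poly)
qed

text \<open>For M with rows (\<alpha>, \<beta>) and (\<gamma>, \<delta>), this is the first
  coordinate of M \<Phi>(adj M v), and \<open>conj_den\<close> is the second. The adjugate in place
  of the inverse scales the pair by the d-th power of the determinant and avoids
  denominators.\<close>

definition conj_num :: "nat \<Rightarrow> 'a::field poly \<Rightarrow> 'a poly \<Rightarrow> 'a \<Rightarrow> 'a \<Rightarrow> 'a \<Rightarrow> 'a \<Rightarrow> 'a poly" where
  "conj_num d f g \<alpha> \<beta> \<gamma> \<delta> = smult \<alpha> (hsubst d f [:- \<beta>, \<delta>:] [:\<alpha>, - \<gamma>:]) +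
     smult \<beta> (hsubst d g [:- \<beta>, \<delta>:] [:\<alpha>, - \<gamma>:])"

definition conj_den :: "nat \<Rightarrow> 'a::field poly \<Rightarrow> 'a poly \<Rightarrow> 'a \<Rightarrow> 'a \<Rightarrow> 'a \<Rightarrow> 'a \<Rightarrow> 'a poly" where
  "conj_den d f g \<alpha> \<beta> \<gamma> \<delta> = smult \<gamma> (hsubst d f [:- \<beta>, \<delta>:] [:\<alpha>, - \<gamma>:]) +
     smult \<delta> (hsubst d g [:- \<beta>, \<delta>:] [:\<alpha>, - \<gamma>:])"

lemma degree_conj:
  "degree (conj_num d f g \<alpha> \<beta> \<gamma> \<delta>) \<le> d" "degree (conj_den d f g \<alpha> \<beta> \<gamma> \<delta>) \<le> d"
  unfolding conj_num_def conj_den_def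
  by (intro degree_add_le order_trans[OF degree_smult_le] degree_hsubst)+

lemma hval_conj:
  "hval d (conj_num d f g \<alpha> \<beta> \<gamma> \<delta>) x y =
     \<alpha> * hval d f (\<delta> * x - \<beta> * y) (\<alpha> * y - \<gamma> * x) + \<beta> * hval d g (\<delta> * x - \<beta> * y) (\<alpha> * y - \<gamma> * x)"
  "hval d (conj_den d f g \<alpha> \<beta> \<gamma> \<delta>) x y =
     \<gamma> * hval d f (\<delta> * x - \<beta> * y) (\<alpha> * y - \<gamma> * x) + \<delta> * hval d g (\<delta> * x - \<beta> * y) (\<alpha> * y - \<gamma> * x)"
  by (simp_all add: conj_num_def conj_den_def hval_add hval_smult hval_hsubst)

lemma poly_over_hsubst:
  assumes "is_subfield F" "poly_over F f" "poly_over F p" "poly_over F q"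
  shows "poly_over F (hsubst d f p q)"
  unfolding hsubst_def using assms
  by (intro poly_over_intros) (auto simp: poly_over_def)

lemma poly_over_conj:
  assumes F: "is_subfield F" and "poly_over F f" "poly_over F g" "\<alpha> \<in> F" "\<beta> \<in> F" "\<gamma> \<in> F" "\<delta> \<in> F"
  shows "poly_over F (conj_num d f g \<alpha> \<beta> \<gamma> \<delta>)" "poly_over F (conj_den d f g \<alpha> \<beta> \<gamma> \<delta>)"
proof -
  have "- \<beta> \<in> F" "- \<gamma> \<in> F"
    using F assms by (auto simp: is_subfield_def)
  thus "poly_over F (conj_num d f g \<alpha> \<beta> \<gamma> \<delta>)" "poly_over F (conj_den d f g \<alpha> \<beta> \<gamma> \<delta>)"
    unfolding conj_num_def conj_den_def using assms
    by (intro poly_over_intros[OF F] poly_over_hsubst; simp)+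
qed

lemma poly_embed_Fract:
  assumes "degree f \<le> d" "q \<noteq> 0"
  shows "poly (map_poly (\<lambda>c. to_fract [:c:]) f) (Fract p q) = Fract (hsubst d f p q) (q ^ d)"
proof -
  let ?P = "to_fract p" and ?Q = "to_fract q"
  have pow: "to_fract (r ^ n) = to_fract r ^ n" for r :: "'a poly" and n
    by (induction n) simp_all
  have Q: "?Q \<noteq> 0"
    using assms by simp
  have eq: "to_fract (smult c r) = to_fract [:c:] * to_fract r" for c and r :: "'a poly"
    by (simp flip: to_fract_mult)
  have "degree (map_poly (\<lambda>c. to_fract [:c:]) f) \<le> d"
    using assms(1) by (intro degree_map_poly_bound) auto
  hence "poly (map_poly (\<lambda>c. to_fract [:c:]) f) (Fract p q) =
      (\<Sum>i\<le>d. to_fract [:coeff f i:] * (?P / ?Q) ^ i)"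
    by (simp add: poly_altdef_le coeff_map_poly Fract_conv_to_fract)
  also have "\<dots> = (\<Sum>i\<le>d. to_fract [:coeff f i:] * (?P ^ i * ?Q ^ (d - i))) / ?Q ^ d"
    unfolding sum_divide_distrib
    using Q by (intro sum.cong refl) (simp add: power_diff power_divide)
  also have "\<dots> = Fract (hsubst d f p q) (q ^ d)"
    by (simp add: Fract_conv_to_fract hsubst_def pow eq)
  finally show ?thesis .
qed

lemma hval_nonzero_if_coprime:
  fixes f g :: "'a::field poly"
  assumes "coprime f g" "max (degree f) (degree g) = d" "d > 0" "(x, y) \<noteq> (0, 0)"
  shows "hval d f x y \<noteq> 0 \<or> hval d g x y \<noteq> 0"
proof (cases "y = 0")
  case True
  hence "x \<noteq> 0" using assms by simp
  moreover have "coeff f d \<noteq> 0 \<or> coeff g d \<noteq> 0"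
    using assms(2,3) by (metis degree_0 leading_coeff_0_iff less_irrefl max_def)
  ultimately show ?thesis
    using True by (auto simp: hval_0)
next
  case False
  obtain u v where "u * f + v * g = 1"
    using coprime_poly_bezout[OF assms(1)] by blast
  hence "poly u (x / y) * poly f (x / y) + poly v (x / y) * poly g (x / y) = 1"
    by (metis poly_1 poly_add poly_mult)
  hence "poly f (x / y) \<noteq> 0 \<or> poly g (x / y) \<noteq> 0"
    by auto
  thus ?thesis
    using assms(2) False by (auto simp: hval_nonzero)
qed

lemma coprime_if_hval_nonzero:
  fixes A B :: "'a::alg_closed_field poly"
  assumes "degree A \<le> d" "degree B \<le> d" "d > 0"
    and nz: "\<And>x y. (x, y) \<noteq> (0, 0) \<Longrightarrow> hval d A x y \<noteq> 0 \<or> hval d B x y \<noteq> 0"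
  shows "coprime A B" "max (degree A) (degree B) = d" "A \<noteq> 0" "B \<noteq> 0"
proof -
  have lead: "coeff A d \<noteq> 0 \<or> coeff B d \<noteq> 0"
    using nz[of 1 0] by (simp add: hval_0)
  thus deg: "max (degree A) (degree B) = d"
    using assms(1,2) le_degree[of A d] le_degree[of B d] by linarith
  have root: "poly A z \<noteq> 0 \<or> poly B z \<noteq> 0" for z
    using nz[of z 1] assms(1,2) by (simp add: hval_1)
  have no_const: "degree h = 0" if "h dvd A" "h dvd B" for h
  proof (rule ccontr)
    assume "degree h \<noteq> 0"
    then obtain z where "poly h z = 0"
      using alg_closed_imp_poly_has_root by blast
    thus False using root[of z] that by (auto elim!: dvdE)
  qed
  show "coprime A B"
  proof (rule coprimeI)
    fix h assume h: "h dvd A" "h dvd B"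
    have "h \<noteq> 0" using h lead by auto
    thus "is_unit h" using no_const[OF h] by (simp add: is_unit_iff_degree)
  qed
  show "A \<noteq> 0" "B \<noteq> 0"
    using no_const[of A] no_const[of B] deg assms(3) by auto
qed

lemma conj_nonzero:
  fixes f g :: "'a::alg_closed_field poly"
  assumes "coprime f g" "max (degree f) (degree g) = d" "d > 0" "\<alpha> * \<delta> - \<beta> * \<gamma> \<noteq> 0"
  defines "A \<equiv> conj_num d f g \<alpha> \<beta> \<gamma> \<delta>" and "B \<equiv> conj_den d f g \<alpha> \<beta> \<gamma> \<delta>"
  shows "coprime A B" "max (degree A) (degree B) = d" "A \<noteq> 0" "B \<noteq> 0"
proof -
  have nz: "hval d A x y \<noteq> 0 \<or> hval d B x y \<noteq> 0" if xy: "(x, y) \<noteq> (0, 0)" for x y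
  proof (rule ccontr)
    assume *: "\<not> ?thesis"
    define x' y' where "x' = \<delta> * x - \<beta> * y" and "y' = \<alpha> * y - \<gamma> * x"
    define X Y where "X = hval d f x' y'" and "Y = hval d g x' y'"
    have eq: "\<alpha> * X + \<beta> * Y = 0" "\<gamma> * X + \<delta> * Y = 0"
      using * by (auto simp: A_def B_def hval_conj X_def Y_def x'_def y'_def)
    have "(\<alpha> * \<delta> - \<beta> * \<gamma>) * X = \<delta> * (\<alpha> * X + \<beta> * Y) - \<beta> * (\<gamma> * X + \<delta> * Y)"
      "(\<alpha> * \<delta> - \<beta> * \<gamma>) * Y = \<alpha> * (\<gamma> * X + \<delta> * Y) - \<gamma> * (\<alpha> * X + \<beta> * Y)"
      by (simp_all add: algebra_simps)
    hence "X = 0" "Y = 0"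
      using assms(4) eq by auto
    moreover have "\<alpha> * x' + \<beta> * y' = (\<alpha> * \<delta> - \<beta> * \<gamma>) * x" "\<gamma> * x' + \<delta> * y' = (\<alpha> * \<delta> - \<beta> * \<gamma>) * y"
      by (simp_all add: x'_def y'_def algebra_simps)
    hence "(x', y') \<noteq> (0, 0)"
      using xy assms(4) by auto
    ultimately show False
      using hval_nonzero_if_coprime[OF assms(1,2,3), of x' y'] by (auto simp: X_def Y_def)
  qed
  from coprime_if_hval_nonzero[of A d B, OF _ _ assms(3) this]
  show "coprime A B" "max (degree A) (degree B) = d" "A \<noteq> 0" "B \<noteq> 0"
    by (auto simp: A_def B_def degree_conj)
qed

lemma conjugate_Fract:
  fixes f g :: "'a::alg_closed_field poly"
  assumes "coprime f g" "g \<noteq> 0" "max (degree f) (degree g) = d" "d > 0"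
    and det: "\<alpha> * \<delta> - \<beta> * \<gamma> \<noteq> 0"
  shows "ratfun_comp (moebius \<alpha> \<beta> \<gamma> \<delta>) (ratfun_comp (Fract f g) (moebius \<delta> (- \<beta>) (- \<gamma>) \<alpha>)) =
    Fract (conj_num d f g \<alpha> \<beta> \<gamma> \<delta>) (conj_den d f g \<alpha> \<beta> \<gamma> \<delta>)"
proof -
  let ?p = "[:- \<beta>, \<delta>:]" and ?q = "[:\<alpha>, - \<gamma>:]"
  let ?f = "hsubst d f ?p ?q" and ?g = "hsubst d g ?p ?q"
  have q: "?q \<noteq> 0" and q': "[:\<delta>, \<gamma>:] \<noteq> 0"
    using det by auto
  have deg: "degree f \<le> d" "degree g \<le> d"
    using assms(3) by auto
  have 1: "ratfun_comp (Fract f g) (moebius \<delta> (- \<beta>) (- \<gamma>) \<alpha>) = Fract ?f ?g"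
    unfolding ratfun_comp_Fract[OF assms(2,1)] moebius_def
    unfolding poly_embed_Fract[OF deg(1) q] poly_embed_Fract[OF deg(2) q] divide_fract
    using mult_fract_cancel[OF power_not_zero[OF q], of d ?f ?g] by (simp only: mult.commute)
  \<comment> \<open>The substitution is invertible, so \<open>?g = 0\<close> would make the form of
    g vanish everywhere. At a root of f this contradicts coprimality; for constant f the value at
    (1, 0) is the nonzero leading coefficient of g.\<close>
  have g: "?g \<noteq> 0"
  proof
    assume "?g = 0"
    hence 0: "hval d g (\<delta> * x + (- \<beta>) * y) ((- \<gamma>) * x + \<alpha> * y) = 0" for x y
      using hval_hsubst[of d g "- \<beta>" \<delta> \<alpha> "- \<gamma>" x y] by (simp add: hval_def)
    define D where "D = \<alpha> * \<delta> - \<beta> * \<gamma>"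
    have "D \<noteq> 0" using det by (simp add: D_def)
    have "hval d g (D * x) (D * y) = 0" for x y
      using 0[of "\<alpha> * x + \<beta> * y" "\<gamma> * x + \<delta> * y"] by (simp add: D_def algebra_simps)
    hence 0: "hval d g x y = 0" for x y
      using \<open>D \<noteq> 0\<close> by (simp add: hval_scale)
    show False
    proof (cases "degree f = 0")
      case True
      hence "degree g = d"
        using assms(3,4) by simp
      thus False using 0[of 1 0] assms(2) by (auto simp: hval_0)
    next
      case False
      then obtain z where "poly f z = 0"
        using alg_closed_imp_poly_has_root by blast
      thus False
        using hval_nonzero_if_coprime[OF assms(1,3,4), of z 1] 0[of z 1] deg by (simp add: hval_1)
    qed
  qed
  have "coprime [:\<beta>, \<alpha>:] [:\<delta>, \<gamma>:]"
  proof (rule coprimeI)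
    fix h assume h: "h dvd [:\<beta>, \<alpha>:]" "h dvd [:\<delta>, \<gamma>:]"
    have "h dvd smult \<alpha> [:\<delta>, \<gamma>:] - smult \<gamma> [:\<beta>, \<alpha>:]"
      by (intro dvd_diff dvd_smult h)
    also have "smult \<alpha> [:\<delta>, \<gamma>:] - smult \<gamma> [:\<beta>, \<alpha>:] = [:\<alpha> * \<delta> - \<beta> * \<gamma>:]"
      by (simp add: mult.commute)
    finally show "is_unit h"
      by (rule dvd_unit_imp_unit) (use det in \<open>simp add: is_unit_const_poly_iff dvd_field_iff\<close>)
  qed
  note 2 = ratfun_comp_Fract[OF q' this]
  have lin: "poly (map_poly (\<lambda>c. to_fract [:c:]) [:u, v:]) (Fract ?f ?g) =
      to_fract (smult v ?f + smult u ?g) / to_fract ?g" for u v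
  proof -
    have "degree [:u, v:] \<le> 1" by simp
    from poly_embed_Fract[OF this g, of ?f] show ?thesis
      by (simp add: Fract_conv_to_fract hsubst_def add.commute)
  qed
  show ?thesis
    unfolding 1 unfolding moebius_def 2 lin
    using g by (simp add: Fract_conv_to_fract conj_num_def conj_den_def)
qed

section \<open>Good reduction as a norm identity\<close>

definition max_norm :: "'a::nonarch_field \<Rightarrow> 'a \<Rightarrow> real" where
  "max_norm x y = max (absv x) (absv y)"

lemma max_norm_eq_0_iff: "max_norm x y = 0 \<longleftrightarrow> x = 0 \<and> y = 0"
  using absv_nonneg[of x] absv_nonneg[of y] absv_eq_0_iff[of x] absv_eq_0_iff[of y]
  by (auto simp: max_norm_def max_def)

lemma max_norm_scale: "max_norm (k * x) (k * y) = absv k * max_norm x y"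
  by (simp add: max_norm_def absv_mult max_mult_distrib_left absv_nonneg)

lemma max_norm_commute: "max_norm x y = max_norm y x"
  by (simp add: max_norm_def max.commute)

lemma max_norm_shear:
  assumes "absv t \<le> 1"
  shows "max_norm u (t * u + w) = max_norm u w"
proof -
  have t: "absv (t * u) \<le> absv u"
    using absv_mult_le[OF assms order_refl[of "absv u"]] by simp
  show ?thesis
  proof (cases "absv w \<le> absv u")
    case True
    thus ?thesis using absv_add_le[OF t True] by (simp add: max_norm_def)
  next
    case False
    hence "absv (w + t * u) = absv w"
      using t by (intro absv_add_dominant) simp
    thus ?thesis by (simp add: max_norm_def add.commute)
  qed
qed

text \<open>
  The homogeneous lift of the map satisfies \<open>\<parallel>M \<Phi>(v)\<parallel> = S \<parallel>M v\<parallel> ^ d\<close> for the matrix \<open>M\<close> with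
  rows \<open>(\<alpha>, \<beta>)\<close> and \<open>(\<gamma>, \<delta>)\<close>.
\<close>
definition good_matrix ::
    "nat \<Rightarrow> 'a::nonarch_field poly \<Rightarrow> 'a poly \<Rightarrow> 'a \<Rightarrow> 'a \<Rightarrow> 'a \<Rightarrow> 'a \<Rightarrow> bool" where
  "good_matrix d f g \<alpha> \<beta> \<gamma> \<delta> \<longleftrightarrow> \<alpha> * \<delta> - \<beta> * \<gamma> \<noteq> 0 \<and> (\<exists>S>0. \<forall>x y.
     max_norm (\<alpha> * hval d f x y + \<beta> * hval d g x y) (\<gamma> * hval d f x y + \<delta> * hval d g x y) =
     S * max_norm (\<alpha> * x + \<beta> * y) (\<gamma> * x + \<delta> * y) ^ d)"

text \<open>The identity of \<open>good_matrix\<close> for the unit matrix: A / B itself reduces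
  well once the pair is divided by a scalar of absolute value T.\<close>

definition good_pair :: "nat \<Rightarrow> real \<Rightarrow> 'a::nonarch_field poly \<Rightarrow> 'a poly \<Rightarrow> bool" where
  "good_pair d T A B \<longleftrightarrow> degree A \<le> d \<and> degree B \<le> d \<and> T > 0 \<and>
     (\<forall>x y. max_norm (hval d A x y) (hval d B x y) = T * max_norm x y ^ d)"

text \<open>Substituting adj M v for v, or M v in the other direction, turns one norm identity into
  the other, because M adj M is the scalar D.\<close>

lemma good_matrix_iff_good_pair:
  fixes f g :: "'a::nonarch_field poly"
  shows "good_matrix d f g \<alpha> \<beta> \<gamma> \<delta> \<longleftrightarrow> \<alpha> * \<delta> - \<beta> * \<gamma> \<noteq> 0 \<and>
    (\<exists>T. good_pair d T (conj_num d f g \<alpha> \<beta> \<gamma> \<delta>) (conj_den d f g \<alpha> \<beta> \<gamma> \<delta>))"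
proof (cases "\<alpha> * \<delta> - \<beta> * \<gamma> = 0")
  case True
  thus ?thesis by (simp add: good_matrix_def)
next
  case False
  define D where "D = \<alpha> * \<delta> - \<beta> * \<gamma>"
  have D: "absv D > 0"
    using False by (simp add: D_def absv_pos_iff)
  show ?thesis
  proof
    assume "good_matrix d f g \<alpha> \<beta> \<gamma> \<delta>"
    then obtain S where S: "S > 0" and eq: "\<And>x y.
       max_norm (\<alpha> * hval d f x y + \<beta> * hval d g x y) (\<gamma> * hval d f x y + \<delta> * hval d g x y) =
       S * max_norm (\<alpha> * x + \<beta> * y) (\<gamma> * x + \<delta> * y) ^ d"
      unfolding good_matrix_def by blast
    have "max_norm (hval d (conj_num d f g \<alpha> \<beta> \<gamma> \<delta>) x y) (hval d (conj_den d f g \<alpha> \<beta> \<gamma> \<delta>) x y)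
        = S * absv D ^ d * max_norm x y ^ d" for x y
    proof -
      have "\<alpha> * (\<delta> * x - \<beta> * y) + \<beta> * (\<alpha> * y - \<gamma> * x) = D * x"
        "\<gamma> * (\<delta> * x - \<beta> * y) + \<delta> * (\<alpha> * y - \<gamma> * x) = D * y"
        by (simp_all add: D_def algebra_simps)
      thus ?thesis
        unfolding hval_conj eq by (simp add: max_norm_scale power_mult_distrib)
    qed
    hence "good_pair d (S * absv D ^ d) (conj_num d f g \<alpha> \<beta> \<gamma> \<delta>) (conj_den d f g \<alpha> \<beta> \<gamma> \<delta>)"
      using S D by (simp add: good_pair_def degree_conj)
    thus "\<alpha> * \<delta> - \<beta> * \<gamma> \<noteq> 0 \<and>
      (\<exists>T. good_pair d T (conj_num d f g \<alpha> \<beta> \<gamma> \<delta>) (conj_den d f g \<alpha> \<beta> \<gamma> \<delta>))"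
      using False by blast
  next
    assume "\<alpha> * \<delta> - \<beta> * \<gamma> \<noteq> 0 \<and>
      (\<exists>T. good_pair d T (conj_num d f g \<alpha> \<beta> \<gamma> \<delta>) (conj_den d f g \<alpha> \<beta> \<gamma> \<delta>))"
    then obtain T where T: "T > 0" and eq: "\<And>x y. max_norm (hval d (conj_num d f g \<alpha> \<beta> \<gamma> \<delta>) x y)
        (hval d (conj_den d f g \<alpha> \<beta> \<gamma> \<delta>) x y) = T * max_norm x y ^ d"
      unfolding good_pair_def by blast
    have "max_norm (\<alpha> * hval d f x y + \<beta> * hval d g x y) (\<gamma> * hval d f x y + \<delta> * hval d g x y) =
       T / absv D ^ d * max_norm (\<alpha> * x + \<beta> * y) (\<gamma> * x + \<delta> * y) ^ d" (is "?N = _ * ?R") for x y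
    proof -
      have "\<delta> * (\<alpha> * x + \<beta> * y) - \<beta> * (\<gamma> * x + \<delta> * y) = D * x"
        "\<alpha> * (\<gamma> * x + \<delta> * y) - \<gamma> * (\<alpha> * x + \<beta> * y) = D * y"
        by (simp_all add: D_def algebra_simps)
      hence *: "hval d (conj_num d f g \<alpha> \<beta> \<gamma> \<delta>) (\<alpha> * x + \<beta> * y) (\<gamma> * x + \<delta> * y) =
          D ^ d * (\<alpha> * hval d f x y + \<beta> * hval d g x y)"
        "hval d (conj_den d f g \<alpha> \<beta> \<gamma> \<delta>) (\<alpha> * x + \<beta> * y) (\<gamma> * x + \<delta> * y) =
          D ^ d * (\<gamma> * hval d f x y + \<delta> * hval d g x y)"
        unfolding hval_conj by (simp_all only: hval_scale) (simp_all add: algebra_simps)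
      have "absv D ^ d * ?N = T * ?R"
        using eq[of "\<alpha> * x + \<beta> * y" "\<gamma> * x + \<delta> * y"]
        unfolding * max_norm_scale by (simp add: absv_power)
      thus ?thesis using D by (simp add: field_simps)
    qed
    thus "good_matrix d f g \<alpha> \<beta> \<gamma> \<delta>"
      unfolding good_matrix_def using False T D
      by (intro conjI exI[of _ "T / absv D ^ d"]) auto
  qed
qed

section \<open>Change of the matrix\<close>

text \<open>Conjugating by M and then by M' is conjugating by the product M' M, up to a scalar; a
  good matrix found in another coordinate can thus be carried back.\<close>

lemma good_matrix_compose:
  fixes f g :: "'a::nonarch_field poly"
  assumes "\<alpha> * \<delta> - \<beta> * \<gamma> \<noteq> 0"
    and "good_matrix d (conj_num d f g \<alpha> \<beta> \<gamma> \<delta>) (conj_den d f g \<alpha> \<beta> \<gamma> \<delta>) \<alpha>' \<beta>' \<gamma>' \<delta>'"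
  shows "good_matrix d f g (\<alpha>' * \<alpha> + \<beta>' * \<gamma>) (\<alpha>' * \<beta> + \<beta>' * \<delta>) (\<gamma>' * \<alpha> + \<delta>' * \<gamma>) (\<gamma>' * \<beta> + \<delta>' * \<delta>)"
proof -
  define D where "D = \<alpha> * \<delta> - \<beta> * \<gamma>"
  have D: "absv D > 0"
    using assms(1) by (simp add: D_def absv_pos_iff)
  let ?A = "conj_num d f g \<alpha> \<beta> \<gamma> \<delta>" and ?B = "conj_den d f g \<alpha> \<beta> \<gamma> \<delta>"
  obtain S where S: "S > 0" and det': "\<alpha>' * \<delta>' - \<beta>' * \<gamma>' \<noteq> 0" and eq: "\<And>x y.
       max_norm (\<alpha>' * hval d ?A x y + \<beta>' * hval d ?B x y) (\<gamma>' * hval d ?A x y + \<delta>' * hval d ?B x y) =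
       S * max_norm (\<alpha>' * x + \<beta>' * y) (\<gamma>' * x + \<delta>' * y) ^ d"
    using assms(2) unfolding good_matrix_def by blast
  have "(\<alpha>' * \<alpha> + \<beta>' * \<gamma>) * (\<gamma>' * \<beta> + \<delta>' * \<delta>) - (\<alpha>' * \<beta> + \<beta>' * \<delta>) * (\<gamma>' * \<alpha> + \<delta>' * \<gamma>) =
      (\<alpha>' * \<delta>' - \<beta>' * \<gamma>') * D"
    by (simp add: D_def algebra_simps)
  hence det: "(\<alpha>' * \<alpha> + \<beta>' * \<gamma>) * (\<gamma>' * \<beta> + \<delta>' * \<delta>) - (\<alpha>' * \<beta> + \<beta>' * \<delta>) * (\<gamma>' * \<alpha> + \<delta>' * \<gamma>) \<noteq> 0"
    using det' assms(1) by (simp add: D_def)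
  have "max_norm ((\<alpha>' * \<alpha> + \<beta>' * \<gamma>) * hval d f x y + (\<alpha>' * \<beta> + \<beta>' * \<delta>) * hval d g x y)
       ((\<gamma>' * \<alpha> + \<delta>' * \<gamma>) * hval d f x y + (\<gamma>' * \<beta> + \<delta>' * \<delta>) * hval d g x y) =
     S / absv D ^ d * max_norm ((\<alpha>' * \<alpha> + \<beta>' * \<gamma>) * x + (\<alpha>' * \<beta> + \<beta>' * \<delta>) * y)
       ((\<gamma>' * \<alpha> + \<delta>' * \<gamma>) * x + (\<gamma>' * \<beta> + \<delta>' * \<delta>) * y) ^ d" (is "?N = _ * ?R ^ d") for x y
  proof -
    have "\<delta> * (\<alpha> * x + \<beta> * y) - \<beta> * (\<gamma> * x + \<delta> * y) = D * x"
      "\<alpha> * (\<gamma> * x + \<delta> * y) - \<gamma> * (\<alpha> * x + \<beta> * y) = D * y"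
      by (simp_all add: D_def algebra_simps)
    hence *: "hval d ?A (\<alpha> * x + \<beta> * y) (\<gamma> * x + \<delta> * y) =
        D ^ d * (\<alpha> * hval d f x y + \<beta> * hval d g x y)"
      "hval d ?B (\<alpha> * x + \<beta> * y) (\<gamma> * x + \<delta> * y) =
        D ^ d * (\<gamma> * hval d f x y + \<delta> * hval d g x y)"
      unfolding hval_conj by (simp_all only: hval_scale) (simp_all add: algebra_simps)
    have "absv (D ^ d) * ?N = max_norm (D ^ d * (\<alpha>' * (\<alpha> * hval d f x y + \<beta> * hval d g x y) +
        \<beta>' * (\<gamma> * hval d f x y + \<delta> * hval d g x y)))
        (D ^ d * (\<gamma>' * (\<alpha> * hval d f x y + \<beta> * hval d g x y) + \<delta>' * (\<gamma> * hval d f x y + \<delta> * hval d g x y)))"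
      unfolding max_norm_scale[symmetric] by (simp add: algebra_simps)
    also have "\<dots> = S * max_norm (\<alpha>' * (\<alpha> * x + \<beta> * y) + \<beta>' * (\<gamma> * x + \<delta> * y))
        (\<gamma>' * (\<alpha> * x + \<beta> * y) + \<delta>' * (\<gamma> * x + \<delta> * y)) ^ d"
      unfolding eq[symmetric] * by (simp add: algebra_simps)
    also have "\<dots> = S * ?R ^ d"
      by (simp add: algebra_simps)
    finally show ?thesis using D by (simp add: absv_power field_simps)
  qed
  thus ?thesis
    unfolding good_matrix_def using det S D
    by (intro conjI exI[of _ "S / absv D ^ d"]) auto
qed

lemma good_matrix_conj:
  fixes f g :: "'a::nonarch_field poly"
  assumes "\<alpha> * \<delta> - \<beta> * \<gamma> \<noteq> 0" "\<alpha>' * \<delta>' - \<beta>' * \<gamma>' \<noteq> 0"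
    and "good_matrix d f g (\<alpha>' * \<alpha> + \<beta>' * \<gamma>) (\<alpha>' * \<beta> + \<beta>' * \<delta>) (\<gamma>' * \<alpha> + \<delta>' * \<gamma>) (\<gamma>' * \<beta> + \<delta>' * \<delta>)"
  shows "good_matrix d (conj_num d f g \<alpha> \<beta> \<gamma> \<delta>) (conj_den d f g \<alpha> \<beta> \<gamma> \<delta>) \<alpha>' \<beta>' \<gamma>' \<delta>'"
proof -
  define D where "D = \<alpha> * \<delta> - \<beta> * \<gamma>"
  have D: "absv D > 0"
    using assms(1) by (simp add: D_def absv_pos_iff)
  let ?A = "conj_num d f g \<alpha> \<beta> \<gamma> \<delta>" and ?B = "conj_den d f g \<alpha> \<beta> \<gamma> \<delta>"
  obtain S where S: "S > 0" and eq: "\<And>x y.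
      max_norm ((\<alpha>' * \<alpha> + \<beta>' * \<gamma>) * hval d f x y + (\<alpha>' * \<beta> + \<beta>' * \<delta>) * hval d g x y)
       ((\<gamma>' * \<alpha> + \<delta>' * \<gamma>) * hval d f x y + (\<gamma>' * \<beta> + \<delta>' * \<delta>) * hval d g x y) =
     S * max_norm ((\<alpha>' * \<alpha> + \<beta>' * \<gamma>) * x + (\<alpha>' * \<beta> + \<beta>' * \<delta>) * y)
       ((\<gamma>' * \<alpha> + \<delta>' * \<gamma>) * x + (\<gamma>' * \<beta> + \<delta>' * \<delta>) * y) ^ d"
    using assms(3) unfolding good_matrix_def by blast
  have "max_norm (\<alpha>' * hval d ?A x y + \<beta>' * hval d ?B x y) (\<gamma>' * hval d ?A x y + \<delta>' * hval d ?B x y) =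
      S * absv D ^ d * max_norm (\<alpha>' * x + \<beta>' * y) (\<gamma>' * x + \<delta>' * y) ^ d" for x y
  proof -
    let ?x = "\<delta> * x - \<beta> * y" and ?y = "\<alpha> * y - \<gamma> * x"
    have "(\<alpha>' * \<alpha> + \<beta>' * \<gamma>) * ?x + (\<alpha>' * \<beta> + \<beta>' * \<delta>) * ?y = D * (\<alpha>' * x + \<beta>' * y)"
      "(\<gamma>' * \<alpha> + \<delta>' * \<gamma>) * ?x + (\<gamma>' * \<beta> + \<delta>' * \<delta>) * ?y = D * (\<gamma>' * x + \<delta>' * y)"
      by (simp_all add: D_def algebra_simps)
    moreover have "\<alpha>' * hval d ?A x y + \<beta>' * hval d ?B x y =
        (\<alpha>' * \<alpha> + \<beta>' * \<gamma>) * hval d f ?x ?y + (\<alpha>' * \<beta> + \<beta>' * \<delta>) * hval d g ?x ?y"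
      "\<gamma>' * hval d ?A x y + \<delta>' * hval d ?B x y =
        (\<gamma>' * \<alpha> + \<delta>' * \<gamma>) * hval d f ?x ?y + (\<gamma>' * \<beta> + \<delta>' * \<delta>) * hval d g ?x ?y"
      unfolding hval_conj by (simp_all add: algebra_simps)
    ultimately show ?thesis
      using eq[of ?x ?y] by (simp add: max_norm_scale power_mult_distrib)
  qed
  thus ?thesis
    unfolding good_matrix_def using assms(2) S D
    by (intro conjI exI[of _ "S * absv D ^ d"]) auto
qed

lemma good_matrix_cong:
  fixes f g :: "'a::nonarch_field poly"
  assumes "good_matrix d f g \<alpha> \<beta> \<gamma> \<delta>" "\<alpha>' * \<delta>' - \<beta>' * \<gamma>' \<noteq> 0" "\<kappa> > 0"
    and eq: "\<And>x y. max_norm (\<alpha>' * x + \<beta>' * y) (\<gamma>' * x + \<delta>' * y) =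
       \<kappa> * max_norm (\<alpha> * x + \<beta> * y) (\<gamma> * x + \<delta> * y)"
  shows "good_matrix d f g \<alpha>' \<beta>' \<gamma>' \<delta>'"
proof -
  obtain S where S: "S > 0" "\<And>x y.
     max_norm (\<alpha> * hval d f x y + \<beta> * hval d g x y) (\<gamma> * hval d f x y + \<delta> * hval d g x y) =
     S * max_norm (\<alpha> * x + \<beta> * y) (\<gamma> * x + \<delta> * y) ^ d"
    using assms(1) unfolding good_matrix_def by blast
  show ?thesis
    \<comment> \<open>The left side scales by \<kappa> and the right side by
      \<open>\<kappa> ^ d\<close>.\<close>
    unfolding good_matrix_def eq S(2) using S(1) assms(2,3)
    by (intro conjI exI[of _ "\<kappa> * S / \<kappa> ^ d"]) (auto simp: power_mult_distrib)
qed

text \<open>Iwasawa decomposition: swapping the rows and subtracting an integral multiple of the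
  first row from the second preserve the max norm. Clearing \<gamma> leaves the determinant over
  \<alpha> in the corner, and dividing everything by \<alpha> gives c as the determinant over
  \<open>\<alpha> ^ 2\<close>.\<close>

lemma good_matrix_imp_affine:
  fixes f g :: "'a::nonarch_field poly"
  assumes "good_matrix d f g \<alpha> \<beta> \<gamma> \<delta>"
  obtains a c where "c \<noteq> 0" "good_matrix d f g 1 (- a) 0 c"
proof -
  have *: "\<exists>a c. c \<noteq> 0 \<and> good_matrix d f g 1 (- a) 0 c"
    if good: "good_matrix d f g \<alpha> \<beta> \<gamma> \<delta>" and le: "absv \<gamma> \<le> absv \<alpha>" for \<alpha> \<beta> \<gamma> \<delta>
  proof -
    have det: "\<alpha> * \<delta> - \<beta> * \<gamma> \<noteq> 0"
      using good by (simp add: good_matrix_def)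
    have \<alpha>: "\<alpha> \<noteq> 0"
      using det le absv_nonneg[of \<gamma>] absv_eq_0_iff[of \<gamma>] by auto
    define c where "c = (\<alpha> * \<delta> - \<beta> * \<gamma>) / \<alpha> ^ 2"
    have c: "c \<noteq> 0"
      using det \<alpha> by (simp add: c_def)
    have "good_matrix d f g 1 (- (- \<beta> / \<alpha>)) 0 c"
    proof (rule good_matrix_cong[OF good, of _ _ _ _ "1 / absv \<alpha>"])
      show "1 * c - - (- \<beta> / \<alpha>) * 0 \<noteq> 0" "1 / absv \<alpha> > 0"
        using c \<alpha> by (simp_all add: absv_pos_iff)
      fix x y
      have t: "absv (\<gamma> / \<alpha>) \<le> 1"
        using le \<alpha> by (simp add: absv_divide absv_pos_iff divide_le_eq)
      have "\<alpha> * (\<gamma> * x + \<delta> * y) = \<gamma> * (\<alpha> * x + \<beta> * y) + (\<alpha> * \<delta> - \<beta> * \<gamma>) * y"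
        by (simp add: algebra_simps)
      hence "\<gamma> * x + \<delta> * y = \<gamma> / \<alpha> * (\<alpha> * x + \<beta> * y) + (\<alpha> * \<delta> - \<beta> * \<gamma>) / \<alpha> * y"
        using \<alpha> by (simp only: times_divide_eq_left add_divide_distrib[symmetric] eq_divide_eq
            mult.commute[of _ \<alpha>] if_False if_True not_False_eq_True)
      hence "max_norm (\<alpha> * x + \<beta> * y) (\<gamma> * x + \<delta> * y) =
          max_norm (\<alpha> * x + \<beta> * y) (\<gamma> / \<alpha> * (\<alpha> * x + \<beta> * y) + (\<alpha> * \<delta> - \<beta> * \<gamma>) / \<alpha> * y)"
        by simp
      also have "\<dots> = max_norm (\<alpha> * x + \<beta> * y) ((\<alpha> * \<delta> - \<beta> * \<gamma>) / \<alpha> * y)"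
        using t by (rule max_norm_shear)
      also have "\<dots> = absv \<alpha> * max_norm (1 * x + - (- \<beta> / \<alpha>) * y) (0 * x + c * y)"
      proof -
        have "\<alpha> * x + \<beta> * y = \<alpha> * (1 * x + - (- \<beta> / \<alpha>) * y)"
          using \<alpha> by (simp add: distrib_left)
        moreover have "(\<alpha> * \<delta> - \<beta> * \<gamma>) / \<alpha> * y = \<alpha> * (0 * x + c * y)"
          using \<alpha> by (simp add: c_def power2_eq_square)
        ultimately show ?thesis
          by (simp only: max_norm_scale)
      qed
      finally show "max_norm (1 * x + - (- \<beta> / \<alpha>) * y) (0 * x + c * y) =
          1 / absv \<alpha> * max_norm (\<alpha> * x + \<beta> * y) (\<gamma> * x + \<delta> * y)"
        using \<alpha> by (simp add: absv_eq_0_iff)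
    qed
    thus ?thesis using c by blast
  qed
  show ?thesis
  proof (cases "absv \<gamma> \<le> absv \<alpha>")
    case True
    thus ?thesis using *[OF assms] that by blast
  next
    case False
    have "\<gamma> * \<beta> - \<delta> * \<alpha> \<noteq> 0"
      using assms by (auto simp: good_matrix_def mult.commute)
    hence "good_matrix d f g \<gamma> \<delta> \<alpha> \<beta>"
      by (rule good_matrix_cong[OF assms, of _ _ _ _ 1]) (simp_all add: max_norm_commute)
    from *[OF this] False that show ?thesis by auto
  qed
qed

text \<open>The norm \<open>max |x - a y| |c y|\<close> depends only on the disc: moving the centre
  by at most \<open>|c|\<close> is an integral shear.\<close>

lemma good_matrix_affine_cong:
  fixes f g :: "'a::nonarch_field poly"
  assumes "good_matrix d f g 1 (- a) 0 c" "absv (a' - a) \<le> absv c" "absv c' = absv c"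
  shows "good_matrix d f g 1 (- a') 0 c'"
proof (rule good_matrix_cong[OF assms(1), of _ _ _ _ 1])
  have c: "c \<noteq> 0"
    using assms(1) by (simp add: good_matrix_def)
  show "1 * c' - - a' * 0 \<noteq> 0"
    using c assms(3) absv_pos_iff[of c] absv_pos_iff[of c'] by simp
  fix x y
  have eq: "x - a' * y = (a - a') / c * (c * y) + (x - a * y)"
    using c by (simp add: field_simps)
  have "max_norm (x - a' * y) (c' * y) = max_norm (c * y) (x - a' * y)"
    by (simp add: max_norm_def absv_mult assms(3) max.commute)
  also have "\<dots> = max_norm (c * y) (x - a * y)"
    unfolding eq using assms(2) c
    by (intro max_norm_shear) (simp add: absv_divide absv_pos_iff divide_le_eq absv_minus_commute)
  also have "\<dots> = max_norm (x - a * y) (c * y)"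
    by (rule max_norm_commute)
  finally show "max_norm (1 * x + - a' * y) (0 * x + c' * y) =
      1 * max_norm (1 * x + - a * y) (0 * x + c * y)"
    by simp
qed simp

section \<open>From the norm identity to reduction of coefficients and back\<close>

lemma good_pairD:
  fixes A B :: "'a::{nonarch_field, alg_closed_field} poly"
  assumes "good_pair d T A B"
  shows "T > 0" "degree A \<le> d" "degree B \<le> d"
    and "absv (coeff A i) \<le> T" "absv (coeff B i) \<le> T"
    and "max_norm (coeff A d) (coeff B d) = T"
    and "absv z \<le> 1 \<Longrightarrow> max_norm (poly A z) (poly B z) = T"
proof -
  show T: "T > 0" "degree A \<le> d" "degree B \<le> d"
    using assms by (auto simp: good_pair_def)
  have eq: "max_norm (hval d A x y) (hval d B x y) = T * max_norm x y ^ d" for x y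
    using assms by (auto simp: good_pair_def)
  show "max_norm (coeff A d) (coeff B d) = T"
    using eq[of 1 0] by (simp add: hval_0 max_norm_def)
  show *: "max_norm (poly A z) (poly B z) = T" if "absv z \<le> 1" for z
    using eq[of z 1] T that by (simp add: hval_1 max_norm_def)
  \<comment> \<open>The coefficient bounds follow because both Gauss norms are attained at integral
    points, where the identity bounds the values by T.\<close>
  obtain u v where "absv u \<le> 1" "\<And>i. absv (coeff A i) \<le> absv (poly A u)"
      "absv v \<le> 1" "\<And>i. absv (coeff B i) \<le> absv (poly B v)"
    using gauss_norm_attained[of A] gauss_norm_attained[of B] by metis
  thus "absv (coeff A i) \<le> T" "absv (coeff B i) \<le> T"
    using *[of u] *[of v] unfolding max_norm_def by (metis max.cobounded1 max.cobounded2 order_trans)+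
qed

lemma good_pair_imp_coprime:
  fixes A B :: "'a::{nonarch_field, alg_closed_field} poly"
  assumes "good_pair d T A B" "d > 0"
  shows "coprime A B" "max (degree A) (degree B) = d" "A \<noteq> 0" "B \<noteq> 0"
proof -
  have nz: "hval d A x y \<noteq> 0 \<or> hval d B x y \<noteq> 0" if xy: "(x, y) \<noteq> (0, 0)" for x y
  proof -
    have "max_norm (hval d A x y) (hval d B x y) = T * max_norm x y ^ d" "T > 0"
      using assms(1) by (auto simp: good_pair_def)
    moreover have "max_norm x y \<noteq> 0"
      using xy max_norm_eq_0_iff[of x y] by auto
    ultimately show ?thesis
      by (metis max_norm_eq_0_iff mult_eq_0_iff power_not_zero less_irrefl)
  qed
  from coprime_if_hval_nonzero[OF good_pairD(2,3)[OF assms(1)] assms(2) this]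
  show "coprime A B" "max (degree A) (degree B) = d" "A \<noteq> 0" "B \<noteq> 0"
    by auto
qed

lemma max_degree_reduce:
  fixes A B :: "'a::nonarch_field poly"
  assumes "degree A \<le> d" "degree B \<le> d" "max_norm (coeff A d) (coeff B d) = 1"
  shows "max (degree (reduce A)) (degree (reduce B)) = d"
proof (rule antisym)
  show "max (degree (reduce A)) (degree (reduce B)) \<le> d"
    using assms by (auto intro!: degree_map_poly_bound)
  have "absv (coeff A d) = 1 \<or> absv (coeff B d) = 1"
    "absv (coeff A d) \<le> 1" "absv (coeff B d) \<le> 1"
    using assms(3) by (auto simp: max_norm_def max_def split: if_splits)
  hence "coeff (reduce A) d \<noteq> 0 \<or> coeff (reduce B) d \<noteq> 0"
    by (auto simp: reduction_eq_0_iff)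
  thus "d \<le> max (degree (reduce A)) (degree (reduce B))"
    using le_degree le_max_iff_disj by blast
qed

lemma good_pair_imp_good_reduction:
  fixes A B :: "'a::{nonarch_field, alg_closed_field} poly"
  assumes good: "good_pair d T A B" and d: "d > 0" and L: "is_subfield L" "poly_over L A" "poly_over L B"
  shows "good_reduction L (Fract A B)"
proof -
  note g = good_pairD[OF good]
  \<comment> \<open>T is attained by a top coefficient, which lies in L, so the pair can be
    normalised without leaving L.\<close>
  define m where "m = (if absv (coeff A d) = T then coeff A d else coeff B d)"
  have m: "absv m = T" "m \<in> L" "m = coeff A d \<or> m = coeff B d"
    using g(6) L by (auto simp: m_def max_norm_def max_def poly_over_def split: if_splits)
  have m0: "m \<noteq> 0"
    using m(1) g(1) by auto
  define A' B' where "A' = smult (inverse m) A" and "B' = smult (inverse m) B"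
  have inv: "absv (inverse m) = inverse T" "inverse T > 0"
    using m g(1) by (auto simp: absv_inverse)
  have le: "absv (coeff A' i) \<le> 1" "absv (coeff B' i) \<le> 1" for i
    using mult_left_mono[OF g(4)[of i], of "inverse T"] mult_left_mono[OF g(5)[of i], of "inverse T"]
      g(1) inv by (auto simp: A'_def B'_def absv_mult)
  have int: "integral_poly A'" "integral_poly B'"
    using le by (auto simp: integral_poly_def)
  have "max_norm (coeff A' d) (coeff B' d) = inverse T * T"
    using g(6) by (simp add: A'_def B'_def max_norm_scale absv_inverse m(1))
  hence lead: "max_norm (coeff A' d) (coeff B' d) = 1"
    using g(1) by simp
  have val: "absv (poly A' z) = 1 \<or> absv (poly B' z) = 1" if "absv z \<le> 1" for z
  proof -
    have "max_norm (poly A' z) (poly B' z) = inverse T * T"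
      using g(7)[OF that] by (simp add: A'_def B'_def max_norm_scale absv_inverse m(1))
    thus ?thesis using g(1) by (auto simp: max_norm_def max_def split: if_splits)
  qed
  have deg: "degree A' \<le> d" "degree B' \<le> d"
    using g(2,3) by (simp_all add: A'_def B'_def)
  have mx: "max (degree (reduce A')) (degree (reduce B')) = d"
    using deg lead by (rule max_degree_reduce)
  hence "reduce A' \<noteq> 0 \<or> reduce B' \<noteq> 0"
    using d by auto
  hence cop: "coprime (reduce A') (reduce B')"
    using int val by (intro coprime_reduceI) auto
  \<comment> \<open>A vanishing denominator would turn the fraction into the default value 0; by
    coprimality \<open>reduce A'\<close> would then be constant, against
    \<open>d > 0\<close>.\<close>
  have "reduce B' \<noteq> 0"
  proof
    assume "reduce B' = 0"
    hence "is_unit (reduce A')"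
      using cop by simp
    thus False
      using mx d \<open>reduce B' = 0\<close> is_unit_iff_degree[of "reduce A'"]
      by (cases "reduce A' = 0") auto
  qed
  hence "ratfun_degree (Fract (reduce A') (reduce B')) = d"
    using cop mx by (simp add: ratfun_degree_Fract)
  moreover have "ratfun_degree (Fract A B) = d"
    using good_pair_imp_coprime[OF good d] by (simp add: ratfun_degree_Fract)
  moreover have AB: "Fract A B = Fract A' B'" "B' \<noteq> 0"
    using m0 good_pair_imp_coprime[OF good d] by (simp_all add: A'_def B'_def eq_fract mult.commute)
  moreover have "inverse m \<in> L"
    using L(1) m(2) by (simp add: is_subfield_def)
  hence over: "poly_over L A'" "poly_over L B'"
    using L by (simp_all add: A'_def B'_def poly_over_smult)
  have "set (coeffs P) \<subseteq> {x \<in> L. absv x \<le> 1}" if "poly_over L P" "\<And>i. absv (coeff P i) \<le> 1" for P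
    using that by (auto simp: poly_over_def coeffs_def)
  hence "set (coeffs A') \<subseteq> {x \<in> L. absv x \<le> 1}" "set (coeffs B') \<subseteq> {x \<in> L. absv x \<le> 1}"
    using over le by auto
  moreover have "\<exists>x\<in>set (coeffs A') \<union> set (coeffs B'). absv x = 1"
  proof -
    have "coeff P i \<in> set (coeffs P)" if "coeff P i \<noteq> 0" for P :: "'a poly" and i
      using that by (metis coeff_in_coeffs coeff_0 le_degree)
    moreover have "coeff A' d = 1 \<or> coeff B' d = 1"
      using m(3) m0 by (auto simp: A'_def B'_def)
    ultimately show ?thesis
      by (metis UnI1 UnI2 absv_1 zero_neq_one)
  qed
  ultimately show ?thesis
    unfolding good_reduction_def by (intro exI[of _ A'] exI[of _ B']) simp
qed

text \<open>Homogeneity reduces the identity to points of norm 1. Such a point reduces to a point of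
  the projective line, where the coprime reduced forms do not vanish together.\<close>

lemma good_pair_if_reduction:
  fixes A B :: "'a::nonarch_field poly"
  assumes int: "integral_poly A" "integral_poly B" and deg: "degree A \<le> d" "degree B \<le> d"
    and cop: "coprime (reduce A) (reduce B)" and mx: "max (degree (reduce A)) (degree (reduce B)) = d"
    and d: "d > 0"
  shows "good_pair d 1 A B"
proof -
  have main: "max_norm (hval d A x y) (hval d B x y) = 1" if xy: "max_norm x y = 1" for x y
  proof -
    have le: "absv x \<le> 1" "absv y \<le> 1" and one: "absv x = 1 \<or> absv y = 1"
      using xy by (auto simp: max_norm_def max_def split: if_splits)
    have pow: "absv (x ^ n) \<le> 1" "absv (y ^ n) \<le> 1" for n
      using le by (auto simp: absv_power absv_nonneg power_le_one)
    have hv: "absv (hval d P x y) \<le> 1 \<and>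
        reduction (hval d P x y) = hval d (reduce P) (reduction x) (reduction y)"
      if "integral_poly P" for P
    proof -
      have c: "absv (coeff P i) \<le> 1" for i
        using that by (auto simp: integral_poly_def)
      show ?thesis
        unfolding hval_def using c pow le
        by (auto simp: reduction_sum reduction_mult reduction_power absv_mult_le_1 intro!: absv_sum_le)
    qed
    have "(reduction x, reduction y) \<noteq> (0, 0)"
      using one le by (auto simp: reduction_eq_0_iff)
    hence "reduction (hval d A x y) \<noteq> 0 \<or> reduction (hval d B x y) \<noteq> 0"
      using hval_nonzero_if_coprime[OF cop mx d] hv[OF int(1)] hv[OF int(2)] by auto
    moreover have "absv z = 1" if "absv z \<le> 1" "reduction z \<noteq> 0" for z :: 'a
      using that reduction_eq_0_iff[of z] by linarith
    ultimately have "absv (hval d A x y) = 1 \<or> absv (hval d B x y) = 1"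
      using hv[OF int(1)] hv[OF int(2)] by blast
    thus ?thesis
      using hv[OF int(1)] hv[OF int(2)] by (auto simp: max_norm_def max_def)
  qed
  have "max_norm (hval d A x y) (hval d B x y) = max_norm x y ^ d" for x y
  proof (cases "max_norm x y = 0")
    case True
    hence "x = 0" "y = 0"
      by (simp_all add: max_norm_eq_0_iff)
    thus ?thesis using d by (simp add: hval_0 max_norm_def power_0_left)
  next
    case False
    define k where "k = (if absv x \<le> absv y then y else x)"
    have k: "absv k = max_norm x y"
      by (auto simp: k_def max_norm_def max_def)
    have k0: "k \<noteq> 0"
      using False k by auto
    have "max_norm (k * (x / k)) (k * (y / k)) = absv k * max_norm (x / k) (y / k)"
      by (rule max_norm_scale)
    hence "max_norm (x / k) (y / k) = 1"
      using k k0 False by simp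
    from main[OF this] show ?thesis
      using hval_scale[of d A k "x / k" "y / k"] hval_scale[of d B k "x / k" "y / k"] k k0
      by (simp add: max_norm_scale absv_power)
  qed
  thus ?thesis
    using deg by (simp add: good_pair_def)
qed

lemma good_pair_scale:
  fixes A B :: "'a::nonarch_field poly"
  assumes "good_pair d T (smult k A) (smult k B)" "k \<noteq> 0"
  shows "good_pair d (T / absv k) A B"
proof -
  have "absv k > 0" using assms(2) by (simp add: absv_pos_iff)
  thus ?thesis
    using assms by (simp add: good_pair_def hval_smult max_norm_scale field_simps)
qed

lemma ex_max_coeff:
  fixes P Q :: "'a::nonarch_field poly"
  assumes "P \<noteq> 0 \<or> Q \<noteq> 0"
  obtains m where "m \<noteq> 0" "integral_poly (smult (inverse m) P)" "integral_poly (smult (inverse m) Q)"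
    "\<exists>i. coeff P i = m \<or> coeff Q i = m"
proof -
  define C where "C = range (coeff P) \<union> range (coeff Q)"
  have "range (coeff R) \<subseteq> insert 0 (coeff R ` {..degree R})" for R :: "'a poly"
    by (auto simp: image_iff) (metis atMost_iff coeff_eq_0 not_le)
  hence "finite (range (coeff R))" for R :: "'a poly"
    by (meson finite_insert finite_imageI finite_atMost finite_subset)
  hence fin: "finite (absv ` C)" "absv ` C \<noteq> {}"
    by (auto simp: C_def)
  obtain m where m: "m \<in> C" "absv m = Max (absv ` C)"
    using Max_in[OF fin] by auto
  have le: "absv x \<le> absv m" if "x \<in> C" for x
    using m fin that by simp
  have m0: "m \<noteq> 0"
  proof
    assume "m = 0"
    hence "x = 0" if "x \<in> C" for x
      using le[OF that] absv_nonneg[of x] absv_eq_0_iff[of x] by auto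
    hence "P = 0" "Q = 0" by (auto simp: C_def poly_eq_iff)
    thus False using assms by simp
  qed
  have "integral_poly (smult (inverse m) P)" "integral_poly (smult (inverse m) Q)"
    using le m0 absv_pos_iff[of m]
    by (auto simp: integral_poly_def C_def absv_divide divide_inverse_commute[symmetric] divide_le_eq)
  thus ?thesis using that[of m] m0 m(1) by (auto simp: C_def)
qed

text \<open>
  A representation of \<open>A / B\<close> witnessing good reduction may have a common factor \<open>h\<close>; by Gauss's lemma
  \<open>h\<close> can be normalised, and its reduction cancels.
\<close>
lemma good_reduction_imp_good_pair:
  fixes A B :: "'a::nonarch_field poly"
  assumes "coprime A B" "B \<noteq> 0" "max (degree A) (degree B) = d" "d > 0" "good_reduction L (Fract A B)"
  obtains T where "good_pair d T A B"
proof -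
  obtain F G where FG: "set (coeffs F) \<subseteq> {x \<in> L. absv x \<le> 1}" "set (coeffs G) \<subseteq> {x \<in> L. absv x \<le> 1}"
     "G \<noteq> 0" "Fract A B = Fract F G" "\<exists>x\<in>set (coeffs F) \<union> set (coeffs G). absv x = 1"
     and rd: "ratfun_degree (Fract (reduce F) (reduce G)) = ratfun_degree (Fract A B)"
    using assms(5) unfolding good_reduction_def by blast
  have rd: "ratfun_degree (Fract (reduce F) (reduce G)) = d"
    using rd assms by (simp add: ratfun_degree_Fract)
  have int_if: "integral_poly P" if "set (coeffs P) \<subseteq> {x \<in> L. absv x \<le> 1}" for P
    unfolding integral_poly_def
  proof
    fix i
    show "absv (coeff P i) \<le> 1"
      using that range_coeff[of P] rangeI[of "coeff P" i] by auto
  qed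
  have int: "integral_poly F" "integral_poly G"
    using FG int_if by auto
  have unit: "\<exists>i. absv (coeff F i) = 1 \<or> absv (coeff G i) = 1"
  proof -
    have "\<exists>i. x = coeff P i" if "x \<in> set (coeffs P)" for x and P :: "'a poly"
      using that range_coeff[of P] by (metis insertCI rangeE)
    thus ?thesis using FG(5) by blast
  qed
  have eq: "A * G = F * B"
    using FG(4) assms(2) FG(3) by (simp add: eq_fract)
  have "coprime B A" "B dvd A * G"
    using assms(1) eq by (simp_all add: coprime_commute)
  hence "B dvd G" by (rule coprime_poly_dvd_mult)
  then obtain h where h: "G = B * h" by (rule dvdE)
  have "F * B = (A * h) * B"
    using eq unfolding h by (metis mult.assoc mult.commute)
  hence F: "F = A * h"
    using assms(2) mult_right_cancel by blast
  have h0: "h \<noteq> 0" using h FG(3) by auto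
  obtain \<eta> where \<eta>: "\<eta> \<noteq> 0" "integral_poly (smult (inverse \<eta>) h)" "\<exists>i. coeff h i = \<eta>"
    using ex_max_coeff[of h h] h0 by metis
  obtain m where m: "m \<noteq> 0" "integral_poly (smult (inverse m) A)" "integral_poly (smult (inverse m) B)"
    "\<exists>i. coeff A i = m \<or> coeff B i = m"
    using ex_max_coeff[of A B] assms(2) by metis
  define h' A' B' where "h' = smult (inverse \<eta>) h"
    and "A' = smult (inverse m) A" and "B' = smult (inverse m) B"
  have int': "integral_poly h'" "integral_poly A'" "integral_poly B'"
    using \<eta> m by (auto simp: h'_def A'_def B'_def)
  have rh: "reduce h' \<noteq> 0"
  proof -
    obtain i where "coeff h i = \<eta>"
      using \<eta>(3) by blast
    hence "coeff h' i = 1"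
      using \<eta>(1) by (simp add: h'_def)
    thus ?thesis by (metis coeff_0 coeff_reduce reduction_1 zero_neq_one)
  qed
  have rAB: "reduce A' \<noteq> 0 \<or> reduce B' \<noteq> 0"
  proof -
    obtain i where "coeff A i = m \<or> coeff B i = m"
      using m(4) by blast
    hence "coeff A' i = 1 \<or> coeff B' i = 1"
      using m(1) by (auto simp: A'_def B'_def)
    thus ?thesis by (metis coeff_0 coeff_reduce reduction_1 zero_neq_one)
  qed
  define k where "k = \<eta> * m"
  have FG': "F = smult k (A' * h')" "G = smult k (B' * h')"
  proof -
    have "\<eta> * m * (inverse \<eta> * inverse m) = 1"
      using \<eta>(1) m(1) by (simp add: field_simps)
    thus "F = smult k (A' * h')" "G = smult k (B' * h')"
      by (simp_all only: F h k_def A'_def B'_def h'_def mult_smult_left mult_smult_right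
          smult_smult mult.commute[of "inverse m"] smult_1_left)
  qed
  have intAh: "integral_poly (A' * h')" "integral_poly (B' * h')"
    using int' by (simp_all add: integral_poly_mult)
  have red: "reduce (A' * h') = reduce A' * reduce h'" "reduce (B' * h') = reduce B' * reduce h'"
    using int' by (simp_all add: reduce_mult)
  \<comment> \<open>Both pairs have Gauss norm 1: (F, G) by assumption, and (A' h', B' h') because a
    product of nonzero reductions is nonzero. Hence the scalar between them has absolute value
    1.\<close>
  have k1: "absv k = 1"
  proof (rule antisym)
    show "absv k \<le> 1"
    proof (rule ccontr)
      assume "\<not> absv k \<le> 1"
      hence lt: "absv x < 1" if "absv (k * x) \<le> 1" for x
        using that absv_nonneg[of x] unfolding absv_mult
        by (smt (verit) mult_left_le_one_le mult_mono mult_cancel_right1 mult_strict_right_mono)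
      have "reduce (A' * h') = 0" "reduce (B' * h') = 0"
        using int lt unfolding reduce_eq_0_iff[OF intAh(1)] reduce_eq_0_iff[OF intAh(2)]
        by (auto simp: FG' integral_poly_def)
      thus False using red rh rAB by auto
    qed
    obtain i where "absv (k * coeff (A' * h') i) = 1 \<or> absv (k * coeff (B' * h') i) = 1"
      using unit by (auto simp: FG')
    moreover have "absv (k * x) \<le> absv k * 1" if "absv x \<le> 1" for x
      using that by (intro absv_mult_le) auto
    ultimately show "absv k \<ge> 1"
      using intAh by (auto simp: integral_poly_def) metis+
  qed
  have intk: "integral_poly [:k:]"
    using k1 by (auto simp: integral_poly_def coeff_pCons split: nat.splits)
  have "F = [:k:] * h' * A'" "G = [:k:] * h' * B'"
    using FG' by (simp_all add: mult.commute)
  hence FG_red: "reduce F = reduce ([:k:] * h') * reduce A'" "reduce G = reduce ([:k:] * h') * reduce B'"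
    using int' intk by (simp_all only: reduce_mult integral_poly_mult)
  have "coeff (reduce [:k:]) 0 \<noteq> 0"
    using k1 by (simp add: reduction_eq_0_iff)
  hence "reduce [:k:] \<noteq> 0" by (metis coeff_0)
  hence nz: "reduce ([:k:] * h') \<noteq> 0"
    using rh int' intk by (simp only: reduce_mult) simp
  \<comment> \<open>Otherwise the reduced fraction is the default value 0, of degree 0.\<close>
  have rB: "reduce B' \<noteq> 0"
  proof
    assume "reduce B' = 0"
    hence "Fract (reduce F) (reduce G) = Fract 0 1"
      using FG_red by (simp add: eq_fract fract_collapse)
    thus False using rd assms(4) by (simp add: ratfun_degree_Fract)
  qed
  have "Fract (reduce F) (reduce G) = Fract (reduce A') (reduce B')"
    unfolding FG_red using nz by (rule mult_fract_cancel)
  moreover obtain u v where uv: "v \<noteq> 0" "coprime u v" "Fract (reduce A') (reduce B') = Fract u v"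
    using ex_coprime_Fract by blast
  ultimately have duv: "max (degree u) (degree v) = d"
    using rd by (simp add: ratfun_degree_Fract)
  have eq2: "reduce A' * v = u * reduce B'"
    using uv rB by (simp add: eq_fract)
  have "coprime v u" "v dvd u * reduce B'"
    using uv(2) eq2 by (auto simp: coprime_commute) (metis dvd_triv_right)
  hence "v dvd reduce B'" by (rule coprime_poly_dvd_mult)
  then obtain w where w: "reduce B' = v * w" by (rule dvdE)
  have "reduce A' * v = (u * w) * v"
    using eq2 w by (simp add: mult_ac)
  hence w': "reduce A' = u * w"
    using uv(1) mult_right_cancel by blast
  have w0: "w \<noteq> 0" using w rB by auto
  have dA: "degree A' \<le> d" "degree B' \<le> d"
    using assms(3) by (auto simp: A'_def B'_def)
  have rdeg: "degree (reduce A') \<le> d" "degree (reduce B') \<le> d"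
    using dA by (auto intro: degree_map_poly_bound)
  \<comment> \<open>u or v already has degree d, while \<open>u * w\<close> and \<open>v * w\<close>
    have degree at most d; so the common factor w of the reductions is constant.\<close>
  have "degree w = 0"
  proof (cases "degree v = d")
    case True
    thus ?thesis using rdeg(2) w w0 uv(1) by (simp add: degree_mult_eq)
  next
    case False
    hence "degree u = d" using duv by (auto simp: max_def split: if_splits)
    moreover from this have "u \<noteq> 0" using assms(4) by auto
    ultimately show ?thesis using rdeg(1) w' w0 by (simp add: degree_mult_eq)
  qed
  then obtain \<omega> where \<omega>: "w = [:\<omega>:]" "\<omega> \<noteq> 0"
    using w0 by (auto elim: degree_eq_zeroE)
  have "coprime (reduce A') (reduce B')"
    unfolding w w' \<omega>(1)
    by (rule coprimeI) (use uv(2) \<omega>(2) in \<open>auto simp: dvd_smult_iff intro: coprime_common_divisor\<close>)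
  moreover have "max (degree (reduce A')) (degree (reduce B')) = d"
    using duv \<omega> by (simp add: w w' mult.commute)
  ultimately have "good_pair d 1 A' B'"
    using int' dA assms(4) by (intro good_pair_if_reduction)
  hence "good_pair d (1 / absv (inverse m)) A B"
    unfolding A'_def B'_def using m(1) by (intro good_pair_scale) auto
  thus ?thesis by (rule that)
qed

lemma conj_affine:
  assumes "degree f \<le> d" "degree g \<le> d"
  shows "conj_num d f g 1 (- a) 0 c = pcompose f [:a, c:] - smult a (pcompose g [:a, c:])"
    "conj_den d f g 1 (- a) 0 c = smult c (pcompose g [:a, c:])"
proof -
  have "[:1, - 0:] = (1 :: 'a::field poly)" by simp
  thus "conj_num d f g 1 (- a) 0 c = pcompose f [:a, c:] - smult a (pcompose g [:a, c:])"
    "conj_den d f g 1 (- a) 0 c = smult c (pcompose g [:a, c:])"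
    using assms by (simp_all add: conj_num_def conj_den_def hsubst_affine[unfolded one_pCons])
qed

section \<open>Finding a centre of small degree\<close>

text \<open>The k-th derivative divided by k!, in a form that makes sense when k! is zero or not a
  unit.\<close>

definition hasse_deriv :: "nat \<Rightarrow> 'a::comm_semiring_1 poly \<Rightarrow> 'a poly" where
  "hasse_deriv k P = (\<Sum>j\<le>degree P. monom (of_nat ((k + j) choose k) * coeff P (k + j)) j)"

lemma coeff_hasse_deriv: "coeff (hasse_deriv k P) j = of_nat ((k + j) choose k) * coeff P (k + j)"
  by (auto simp: hasse_deriv_def coeff_sum coeff_eq_0)

text \<open>Taylor expansion at u. It expresses coefficients in the coordinate of a disc as a power
  of the radius scalar times a value of a polynomial with coefficients in the small field.\<close>

lemma coeff_pcompose_affine: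
  fixes P :: "'a::comm_ring_1 poly"
  shows "coeff (pcompose P [:u, v:]) k = v ^ k * poly (hasse_deriv k P) u"
proof -
  have split: "(\<Sum>i\<le>k + D. h i) = (\<Sum>i<k. h i) + (\<Sum>j\<le>D. h (k + j))" for h :: "nat \<Rightarrow> 'a" and D
    by (induction D) (simp_all add: add.assoc flip: lessThan_Suc_atMost)
  have deg: "degree (map_poly (\<lambda>x. [:x:]) P) \<le> k + degree P"
    by (intro degree_map_poly_bound) auto
  have "coeff (pcompose P [:u, v:]) k = (\<Sum>i\<le>k + degree P. coeff P i * coeff ([:u, v:] ^ i) k)"
    using deg by (simp add: pcompose_altdef poly_altdef_le coeff_sum coeff_map_poly)
  also have "\<dots> = (\<Sum>j\<le>degree P. coeff P (k + j) * coeff ([:u, v:] ^ (k + j)) k)"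
  proof -
    have "coeff ([:u, v:] ^ i) k = 0" if "i < k" for i
      using that by (intro coeff_eq_0 le_less_trans[OF degree_linear_power])
    thus ?thesis unfolding split by simp
  qed
  also have "\<dots> = v ^ k * poly (hasse_deriv k P) u"
    unfolding hasse_deriv_def poly_sum sum_distrib_left
    by (intro sum.cong) (simp_all add: poly_monom coeff_linear_poly_power mult_ac)
  finally show ?thesis .
qed

text \<open>
  If all roots of \<open>P\<close>, of degree \<open>n\<close>, lie in a disc, so do those of its Hasse derivatives whose
  leading coefficient \<open>n choose q\<close> is a unit.
\<close>
lemma ex_center:
  fixes \<iota> :: "'k::nonarch_field \<Rightarrow> 'a::{nonarch_field, alg_closed_field}"
  assumes closure: "is_valued_alg_closure \<iota>" and F: "ext_of_degree_le \<iota> N F"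
    and P: "poly_over F P" "degree P \<le> n" and c: "c \<noteq> 0" and T: "T > 0"
    and coeffs: "\<And>i. absv (coeff (pcompose P [:a, c:]) i) \<le> T"
      "absv (coeff (pcompose P [:a, c:]) n) = T"
    and q: "q \<ge> 1" "q \<le> n" "absv (of_nat (n choose q) :: 'a) = 1"
  obtains L b where "ext_of_degree_le \<iota> (N * q) L" "F \<subseteq> L" "b \<in> L" "absv (b - a) \<le> absv c"
proof -
  \<comment> \<open>The Hasse derivative of order \<open>n - q\<close> has degree q, with leading
    coefficient \<open>n choose q\<close> times that of P.\<close>
  define k where "k = n - q"
  have kq: "k + q = n" "(n choose k) = (n choose q)"
    using q by (simp_all add: k_def binomial_symmetric[of q n])
  define R where "R = pcompose P [:a, c:]"
  have degR: "degree R \<le> n"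
    using degree_pcompose_le[of P "[:a, c:]"] P(2) c by (simp add: R_def)
  have deg: "degree (hasse_deriv k Q) \<le> q" if "degree Q \<le> n" for Q :: "'a poly"
    using that kq(1) by (intro degree_le) (auto simp: coeff_hasse_deriv intro!: coeff_eq_0)
  have F': "is_subfield F"
    using F by (rule ext_of_degree_le_subfield)
  have over: "poly_over F (hasse_deriv k P)"
    using F' P(1) subfield_of_nat[OF F'] unfolding poly_over_def coeff_hasse_deriv
    by (simp add: is_subfield_def)
  have "hasse_deriv n P = [:coeff P n:]"
    using P(2) by (intro poly_eqI) (auto simp: coeff_hasse_deriv coeff_pCons coeff_eq_0 split: nat.split)
  hence "coeff P n \<noteq> 0"
    using coeffs(2) T by (auto simp: coeff_pcompose_affine)
  hence "coeff (hasse_deriv k P) q \<noteq> 0"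
    using q(3) by (auto simp: coeff_hasse_deriv kq)
  hence degq: "degree (hasse_deriv k P) = q"
    using deg[OF P(2)] by (intro antisym le_degree)
  then obtain b where b: "poly (hasse_deriv k P) b = 0"
    using alg_closed_imp_poly_has_root[of "hasse_deriv k P"] q(1) by auto
  from adjoin_root[OF closure F over _ b] degq q(1)
  obtain L where L: "ext_of_degree_le \<iota> (N * q) L" "F \<subseteq> L" "b \<in> L"
    by auto
  have "absv (b - a) \<le> absv c"
  proof (rule ccontr)
    assume *: "\<not> ?thesis"
    \<comment> \<open>This is b in the coordinate of the disc. Outside the unit disc the top term of
      the derivative of R dominates, so the derivative cannot vanish there.\<close>
    define u where "u = (b - a) / c"
    have u: "absv u > 1"
      using * c by (simp add: u_def absv_divide absv_pos_iff)
    have "pcompose P [:b, 1:] = pcompose P (pcompose [:a, c:] [:u, 1 / c:])"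
      using c by (simp add: u_def pcompose_pCons)
    hence "pcompose P [:b, 1:] = pcompose R [:u, 1 / c:]"
      by (simp add: R_def pcompose_assoc)
    hence "(1 / c) ^ k * poly (hasse_deriv k R) u = 1 ^ k * poly (hasse_deriv k P) b"
      by (metis coeff_pcompose_affine)
    hence "poly (hasse_deriv k R) u = 0"
      using b c by simp
    moreover have "absv (poly (hasse_deriv k R) u) = T * absv u ^ q"
    proof (rule absv_poly_dominant[OF deg[OF degR]])
      fix j
      have "absv (of_nat (k + j choose k) * coeff R (k + j)) \<le> 1 * T"
        by (intro absv_mult_le absv_of_nat_le_1) (simp add: R_def coeffs)
      thus "absv (coeff (hasse_deriv k R) j) \<le> T"
        by (simp add: coeff_hasse_deriv)
      show "absv (coeff (hasse_deriv k R) q) = T"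
        using q(3) coeffs(2) by (simp add: coeff_hasse_deriv kq absv_mult R_def)
    qed (use T u in auto)
    ultimately show False
      using T u by simp
  qed
  thus ?thesis
    using that L by blast
qed

section \<open>Rational functions with good reduction at a disc\<close>

text \<open>M bounds the degree over the base field, not over F, so the costs of centre and radius
  multiply to a single bound.\<close>

definition attained ::
    "('k::nonarch_field \<Rightarrow> 'a::nonarch_field) \<Rightarrow> 'a set \<Rightarrow> nat \<Rightarrow> nat \<Rightarrow> 'a poly \<Rightarrow> 'a poly \<Rightarrow> bool" where
  "attained \<iota> F M d f g \<longleftrightarrow> (\<exists>L \<alpha> \<beta> \<gamma> \<delta>. ext_of_degree_le \<iota> M L \<and> F \<subseteq> L \<and>
     \<alpha> \<in> L \<and> \<beta> \<in> L \<and> \<gamma> \<in> L \<and> \<delta> \<in> L \<and> good_matrix d f g \<alpha> \<beta> \<gamma> \<delta>)"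

lemma attained_mono: "attained \<iota> L M d f g \<Longrightarrow> F \<subseteq> L \<Longrightarrow> M \<le> M' \<Longrightarrow> attained \<iota> F M' d f g"
  unfolding attained_def by (meson ext_of_degree_le_mono order_trans)

text \<open>
  The disc has centre \<open>a\<close> and radius \<open>\<bar>c\<bar>\<close>, and \<open>A / B\<close> is the conjugate of \<open>f / g\<close> by \<open>z \<mapsto> (z - a) / c\<close>.
  Its reduction fixes \<open>\<infinity>\<close> iff \<open>\<bar>coeff B d\<bar> < T\<close>, with nonzero multiplier iff \<open>\<bar>coeff B (d - 1)\<bar> = T\<close>.
\<close>
locale good_disc =
  fixes d :: nat and f g :: "'a::{nonarch_field, alg_closed_field} poly" and a c :: 'a and T :: real
  assumes d: "d \<ge> 2" and degf: "degree f \<le> d" and degg: "degree g \<le> d"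
    and good: "good_matrix d f g 1 (- a) 0 c"
    and pair: "good_pair d T (pcompose f [:a, c:] - smult a (pcompose g [:a, c:]))
      (smult c (pcompose g [:a, c:]))"
begin

definition "A = pcompose f [:a, c:] - smult a (pcompose g [:a, c:])"

definition "B = smult c (pcompose g [:a, c:])"

lemma AB: "good_pair d T A B"
  using pair by (simp add: A_def B_def)

lemmas AB_facts = good_pairD[OF AB]

lemma c_nonzero: "c \<noteq> 0"
  using good by (simp add: good_matrix_def)

lemma c_pos: "absv c > 0"
  using c_nonzero by (simp add: absv_pos_iff)

lemma pcompose_g: "pcompose g [:a, c:] = smult (1 / c) B"
  using c_nonzero by (simp add: B_def)

lemma pcompose_f: "pcompose f [:a, c:] = A + smult (a / c) B"
  using c_nonzero by (simp add: A_def B_def)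

lemma hasse_deriv_top: "degree P \<le> d \<Longrightarrow> hasse_deriv d P = [:coeff P d:]"
  by (intro poly_eqI) (auto simp: coeff_hasse_deriv coeff_pCons coeff_eq_0 split: nat.split)

lemma coeff_B: "coeff B i = c ^ Suc i * poly (hasse_deriv i g) a"
  by (simp add: B_def coeff_pcompose_affine)

lemma coeff_B_d: "coeff B d = c ^ Suc d * coeff g d"
  by (simp add: coeff_B hasse_deriv_top degg)

lemma coeff_A_d: "coeff A d = c ^ d * (coeff f d - a * coeff g d)"
  by (simp add: A_def coeff_pcompose_affine hasse_deriv_top degf degg algebra_simps)

lemma coeff_A_0: "coeff A 0 = poly f a - a * poly g a"
  by (simp add: A_def pcompose_coeff_0)

lemma lead_A: "absv (coeff B d) < T \<Longrightarrow> absv (coeff A d) = T"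
  using AB_facts(6) by (auto simp: max_norm_def max_def split: if_splits)

text \<open>The reduction is not the constant \<infinity>: A has top coefficient of size T, hence an
  integral root, and there B has to be of size T.\<close>

lemma B_nonzero_mod: "absv (coeff B d) < T \<Longrightarrow> \<exists>j<d. absv (coeff B j) = T"
proof (rule ccontr)
  assume lt: "absv (coeff B d) < T" and *: "\<not> (\<exists>j<d. absv (coeff B j) = T)"
  have small: "absv (coeff B j) < T" for j
  proof (cases "j > d")
    case True
    thus ?thesis using AB_facts(1,3) by (simp add: coeff_eq_0)
  next
    case False
    thus ?thesis using lt * AB_facts(5)[of j] by (metis less_le linorder_cases)
  qed
  have A: "absv (coeff A d) = T"
    using lt by (rule lead_A)
  hence "coeff A d \<noteq> 0"
    using AB_facts(1) by auto
  hence "degree A > 0"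
    using d le_degree[of A d] by simp
  then obtain z where z: "poly A z = 0"
    using alg_closed_imp_poly_has_root by blast
  have z1: "absv z \<le> 1"
  proof (rule ccontr)
    assume "\<not> absv z \<le> 1"
    hence "absv (poly A z) = T * absv z ^ d"
      using AB_facts A by (intro absv_poly_dominant) auto
    thus False using z \<open>\<not> absv z \<le> 1\<close> AB_facts(1) by auto
  qed
  have "absv (coeff B i * z ^ i) < T" for i
  proof -
    have "absv (coeff B i * z ^ i) \<le> absv (coeff B i) * 1"
      using z1 by (intro absv_mult_le) (auto simp: absv_power absv_nonneg power_le_one)
    thus ?thesis using small[of i] by simp
  qed
  hence "absv (poly B z) < T"
    unfolding poly_altdef using AB_facts(1) by (intro absv_sum_less) auto
  moreover have "max_norm (poly A z) (poly B z) = T"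
    using AB_facts(7)[OF z1] .
  ultimately show False
    using z AB_facts(1) by (auto simp: max_norm_def)
qed

text \<open>The new top coefficients arise from the old ones by an integral shear, so the constant T
  is the same for both centres.\<close>

lemma recenter:
  assumes b: "absv (b - a) \<le> absv c"
  shows "good_disc d f g b c T"
proof -
  have good': "good_matrix d f g 1 (- b) 0 c"
    using good_matrix_affine_cong[OF good b] by simp
  then obtain T' where T': "good_pair d T' (pcompose f [:b, c:] - smult b (pcompose g [:b, c:]))
      (smult c (pcompose g [:b, c:]))"
    using degf degg by (auto simp: good_matrix_iff_good_pair conj_affine)
  interpret b: good_disc d f g b c T'
    using d degf degg good' T' by unfold_locales
  have "coeff b.A d = (a - b) / c * coeff B d + coeff A d" "coeff b.B d = coeff B d"
    using c_nonzero by (simp_all add: b.coeff_A_d b.coeff_B_d coeff_A_d coeff_B_d field_simps)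
  moreover have "absv ((a - b) / c) \<le> 1"
    using b c_pos by (simp add: absv_divide absv_minus_commute)
  ultimately have "max_norm (coeff b.B d) (coeff b.A d) = max_norm (coeff B d) (coeff A d)"
    by (simp only: max_norm_shear)
  hence "T' = T"
    using AB_facts(6) b.AB_facts(6) by (simp add: max_norm_commute)
  thus ?thesis
    using b.good_disc_axioms by simp
qed

text \<open>Whether the multiplier at \<infinity> reduces to 0 does not depend on the centre: the
  coefficient changes by an integral multiple of the small \<open>coeff B d\<close>.\<close>

lemma recenter_coeff_B_pred:
  assumes b: "absv (b - a) \<le> absv c" and small: "absv (coeff B d) < T" "absv (coeff B (d - 1)) < T"
  shows "absv (coeff (good_disc.B g b c) (d - 1)) < T"
proof -
  interpret b: good_disc d f g b c T
    using b by (rule recenter)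
  have h: "hasse_deriv (d - 1) g = [:coeff g (d - 1), of_nat d * coeff g d:]"
  proof (rule poly_eqI)
    fix i
    show "coeff (hasse_deriv (d - 1) g) i = coeff [:coeff g (d - 1), of_nat d * coeff g d:] i"
    proof (cases i)
      case (Suc j)
      show ?thesis
      proof (cases j)
        case 0
        have "(d choose (d - 1)) = d"
          using d binomial_symmetric[of 1 d] by simp
        thus ?thesis using Suc 0 d by (simp add: coeff_hasse_deriv)
      next
        case (Suc l)
        thus ?thesis using \<open>i = Suc j\<close> degg d by (simp add: coeff_hasse_deriv coeff_eq_0)
      qed
    qed (simp add: coeff_hasse_deriv)
  qed
  have "Suc (d - 1) = d"
    using d by simp
  hence "coeff b.B (d - 1) = coeff B (d - 1) + of_nat d * ((b - a) / c) * coeff B d"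
    using c_nonzero unfolding coeff_B[of "d - 1"] b.coeff_B[of "d - 1"] h coeff_B_d \<open>Suc (d - 1) = d\<close>
    by (simp add: field_simps)
  moreover have "absv (of_nat d * ((b - a) / c)) \<le> 1"
    using b c_pos by (intro absv_mult_le_1 absv_of_nat_le_1) (simp add: absv_divide)
  hence "absv (of_nat d * ((b - a) / c) * coeff B d) \<le> 1 * absv (coeff B d)"
    by (intro absv_mult_le) auto
  ultimately show ?thesis
    using small by (auto intro: absv_add_less)
qed

end

lemma absv_power_diff_le:
  fixes w w' :: "'a::nonarch_field"
  assumes "absv w \<le> \<rho>" "absv w' \<le> \<rho>"
  shows "absv (w ^ Suc n - w' ^ Suc n) \<le> absv (w - w') * \<rho> ^ n"
proof (induction n)
  case (Suc n)
  have \<rho>: "\<rho> \<ge> 0"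
    using assms(1) absv_nonneg[of w] by linarith
  have "w ^ Suc (Suc n) - w' ^ Suc (Suc n) = w * (w ^ Suc n - w' ^ Suc n) + (w - w') * w' ^ Suc n"
    by (simp add: algebra_simps)
  moreover have "absv (w * (w ^ Suc n - w' ^ Suc n)) \<le> \<rho> * (absv (w - w') * \<rho> ^ n)"
    by (intro absv_mult_le assms Suc)
  moreover have "absv ((w - w') * w' ^ Suc n) \<le> absv (w - w') * \<rho> ^ Suc n"
    using assms(2) by (intro absv_mult_le order_refl) (simp only: absv_power power_mono absv_nonneg)
  ultimately show ?case
    by (simp only: absv_add_le power_Suc mult.left_commute)
qed simp

section \<open>The radius over a field containing the centre, and almost fixed rational
  points\<close>

context good_disc
begin

text \<open>Only \<open>|c|\<close> matters, so any n-th root of y can replace c.\<close>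

lemma attained_radius:
  fixes \<iota> :: "'k::nonarch_field \<Rightarrow> 'a"
  assumes closure: "is_valued_alg_closure \<iota>" and L: "ext_of_degree_le \<iota> N L"
    and "a \<in> L" "y \<in> L" "n > 0" "absv c ^ n = absv y"
  shows "attained \<iota> L (N * n) d f g"
proof -
  obtain L' c' where L': "ext_of_degree_le \<iota> (N * n) L'" "L \<subseteq> L'" "c' \<in> L'" "c' ^ n = y"
    using adjoin_nth_root[OF closure L assms(4,5)] by blast
  have "absv c' ^ n = absv c ^ n"
    using L'(4) assms(6) by (simp flip: absv_power)
  hence "absv c' = absv c"
    using assms(5) absv_nonneg by (metis power_eq_imp_eq_base)
  hence "good_matrix d f g 1 (- a) 0 c'"
    by (intro good_matrix_affine_cong[OF good]) (simp_all add: absv_nonneg)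
  moreover have "1 \<in> L'" "0 \<in> L'" "- a \<in> L'"
    using ext_of_degree_le_subfield[OF L'(1)] L'(2) assms(3) by (auto simp: is_subfield_def)
  ultimately show ?thesis
    unfolding attained_def using L' by blast
qed

lemma poly_over_hasse_deriv:
  "is_subfield L \<Longrightarrow> poly_over L P \<Longrightarrow> poly_over L (hasse_deriv k P)"
  using subfield_of_nat[of L] unfolding poly_over_def coeff_hasse_deriv by (simp add: is_subfield_def)

context
  fixes \<iota> :: "'k::nonarch_field \<Rightarrow> 'a" and N :: nat and L :: "'a set"
  assumes closure: "is_valued_alg_closure \<iota>" and L: "ext_of_degree_le \<iota> N L"
    and over: "poly_over L f" "poly_over L g"
begin

private lemma subfield_L: "is_subfield L"
  using L by (rule ext_of_degree_le_subfield)

context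
  assumes aL: "a \<in> L" and small: "absv (coeff B d) < T"
begin

private lemma lead_in_L:
  "coeff f d - a * coeff g d \<in> L" "absv (coeff f d - a * coeff g d) > 0"
proof -
  show "coeff f d - a * coeff g d \<in> L"
    using subfield_L over aL subfield_diff[OF subfield_L] by (auto simp: poly_over_def is_subfield_def)
  show "absv (coeff f d - a * coeff g d) > 0"
    using lead_A[OF small] AB_facts(1) by (auto simp: coeff_A_d absv_mult absv_pos_iff)
qed

text \<open>Equality of \<open>|coeff A d|\<close> and \<open>|coeff B j|\<close> compares
  \<open>|c| ^ d\<close> with \<open>|c| ^ (j + 1)\<close>; \<open>j \<le> d - 2\<close> makes the
  exponent \<open>d - 1 - j\<close> positive.\<close>

lemma attained_radius_pole:
  assumes j: "j \<le> d - 2" "absv (coeff B j) = T"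
  shows "attained \<iota> L (N * (d - 1)) d f g"
proof -
  let ?\<alpha> = "coeff f d - a * coeff g d" and ?\<beta> = "poly (hasse_deriv j g) a"
  have "absv c ^ d * absv ?\<alpha> = absv c ^ Suc j * absv ?\<beta>"
    using lead_A[OF small] j(2) by (simp add: coeff_A_d coeff_B absv_mult absv_power)
  moreover have "absv c ^ d = absv c ^ Suc j * absv c ^ (d - 1 - j)"
    using j d by (simp flip: power_add power_Suc)
  ultimately have "absv c ^ (d - 1 - j) * absv ?\<alpha> = absv ?\<beta>"
    using c_pos by (simp add: mult.assoc)
  hence "absv c ^ (d - 1 - j) = absv (?\<beta> / ?\<alpha>)"
    using lead_in_L(2) by (simp add: absv_divide field_simps)
  moreover have "?\<beta> / ?\<alpha> \<in> L"
    using lead_in_L(1) subfield_L aL over poly_over_hasse_deriv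
    by (auto intro!: subfield_divide poly_over_eval)
  ultimately have "attained \<iota> L (N * (d - 1 - j)) d f g"
    using j d by (intro attained_radius closure L aL) auto
  thus ?thesis
    by (rule attained_mono) auto
qed

text \<open>If no \<open>coeff B j\<close> with \<open>j \<le> d - 2\<close> has size T, then
  \<open>coeff B 0\<close> has not, so \<open>coeff A 0\<close> has, and comparing it with
  \<open>coeff A d\<close> determines \<open>|c| ^ d\<close>.\<close>

lemma attained_radius_fixed_pole: "attained \<iota> L (N * d) d f g"
proof (cases "\<exists>j\<le>d - 2. absv (coeff B j) = T")
  case True
  then obtain j where "j \<le> d - 2" "absv (coeff B j) = T" by blast
  hence "attained \<iota> L (N * (d - 1)) d f g"
    by (rule attained_radius_pole)
  thus ?thesis by (rule attained_mono) auto
next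
  case False
  let ?\<alpha> = "coeff f d - a * coeff g d"
  have "absv (coeff B 0) < T"
    using False AB_facts(5)[of 0] by (auto simp: less_le)
  moreover have "max_norm (poly A 0) (poly B 0) = T"
    by (rule AB_facts(7)) simp
  ultimately have "absv (coeff A 0) = T"
    by (auto simp: poly_0_coeff_0 max_norm_def max_def split: if_splits)
  hence "absv c ^ d * absv ?\<alpha> = absv (poly f a - a * poly g a)"
    using lead_A[OF small] by (simp add: coeff_A_d coeff_A_0 absv_mult absv_power)
  hence "absv c ^ d = absv ((poly f a - a * poly g a) / ?\<alpha>)"
    using lead_in_L(2) by (simp add: absv_divide field_simps)
  moreover have "poly f a \<in> L" "poly g a \<in> L"
    using subfield_L aL over by (auto intro: poly_over_eval)
  hence "(poly f a - a * poly g a) / ?\<alpha> \<in> L"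
    using lead_in_L(1) aL subfield_L subfield_diff[OF subfield_L] subfield_divide[OF subfield_L]
    by (auto simp: is_subfield_def)
  ultimately show ?thesis
    using d by (intro attained_radius closure L aL) auto
qed

text \<open>Some coefficient of B has size T, and now it sits below degree \<open>d - 1\<close>, so
  the case with exponent d does not arise.\<close>

lemma attained_radius_superattracting:
  assumes "absv (coeff B (d - 1)) < T"
  shows "attained \<iota> L (N * (d - 1)) d f g"
proof -
  obtain j where "j < d" "absv (coeff B j) = T"
    using B_nonzero_mod[OF small] by blast
  moreover from this have "j \<noteq> d - 1"
    using assms by auto
  ultimately show ?thesis
    by (intro attained_radius_pole[of j]) auto
qed

end

text \<open>
  In the coordinate \<open>w = c / (z - a)\<close> the map is \<open>w \<mapsto> \<Phi> w\<close>, a contraction of the residue disc of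
  \<open>\<infinity>\<close> if its multiplier there reduces to 0, so iterating it from \<open>\<infinity>\<close> yields
  almost fixed points over \<open>L\<close>.
\<close>
lemma ex_almost_fixed:
  assumes small: "absv (coeff B d) < T" "absv (coeff B (d - 1)) < T" and gd: "coeff g d \<noteq> 0"
  obtains x where "x \<in> L" "absv c < absv (x - a)" "poly g x \<noteq> 0"
    "absv (poly f x / poly g x - x) < absv c"
proof -
  \<comment> \<open>On the disc \<open>|w| \<le> \<rho>\<close> this number bounds both the size of
    \<Phi> and its Lipschitz constant. It is positive because
    \<open>coeff g d \<noteq> 0\<close>.\<close>
  define \<rho> where "\<rho> = max (absv (coeff B d)) (absv (coeff B (d - 1))) / T"
  have Tpos: "T > 0" by (rule AB_facts(1))
  have \<rho>1: "\<rho> < 1"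
    using small Tpos by (simp add: \<rho>_def)
  have Bd: "coeff B d \<noteq> 0"
    using gd c_nonzero by (simp add: coeff_B_d)
  have B\<rho>: "absv (coeff B d) \<le> \<rho> * T" "absv (coeff B (d - 1)) \<le> \<rho> * T"
    using Tpos by (simp_all add: \<rho>_def)
  have \<rho>0: "\<rho> > 0"
    using Bd Tpos absv_pos_iff[of "coeff B d"] by (auto simp: \<rho>_def less_max_iff_disj)
  have Ad: "absv (coeff A d) = T"
    using small(1) by (rule lead_A)
  \<comment> \<open>These are the forms at (1, w), so \<open>w = 0\<close> is the point \<infinity>;
    \<Phi> is \<open>Bh / Ah\<close> because w is the reciprocal coordinate.\<close>
  define Ah Bh where "Ah = (\<lambda>w. hval d A 1 w)" and "Bh = (\<lambda>w. hval d B 1 w)"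
  define \<Phi> where "\<Phi> = (\<lambda>w. Bh w / Ah w)"
  have Bh: "absv (Bh w) \<le> \<rho> * T" if w: "absv w \<le> \<rho>" for w
    unfolding Bh_def hval_def
  proof (rule absv_sum_le)
    fix i assume i: "i \<in> {..d}"
    show "absv (coeff B i * 1 ^ i * w ^ (d - i)) \<le> \<rho> * T"
    proof (cases "i = d")
      case True
      thus ?thesis using B\<rho> by simp
    next
      case False
      then obtain n where n: "d - i = Suc n"
        using i by (metis Suc_diff_Suc atMost_iff le_neq_implies_less)
      have "absv (w ^ n) \<le> 1"
        using w \<rho>1 by (simp add: absv_power absv_nonneg power_le_one)
      hence "absv (coeff B i * (w * w ^ n)) \<le> T * (\<rho> * 1)"
        using w by (intro absv_mult_le AB_facts)
      thus ?thesis by (simp add: n mult.commute)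
    qed
  qed (use \<rho>0 Tpos in simp)
  have Ah: "absv (Ah w) = T" if w: "absv w \<le> \<rho>" for w
  proof -
    have "max_norm 1 w = 1"
      using w \<rho>1 by (simp add: max_norm_def)
    hence "max_norm (Ah w) (Bh w) = T"
      using AB by (simp add: good_pair_def Ah_def Bh_def)
    moreover have "\<rho> * T < T"
      using \<rho>1 Tpos by simp
    hence "absv (Bh w) < T"
      using Bh[OF w] by linarith
    ultimately show ?thesis
      by (auto simp: max_norm_def max_def split: if_splits)
  qed
  have pow: "absv (w ^ n - w' ^ n) \<le> absv (w - w')" "n \<ge> 2 \<Longrightarrow> absv (w ^ n - w' ^ n) \<le> absv (w - w') * \<rho>"
    if w: "absv w \<le> \<rho>" "absv w' \<le> \<rho>" for w w' n
  proof -
    have *: "absv (w ^ n - w' ^ n) \<le> absv (w - w') * \<rho> ^ m" if "n = Suc k" "m \<le> k" for k m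
    proof -
      have "absv (w - w') * \<rho> ^ k \<le> absv (w - w') * \<rho> ^ m"
        using \<rho>0 \<rho>1 that by (intro mult_left_mono power_decreasing absv_nonneg) auto
      thus ?thesis using absv_power_diff_le[OF w, of k] unfolding that(1) by linarith
    qed
    show "absv (w ^ n - w' ^ n) \<le> absv (w - w')"
      using *[of "n - 1" 0] by (cases n) (auto simp: absv_nonneg)
    show "absv (w ^ n - w' ^ n) \<le> absv (w - w') * \<rho>" if "n \<ge> 2"
      using *[of "n - 1" 1] that by simp
  qed
  have Ah_diff: "absv (Ah w - Ah w') \<le> T * absv (w - w')"
    if w: "absv w \<le> \<rho>" "absv w' \<le> \<rho>" for w w'
  proof -
    have "Ah w - Ah w' = (\<Sum>i\<le>d. coeff A i * (w ^ (d - i) - w' ^ (d - i)))"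
      by (simp add: Ah_def hval_def sum_subtractf algebra_simps)
    also have "absv \<dots> \<le> T * absv (w - w')"
      using Tpos by (intro absv_sum_le absv_mult_le AB_facts pow w mult_nonneg_nonneg absv_nonneg) auto
    finally show ?thesis .
  qed
  have Bh_diff: "absv (Bh w - Bh w') \<le> \<rho> * T * absv (w - w')"
    if w: "absv w \<le> \<rho>" "absv w' \<le> \<rho>" for w w'
  proof -
    have "Bh w - Bh w' = (\<Sum>i\<le>d. coeff B i * (w ^ (d - i) - w' ^ (d - i)))"
      by (simp add: Bh_def hval_def sum_subtractf algebra_simps)
    also have "absv \<dots> \<le> \<rho> * T * absv (w - w')"
    proof (rule absv_sum_le)
      fix i assume "i \<in> {..d}"
      \<comment> \<open>The constant term cancels, the linear term has the small coefficient
        \<open>coeff B (d - 1)\<close>, and higher powers contribute a factor \<rho>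
        themselves.\<close>
      then consider "i = d" | "i = d - 1" | "d - i \<ge> 2"
        by fastforce
      thus "absv (coeff B i * (w ^ (d - i) - w' ^ (d - i))) \<le> \<rho> * T * absv (w - w')"
      proof cases
        case 1
        thus ?thesis using \<rho>0 Tpos by (simp add: absv_nonneg)
      next
        case 2
        hence "d - i = 1" using d by simp
        thus ?thesis using B\<rho>(2) 2 by (auto intro: absv_mult_le)
      next
        case 3
        have "absv (coeff B i * (w ^ (d - i) - w' ^ (d - i))) \<le> T * (absv (w - w') * \<rho>)"
          by (intro absv_mult_le AB_facts pow(2) w 3)
        thus ?thesis by (simp add: mult_ac)
      qed
    qed (use \<rho>0 Tpos in \<open>simp add: absv_nonneg\<close>)
    finally show ?thesis .
  qed
  have \<Phi>_le: "absv (\<Phi> w) \<le> \<rho>" if "absv w \<le> \<rho>" for w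
    using Bh[OF that] Ah[OF that] Tpos by (simp add: \<Phi>_def absv_divide divide_le_eq)
  have \<Phi>_contract: "absv (\<Phi> w - \<Phi> w') \<le> \<rho> * absv (w - w')"
    if w: "absv w \<le> \<rho>" "absv w' \<le> \<rho>" for w w'
  proof -
    have nz: "Ah w \<noteq> 0" "Ah w' \<noteq> 0"
      using Ah[OF w(1)] Ah[OF w(2)] Tpos by auto
    have "\<Phi> w - \<Phi> w' = ((Bh w - Bh w') * Ah w' - Bh w' * (Ah w - Ah w')) / (Ah w * Ah w')"
      using nz by (simp add: \<Phi>_def field_simps)
    moreover have "absv ((Bh w - Bh w') * Ah w') \<le> (\<rho> * T * absv (w - w')) * T"
      using Ah[OF w(2)] by (intro absv_mult_le Bh_diff w) simp
    moreover have "absv (Bh w' * (Ah w - Ah w')) \<le> (\<rho> * T) * (T * absv (w - w'))"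
      by (intro absv_mult_le Bh Ah_diff w)
    ultimately have "absv (\<Phi> w - \<Phi> w') * (T * T) \<le> \<rho> * absv (w - w') * (T * T)"
      using Tpos absv_diff_le[of "(Bh w - Bh w') * Ah w'" "\<rho> * T * absv (w - w') * T" "Bh w' * (Ah w - Ah w')"]
      by (simp add: absv_divide absv_mult Ah[OF w(1)] Ah[OF w(2)] mult_ac)
    thus ?thesis using Tpos by simp
  qed
  define w0 where "w0 = coeff B d / coeff A d"
  have w0: "w0 \<noteq> 0" "absv w0 \<le> \<rho>"
    using Bd Ad Tpos B\<rho>(1) by (auto simp: w0_def absv_divide divide_le_eq)
  have \<Phi>0: "\<Phi> 0 = w0"
    by (simp add: \<Phi>_def Bh_def Ah_def hval_0 w0_def)
  have w0_pos: "absv w0 > 0"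
    using w0 by (simp add: absv_pos_iff)
  \<comment> \<open>Consecutive iterates differ by less than \<open>|w0|\<close>, so from w0 on all
    of them have absolute value \<open>|w0|\<close>.\<close>
  have \<Phi>_abs: "absv (\<Phi> w) = absv w0"
    if "absv w = absv w0" "absv (\<Phi> w - w) \<le> \<rho> ^ Suc n * absv w0" for w n
  proof -
    have "\<rho> ^ Suc n < 1"
      using \<rho>0 \<rho>1 by (intro power_Suc_less_one) auto
    hence "\<rho> ^ Suc n * absv w0 < absv w0"
      using w0_pos by simp
    hence "absv (\<Phi> w - w) < absv w"
      using that by linarith
    hence "absv (w + (\<Phi> w - w)) = absv w"
      by (rule absv_add_dominant)
    thus ?thesis using that(1) by simp
  qed
  \<comment> \<open>In the original coordinate \<Phi> is \<phi> itself, so the iteration stays in L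
    although a and c need not lie there.\<close>
  have step: "poly g x \<noteq> 0 \<and> poly f x / poly g x = a + c / \<Phi> (c / (x - a))"
    if x: "x \<noteq> a" "absv (c / (x - a)) = absv w0" "\<Phi> (c / (x - a)) \<noteq> 0" for x
  proof -
    define w where "w = c / (x - a)"
    define u where "u = (x - a) / c"
    have uw: "u * w = 1" "u \<noteq> 0" and xu: "x = a + c * u"
      using x(1) c_nonzero by (auto simp: u_def w_def)
    have h: "poly P u = u ^ d * hval d P 1 w" if "degree P \<le> d" for P
      using hval_scale[of d P u 1 w] uw that by (simp add: hval_1)
    have gx: "poly g x = poly B u / c"
      using arg_cong[OF pcompose_g, of "\<lambda>P. poly P u"] by (simp add: poly_pcompose xu mult.commute)
    have fx: "poly f x = poly A u + a / c * poly B u"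
      using arg_cong[OF pcompose_f, of "\<lambda>P. poly P u"] by (simp add: poly_pcompose xu mult.commute)
    have "Ah w \<noteq> 0"
      using Ah[of w] w0 x(2) Tpos by (auto simp: w_def)
    moreover have "Bh w \<noteq> 0"
      using x(3) by (auto simp: \<Phi>_def w_def)
    moreover have "poly A u = u ^ d * Ah w" "poly B u = u ^ d * Bh w"
      using h AB_facts by (simp_all add: Ah_def Bh_def)
    ultimately show ?thesis
      unfolding gx fx \<Phi>_def w_def[symmetric] using uw(2) c_nonzero by (simp add: field_simps)
  qed
  have seq: "\<exists>x\<in>L. x \<noteq> a \<and> absv (c / (x - a)) = absv w0 \<and>
      absv (\<Phi> (c / (x - a)) - c / (x - a)) \<le> \<rho> ^ Suc n * absv w0" for n
  proof (induction n)
    case 0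
    \<comment> \<open>This is \<phi>(\<infinity>), the first iterate, with coordinate w0.\<close>
    define x where "x = coeff f d / coeff g d"
    have "coeff A d \<noteq> 0"
      using Ad Tpos by auto
    hence xa: "x - a = c * coeff A d / coeff B d"
      using gd c_nonzero by (simp add: x_def coeff_A_d coeff_B_d field_simps)
    hence "c / (x - a) = w0" "x \<noteq> a"
      using c_nonzero Bd \<open>coeff A d \<noteq> 0\<close> by (auto simp: w0_def)
    moreover have "x \<in> L"
      using over subfield_L by (auto simp: x_def poly_over_def intro: subfield_divide)
    moreover have "absv (\<Phi> w0 - \<Phi> 0) \<le> \<rho> * absv (w0 - 0)"
      using w0 \<rho>0 by (intro \<Phi>_contract) auto
    ultimately show ?case
      using \<Phi>0 by (intro bexI[of _ x]) auto
  next
    case (Suc n)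
    then obtain x where x: "x \<in> L" "x \<noteq> a" "absv (c / (x - a)) = absv w0"
        "absv (\<Phi> (c / (x - a)) - c / (x - a)) \<le> \<rho> ^ Suc n * absv w0"
      by blast
    define w where "w = c / (x - a)"
    have abs: "absv (\<Phi> w) = absv w0"
      using \<Phi>_abs x(3,4) unfolding w_def by blast
    hence nz: "\<Phi> w \<noteq> 0"
      using w0_pos by auto
    define x' where "x' = a + c / \<Phi> w"
    have "poly f x / poly g x = x'"
      using step[OF x(2,3)] nz by (simp add: x'_def w_def)
    hence "x' \<in> L"
      using poly_over_eval[OF subfield_L over(1) x(1)] poly_over_eval[OF subfield_L over(2) x(1)] subfield_L
      by (auto intro: subfield_divide)
    moreover have x'a: "c / (x' - a) = \<Phi> w" "x' \<noteq> a"
      using nz c_nonzero by (auto simp: x'_def)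
    moreover have "absv (\<Phi> (\<Phi> w) - \<Phi> w) \<le> \<rho> * absv (\<Phi> w - w)"
      using abs x(3) w0(2) by (intro \<Phi>_contract) (auto simp: w_def)
    moreover have "\<rho> * absv (\<Phi> w - w) \<le> \<rho> * (\<rho> ^ Suc n * absv w0)"
      using x(4) \<rho>0 by (intro mult_left_mono) (auto simp: w_def)
    ultimately show ?case
      using abs by (intro bexI[of _ x']) (auto simp: mult.assoc)
  qed
  \<comment> \<open>In the original coordinate the error is
    \<open>|c| * |\<Phi> w - w| / |w0| ^ 2\<close>. The estimate for the iterates already supplies
    one factor \<open>|w0|\<close>, and n supplies the other.\<close>
  obtain n where n: "\<rho> ^ n < absv w0"
    using real_arch_pow_inv[OF w0_pos \<rho>1] by blast
  have "\<rho> ^ Suc n \<le> \<rho> ^ n"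
    using \<rho>0 \<rho>1 by (intro power_decreasing) auto
  hence n: "\<rho> ^ Suc n < absv w0"
    using n by linarith
  obtain x where x: "x \<in> L" "x \<noteq> a" "absv (c / (x - a)) = absv w0"
      "absv (\<Phi> (c / (x - a)) - c / (x - a)) \<le> \<rho> ^ Suc n * absv w0"
    using seq[of n] by blast
  define w where "w = c / (x - a)"
  have w: "absv w = absv w0" "w \<noteq> 0"
    using x(2,3) c_nonzero by (auto simp: w_def)
  have \<Phi>w: "absv (\<Phi> w) = absv w0"
    using \<Phi>_abs x(3,4) unfolding w_def by blast
  hence nz: "\<Phi> w \<noteq> 0"
    using w0_pos by auto
  have st: "poly g x \<noteq> 0" "poly f x / poly g x = a + c / \<Phi> w"
    using step[OF x(2,3)] nz by (simp_all add: w_def)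
  have "x = a + c / w"
    using x(2) c_nonzero by (simp add: w_def)
  hence "poly f x / poly g x - x = (a + c / \<Phi> w) - (a + c / w)"
    using st(2) by (rule_tac arg_cong2[of _ _ _ _ minus])
  also have "\<dots> = c * (w - \<Phi> w) / (\<Phi> w * w)"
    using nz w(2) by (simp add: field_simps)
  finally have "poly f x / poly g x - x = c * (w - \<Phi> w) / (\<Phi> w * w)" .
  hence "absv (poly f x / poly g x - x) = absv c * (absv (\<Phi> w - w) / (absv w0 * absv w0))"
    using w \<Phi>w by (simp add: absv_mult absv_divide absv_minus_commute)
  also have "\<dots> < absv c * 1"
  proof (intro mult_strict_left_mono c_pos)
    have "absv (\<Phi> w - w) \<le> \<rho> ^ Suc n * absv w0"
      using x(4) by (simp add: w_def)
    also have "\<dots> < absv w0 * absv w0"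
      using n w0_pos by (intro mult_strict_right_mono)
    finally show "absv (\<Phi> w - w) / (absv w0 * absv w0) < 1"
      using w0_pos by simp
  qed
  finally have "absv (poly f x / poly g x - x) < absv c"
    by simp
  moreover have "absv c < absv (x - a)"
  proof -
    have "absv c / absv (x - a) < 1"
      using x(3) w0(2) \<rho>1 by (simp add: absv_divide)
    thus ?thesis using x(2) by (simp add: absv_pos_iff divide_less_eq)
  qed
  ultimately show ?thesis
    using that x(1) st(1) by blast
qed

end

end

lemma absv_of_nat_embedding:
  fixes \<iota> :: "'k::nonarch_field \<Rightarrow> 'a::{nonarch_field, alg_closed_field}"
  assumes "is_valued_alg_closure \<iota>"
  shows "absv (of_nat n :: 'a) = absv (of_nat n :: 'k)"
proof -
  have "\<iota> (of_nat n) = of_nat n"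
    by (induction n) (simp_all add: embedding_simps[OF assms])
  thus ?thesis by (metis embedding_simps(4)[OF assms])
qed

lemma coeff_linear_mult:
  "coeff ([:u, v:] * P) (Suc i) = u * coeff P (Suc i) + v * coeff P i" for u :: "'a::comm_ring_1"
  by simp

lemma ex_good_disc:
  assumes "d \<ge> 2" "degree f \<le> d" "degree g \<le> d" "good_matrix d f g 1 (- a) 0 c"
  obtains T where "good_disc d f g a c T"
proof -
  obtain T where "good_pair d T (conj_num d f g 1 (- a) 0 c) (conj_den d f g 1 (- a) 0 c)"
    using assms(4) by (auto simp: good_matrix_iff_good_pair)
  hence "good_disc d f g a c T"
    using assms by unfold_locales (simp_all add: conj_affine)
  thus ?thesis by (rule that)
qed

section \<open>Centres from preimages, fixed points and poles\<close>

context good_disc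
begin

text \<open>\<open>f - smult t g - pCons 0 g\<close> is the numerator of \<phi>(z) - t - z, so its
  roots are the finite fixed points of the translate \<phi> - t.\<close>

lemma pcompose_fixed_points:
  "pcompose (f - smult t g - pCons 0 g) [:a, c:] = A - pCons 0 B - smult (t / c) B"
proof -
  have "pcompose (pCons 0 g) [:a, c:] = [:a, c:] * pcompose g [:a, c:]"
    by (simp add: pcompose_pCons)
  also have "\<dots> = smult (a / c) B + pCons 0 B"
    using c_nonzero by (simp add: pcompose_g smult_add_right)
  finally show ?thesis
    by (simp add: pcompose_diff pcompose_smult pcompose_f pcompose_g)
qed

lemma coeff_fixed_points:
  assumes "absv s \<le> 1"
  shows "absv (coeff (A - pCons 0 B - smult s B) i) \<le> T"
proof -
  have "absv (coeff (pCons 0 B) i) \<le> T"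
    using AB_facts(1,5) by (cases i) auto
  moreover have "absv (s * coeff B i) \<le> 1 * T"
    using assms by (intro absv_mult_le AB_facts)
  ultimately show ?thesis
    using AB_facts(4)[of i] by (auto intro!: absv_diff_le)
qed

text \<open>In degree d the shifted polynomial \<open>pCons 0 B\<close> contributes
  \<open>coeff B (d - 1)\<close>; with both top coefficients of B small, A dominates.\<close>

lemma coeff_fixed_points_superattracting:
  assumes "absv s \<le> 1" "absv (coeff B d) < T" "absv (coeff B (d - 1)) < T"
  shows "absv (coeff (A - pCons 0 B - smult s B) d) = T"
proof -
  have "coeff (pCons 0 B) d = coeff B (d - 1)"
    using d by (cases d) auto
  moreover have "absv (s * coeff B d) \<le> 1 * absv (coeff B d)"
    using assms(1) by (intro absv_mult_le) auto
  ultimately have "absv (coeff (pCons 0 B) d + s * coeff B d) < T"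
    using assms(2,3) by (intro absv_add_less) auto
  hence "absv (coeff A d - (coeff (pCons 0 B) d + s * coeff B d)) = T"
    using lead_A[OF assms(2)] absv_diff_dominant by metis
  thus ?thesis by (simp add: algebra_simps)
qed

context
  fixes \<iota> :: "'k::nonarch_field \<Rightarrow> 'a" and L :: "'a set"
  assumes closure: "is_valued_alg_closure \<iota>" and L: "ext_of_degree_le \<iota> 1 L"
    and over: "poly_over L f" "poly_over L g"
begin

private lemma base_subfield: "is_subfield L"
  using L by (rule ext_of_degree_le_subfield)

text \<open>
  If the multiplier at \<open>\<infinity>\<close> does not reduce to 0, then all the other preimages of the image of \<open>\<infinity>\<close>
  lie in the disc.
\<close>
lemma attained_fixed_pole:
  assumes small: "absv (coeff B d) < T" and unit: "absv (coeff B (d - 1)) = T"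
  shows "attained \<iota> L (degree_bound CHAR('k residue) d) d f g"
proof -
  \<comment> \<open>Up to a constant this is the numerator of \<phi>(z) - \<phi>(\<infinity>), with
    the terms of degree d cancelled. If \<open>coeff g d = 0\<close>, then \<phi> fixes \<infinity>
    and the roots of P are the poles.\<close>
  define P where "P = smult (coeff g d) f - smult (coeff f d) g"
  have overP: "poly_over L P"
    unfolding P_def using over by (intro poly_over_intros base_subfield) (auto simp: poly_over_def)
  have degP: "degree P \<le> d - 1"
  proof (rule degree_le, intro allI impI)
    fix i assume "i > d - 1"
    hence "i = d \<or> i > d" using d by auto
    thus "coeff P i = 0"
      using degf degg by (auto simp: P_def coeff_eq_0)
  qed
  have pc: "pcompose P [:a, c:] =
      smult (1 / c ^ Suc d) (smult (coeff B d) A - smult (coeff A d) B)"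
    using c_nonzero
    by (intro poly_eqI)
      (simp add: P_def pcompose_diff pcompose_smult pcompose_f pcompose_g coeff_A_d coeff_B_d field_simps)
  define T' where "T' = T * T / absv c ^ Suc d"
  have T': "T' > 0"
    using AB_facts(1) c_pos by (simp add: T'_def)
  have abs: "absv (coeff (pcompose P [:a, c:]) i) =
      absv (coeff B d * coeff A i - coeff A d * coeff B i) / absv c ^ Suc d" for i
    unfolding pc by (simp add: absv_mult absv_divide absv_power)
  have Ad: "absv (coeff A d) = T"
    using small by (rule lead_A)
  have le: "absv (coeff (pcompose P [:a, c:]) i) \<le> T'" for i
    unfolding abs T'_def
    by (intro divide_right_mono absv_diff_le absv_mult_le AB_facts) (use c_pos in auto)
  have eq: "absv (coeff (pcompose P [:a, c:]) (d - 1)) = T'"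
  proof -
    have "absv (coeff B d * coeff A (d - 1)) \<le> absv (coeff B d) * T"
      by (intro absv_mult_le AB_facts order_refl)
    \<comment> \<open>Nonzero multiplier is used here: the second product has the full size
      \<open>T * T\<close>, so all \<open>d - 1\<close> roots of P lie in the disc.\<close>
    also have "\<dots> < absv (coeff A d * coeff B (d - 1))"
      using small AB_facts(1) by (simp add: absv_mult Ad unit del: One_nat_def)
    finally have "absv (coeff A d * coeff B (d - 1) - coeff B d * coeff A (d - 1)) = T * T"
      by (subst absv_diff_dominant) (simp_all add: absv_mult Ad unit del: One_nat_def)
    thus ?thesis
      unfolding abs T'_def by (simp add: absv_minus_commute)
  qed
  have "d - 1 > 0" using d by simp
  from ex_choose_unit[OF this, where 'k = 'k] obtain q where q: "q \<ge> 1" "q \<le> d - 1"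
      "absv (of_nat ((d - 1) choose q) :: 'a) = 1"
      "q = 1 \<and> \<not> CHAR('k residue) dvd (d - 1) \<or>
       (\<exists>e. has_p_exponent CHAR('k residue) (d - 1) e \<and> q = CHAR('k residue) ^ e)"
    unfolding absv_of_nat_embedding[OF closure, symmetric] by blast
  obtain L1 b where L1: "ext_of_degree_le \<iota> (1 * q) L1" "L \<subseteq> L1" "b \<in> L1" "absv (b - a) \<le> absv c"
    using ex_center[OF closure L overP degP c_nonzero T' le eq q(1,2,3)] by blast
  interpret b: good_disc d f g b c T
    using L1(4) by (rule recenter)
  have "absv (coeff b.B d) < T"
    using small by (simp add: coeff_B_d b.coeff_B_d)
  hence "attained \<iota> L1 (1 * q * d) d f g"
    using over L1(2)
    by (intro b.attained_radius_fixed_pole closure L1(1,3)) (auto intro: poly_over_mono)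
  \<comment> \<open>For \<open>q = 1\<close> the bound \<open>d + 1\<close> suffices; for
    \<open>q = p ^ e\<close> this is the second value of the bound.\<close>
  moreover have "1 * q * d \<le> degree_bound CHAR('k residue) d"
    using q(4) degree_bound_ge[OF d, of "CHAR('k residue)"] degree_bound_dvd_pred[OF d]
    by (auto simp: mult.commute)
  ultimately show ?thesis
    using L1(2) by (blast intro: attained_mono)
qed

text \<open>
  If the multiplier at \<open>\<infinity>\<close> reduces to 0, all the other fixed points of a small translate of the map
  lie in the disc; the translation is chosen so that the fixed point outside the disc is in \<open>L\<close>.
\<close>
lemma ex_fixed_point_poly:
  assumes small: "absv (coeff B d) < T" "absv (coeff B (d - 1)) < T"
  obtains Q T' where "poly_over L Q" "degree Q \<le> d" "T' > 0"
    "\<And>i. absv (coeff (pcompose Q [:a, c:]) i) \<le> T'" "absv (coeff (pcompose Q [:a, c:]) d) = T'"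
proof (cases "coeff g d = 0")
  case True
  \<comment> \<open>Here \<infinity> itself is the exceptional fixed point, so the translation is 0
    and nothing has to be divided out.\<close>
  define Q where "Q = f - smult 0 g - pCons 0 g"
  have over': "poly_over L (pCons 0 g)" "poly_over L (smult 0 g)"
    using over poly_over_0[OF base_subfield] base_subfield by (auto intro!: poly_over_pCons simp: is_subfield_def)
  have "degree Q \<le> d"
  proof (rule degree_le, intro allI impI)
    fix i assume i: "i > d"
    then obtain k where k: "i = Suc k" by (cases i) auto
    have "coeff g k = 0"
      using i k True degg by (cases "k = d") (auto simp: coeff_eq_0)
    thus "coeff Q i = 0"
      using i degf k by (simp add: Q_def coeff_eq_0)
  qed
  moreover have "poly_over L Q"
    unfolding Q_def using over over' by (intro poly_over_diff base_subfield)
  moreover have "pcompose Q [:a, c:] = A - pCons 0 B - smult 0 B"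
    unfolding Q_def pcompose_fixed_points by simp
  ultimately show ?thesis
    using that[of Q T] AB_facts(1) coeff_fixed_points[of 0]
      coeff_fixed_points_superattracting[OF _ small, of 0] by simp
next
  case False
  obtain x where x: "x \<in> L" "absv c < absv (x - a)" "poly g x \<noteq> 0"
      "absv (poly f x / poly g x - x) < absv c"
    using ex_almost_fixed[OF closure L over small False] by blast
  \<comment> \<open>With this t the translate \<phi> - t fixes x exactly, and
    \<open>|t| < |c|\<close> makes the translation integral in the coordinate of the disc.\<close>
  define t where "t = poly f x / poly g x - x"
  define P where "P = f - smult t g - pCons 0 g"
  have t: "t \<in> L"
    unfolding t_def using x(1) over base_subfield
    by (auto intro!: subfield_diff subfield_divide poly_over_eval)
  have "poly P x = 0"
    using x(3) by (simp add: P_def t_def algebra_simps)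
  then obtain Q where Q: "P = [:- x, 1:] * Q"
    by (auto simp: poly_eq_0_iff_dvd elim: dvdE)
  have overP: "poly_over L P"
    unfolding P_def using over t base_subfield by (intro poly_over_intros) (auto simp: is_subfield_def)
  have degP: "degree P \<le> Suc d"
    unfolding P_def using degf degg
    by (intro degree_diff_le) (auto intro: order_trans[OF degree_smult_le] order_trans[OF degree_pCons_le])
  have degQ: "degree Q \<le> d"
  proof (cases "Q = 0")
    case False
    hence "degree P = 1 + degree Q"
      unfolding Q by (subst degree_mult_eq) auto
    thus ?thesis using degP by simp
  qed simp
  \<comment> \<open>Synthetic division from the top coefficient downwards; it shows that the
    quotient has coefficients in L.\<close>
  have Q_rec: "coeff Q i = coeff P (Suc i) + x * coeff Q (Suc i)" for i
    using Q coeff_linear_mult[of "- x" 1 Q i] by simp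
  have overQ: "poly_over L Q"
  proof -
    have "coeff Q i \<in> L" if "i \<le> Suc d" for i
      using that
    proof (induction i rule: inc_induct)
      case base
      show ?case using degQ base_subfield by (simp add: coeff_eq_0 is_subfield_def)
    next
      case (step n)
      thus ?case
        using Q_rec[of n] overP x(1) base_subfield by (simp add: poly_over_def is_subfield_def)
    qed
    moreover have "coeff Q i \<in> L" if "i > Suc d" for i
      using that degQ base_subfield by (simp add: coeff_eq_0 is_subfield_def)
    ultimately show ?thesis
      unfolding poly_over_def by (meson not_le)
  qed
  define s where "s = t / c"
  have s: "absv s \<le> 1"
    using x(4) c_pos by (simp add: s_def t_def absv_divide)
  define E where "E = A - pCons 0 B - smult s B"
  \<comment> \<open>In the coordinate of the disc, dividing by the factor of x is, up to the scalar
    \<open>a - x\<close>, dividing by \<open>[:1, - w:]\<close> with \<open>|w| < 1\<close>. This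
    factor reduces to 1, so R inherits the coefficient bound and the size of the coefficient in
    degree d from E.\<close>
  define R where "R = smult (a - x) (pcompose Q [:a, c:])"
  define w where "w = c / (x - a)"
  have xa: "absv (x - a) > 0" "x - a \<noteq> 0"
    using x(2) c_pos by (auto simp flip: absv_pos_iff)
  have w: "absv w < 1"
    using x(2) xa by (simp add: w_def absv_divide)
  have "E = pcompose P [:a, c:]"
    unfolding P_def pcompose_fixed_points E_def s_def ..
  also have "\<dots> = [:a - x, c:] * pcompose Q [:a, c:]"
    unfolding Q pcompose_mult by (simp add: pcompose_pCons)
  also have "[:a - x, c:] = smult (a - x) [:1, - w:]"
    using xa by (simp add: w_def field_simps)
  finally have ER: "E = [:1, - w:] * R"
    by (simp add: R_def smult_add_right)
  have R_0: "coeff R 0 = coeff E 0"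
    unfolding ER by (simp add: coeff_mult)
  have R_Suc: "coeff R (Suc i) = coeff E (Suc i) + w * coeff R i" for i
    unfolding ER coeff_linear_mult by simp
  have R_le: "absv (coeff R i) \<le> T" for i
  proof (induction i)
    case 0
    show ?case using coeff_fixed_points[OF s] by (simp add: R_0 E_def del: coeff_diff)
  next
    case (Suc i)
    have "absv (w * coeff R i) \<le> 1 * T"
      using w Suc by (intro absv_mult_le) auto
    thus ?case
      using coeff_fixed_points[OF s, of "Suc i"] unfolding R_Suc E_def by (intro absv_add_le) auto
  qed
  have R_d: "absv (coeff R d) = T"
  proof -
    obtain k where k: "d = Suc k" using d by (cases d) auto
    have "absv (w * coeff R k) \<le> absv w * T"
      by (intro absv_mult_le R_le order_refl)
    also have "\<dots> < T" using w AB_facts(1) by simp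
    finally have "absv (w * coeff R k) < absv (coeff E d)"
      using coeff_fixed_points_superattracting[OF s small] by (simp only: E_def)
    hence "absv (coeff E d + w * coeff R k) = absv (coeff E d)"
      by (rule absv_add_dominant)
    thus ?thesis
      using coeff_fixed_points_superattracting[OF s small] R_Suc[of k] k by (simp only: E_def)
  qed
  have "absv (coeff (pcompose Q [:a, c:]) i) = absv (coeff R i) / absv (x - a)" for i
    using xa by (simp add: R_def absv_mult absv_minus_commute)
  thus ?thesis
    using that[of Q "T / absv (x - a)"] overQ degQ AB_facts(1) xa R_le R_d
    by (simp add: divide_right_mono)
qed

text \<open>The roots of Q give a centre of degree at most q, which is 1 or the p-part of d. The
  multiplier still reduces to 0 at the new centre, so the radius costs at most \<open>d - 1\<close>;
  this is the origin of the value \<open>p ^ e * (d - 1)\<close>.\<close>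

lemma attained_superattracting:
  assumes small: "absv (coeff B d) < T" "absv (coeff B (d - 1)) < T"
  shows "attained \<iota> L (degree_bound CHAR('k residue) d) d f g"
proof -
  obtain Q T' where Q: "poly_over L Q" "degree Q \<le> d" "T' > 0"
    "\<And>i. absv (coeff (pcompose Q [:a, c:]) i) \<le> T'" "absv (coeff (pcompose Q [:a, c:]) d) = T'"
    using ex_fixed_point_poly[OF small] by blast
  have "d > 0" using d by simp
  from ex_choose_unit[OF this, where 'k = 'k] obtain q where q: "q \<ge> 1" "q \<le> d"
      "absv (of_nat (d choose q) :: 'a) = 1"
      "q = 1 \<and> \<not> CHAR('k residue) dvd d \<or>
       (\<exists>e. has_p_exponent CHAR('k residue) d e \<and> q = CHAR('k residue) ^ e)"
    unfolding absv_of_nat_embedding[OF closure, symmetric] by blast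
  obtain L1 b where L1: "ext_of_degree_le \<iota> (1 * q) L1" "L \<subseteq> L1" "b \<in> L1" "absv (b - a) \<le> absv c"
    using ex_center[OF closure L Q(1,2) c_nonzero Q(3,4,5) q(1,2,3)] by blast
  interpret b: good_disc d f g b c T
    using L1(4) by (rule recenter)
  have "absv (coeff b.B d) < T" "absv (coeff b.B (d - 1)) < T"
    using small recenter_coeff_B_pred[OF L1(4) small] by (simp_all add: coeff_B_d b.coeff_B_d)
  hence "attained \<iota> L1 (1 * q * (d - 1)) d f g"
    using over L1(2)
    by (intro b.attained_radius_superattracting closure L1(1,3)) (auto intro: poly_over_mono)
  moreover have "1 * q * (d - 1) \<le> degree_bound CHAR('k residue) d"
    using q(4) degree_bound_ge[OF d, of "CHAR('k residue)"] degree_bound_dvd[OF d]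
    by auto
  ultimately show ?thesis
    using L1(2) by (blast intro: attained_mono)
qed

lemma attained_infinity_fixed:
  assumes "absv (coeff B d) < T"
  shows "attained \<iota> L (degree_bound CHAR('k residue) d) d f g"
  using attained_fixed_pole[OF assms] attained_superattracting[OF assms] AB_facts(5)[of "d - 1"]
  by (auto simp: less_le)

text \<open>
  All \<open>d\<close> poles and all \<open>d + 1\<close> fixed points lie in the disc, and \<open>p\<close> does not divide both
  \<open>d\<close> and \<open>d + 1\<close>.
\<close>
lemma ex_rational_center:
  assumes unit: "absv (coeff B d) = T"
  obtains L1 b where "ext_of_degree_le \<iota> 1 L1" "L \<subseteq> L1" "b \<in> L1" "absv (b - a) \<le> absv c"
proof (cases "CHAR('k residue) dvd d")
  case False
  have q: "absv (of_nat (d choose 1) :: 'a) = 1"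
    using False absv_of_nat_eq_1_iff[of d, where 'k = 'k] by (simp add: absv_of_nat_embedding[OF closure])
  have abs: "absv (coeff (pcompose g [:a, c:]) i) = absv (coeff B i) / absv c" for i
    by (simp add: pcompose_g absv_divide)
  have T': "T / absv c > 0"
    using AB_facts(1) c_pos by simp
  have le: "absv (coeff (pcompose g [:a, c:]) i) \<le> T / absv c" for i
    unfolding abs using c_pos by (intro divide_right_mono AB_facts) simp
  have eq: "absv (coeff (pcompose g [:a, c:]) d) = T / absv c"
    unfolding abs unit ..
  have "1 \<le> d" using d by simp
  from ex_center[OF closure L over(2) degg c_nonzero T' le eq order_refl this q] that
  show ?thesis by auto
next
  case True
  have "\<not> CHAR('k residue) dvd Suc d"
  proof
    assume "CHAR('k residue) dvd Suc d"
    hence "CHAR('k residue) dvd Suc d - d"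
      using True by (rule dvd_diff_nat)
    thus False by simp
  qed
  hence q: "absv (of_nat (Suc d choose 1) :: 'a) = 1"
    using absv_of_nat_eq_1_iff[of "Suc d", where 'k = 'k]
    unfolding absv_of_nat_embedding[OF closure] by simp
  define P where "P = f - smult 0 g - pCons 0 g"
  have pc: "pcompose P [:a, c:] = A - pCons 0 B - smult 0 B"
    unfolding P_def pcompose_fixed_points by simp
  have over': "poly_over L (pCons 0 g)" "poly_over L (smult 0 g)"
    using over poly_over_0[OF base_subfield] base_subfield by (auto intro!: poly_over_pCons simp: is_subfield_def)
  have overP: "poly_over L P"
    unfolding P_def using over over' by (intro poly_over_diff base_subfield)
  have degP: "degree P \<le> Suc d"
    unfolding P_def using degf degg
    by (intro degree_diff_le) (auto intro: order_trans[OF degree_pCons_le])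
  have le: "absv (coeff (pcompose P [:a, c:]) i) \<le> T" for i
    unfolding pc by (rule coeff_fixed_points) simp
  \<comment> \<open>In degree \<open>d + 1\<close> only \<open>pCons 0 B\<close> contributes, with
    \<open>coeff B d\<close> of size T.\<close>
  have "coeff A (Suc d) = 0"
    using AB_facts(2) by (intro coeff_eq_0) simp
  hence eq: "absv (coeff (pcompose P [:a, c:]) (Suc d)) = T"
    unfolding pc using unit by simp
  have "1 \<le> Suc d" by simp
  from ex_center[OF closure L overP degP c_nonzero AB_facts(1) le eq order_refl this q] that
  show ?thesis by auto
qed

text \<open>
  If \<open>a\<close> is in the residue class of a fixed point, \<open>z \<mapsto> 1 / (z - a)\<close> moves that class to \<open>\<infinity>\<close>.
\<close>
lemma attained_center:
  assumes aL: "a \<in> L" and unit: "absv (coeff B d) = T"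
  shows "attained \<iota> L (degree_bound CHAR('k residue) d) d f g"
proof (cases "absv (coeff A 0) = T")
  case True
  have gd: "absv (coeff g d) > 0"
    using unit AB_facts(1) by (auto simp: coeff_B_d absv_pos_iff)
  let ?y = "(poly f a - a * poly g a) / coeff g d"
  \<comment> \<open>The top coefficient of B is compared with the constant coefficient of A; this is
    where the value \<open>d + 1\<close> comes from.\<close>
  have "absv c ^ Suc d * absv (coeff g d) = absv (poly f a - a * poly g a)"
    using True unit by (simp add: coeff_A_0 coeff_B_d absv_mult absv_power)
  hence "absv c ^ Suc d = absv ?y"
    using gd by (simp add: absv_divide field_simps)
  moreover have "poly f a \<in> L" "poly g a \<in> L"
    using base_subfield aL over by (auto intro: poly_over_eval)
  hence "?y \<in> L"
    using aL over base_subfield subfield_diff[OF base_subfield] subfield_divide[OF base_subfield]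
    by (auto simp: is_subfield_def poly_over_def)
  ultimately have "attained \<iota> L (1 * Suc d) d f g"
    by (intro attained_radius closure L aL) auto
  thus ?thesis
    using degree_bound_ge[OF d, of "CHAR('k residue)"] by (elim attained_mono) auto
next
  case False
  define f2 g2 where "f2 = conj_num d f g 0 1 1 (- a)" and "g2 = conj_den d f g 0 1 1 (- a)"
  \<comment> \<open>The rows (1, -a) and (0, c) are swapped and divided by c. The result is the
    matrix of z \<mapsto> 1 / (z - a) followed by a diagonal one, so the new disc has centre 0 and
    radius \<open>1 / |c|\<close>.\<close>
  have "good_matrix d f g 0 1 (1 / c) (- a / c)"
  proof (rule good_matrix_cong[OF good, of _ _ _ _ "1 / absv c"])
    fix x y
    have "c * (1 / c * x + - a / c * y) = 1 * x + - a * y"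
      using c_nonzero by (simp add: right_diff_distrib)
    hence "max_norm (c * (0 * x + 1 * y)) (c * (1 / c * x + - a / c * y)) =
        max_norm (1 * x + - a * y) (0 * x + c * y)"
      by (simp add: max_norm_commute)
    hence "absv c * max_norm (0 * x + 1 * y) (1 / c * x + - a / c * y) =
        max_norm (1 * x + - a * y) (0 * x + c * y)"
      by (simp only: max_norm_scale)
    thus "max_norm (0 * x + 1 * y) (1 / c * x + - a / c * y) =
        1 / absv c * max_norm (1 * x + - a * y) (0 * x + c * y)"
      using c_pos by (simp add: field_simps)
  qed (use c_nonzero c_pos in auto)
  hence "good_matrix d f2 g2 1 0 0 (1 / c)"
    unfolding f2_def g2_def using c_nonzero by (intro good_matrix_conj) simp_all
  hence "good_matrix d f2 g2 1 (- 0) 0 (1 / c)"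
    by simp
  moreover have "degree f2 \<le> d" "degree g2 \<le> d"
    by (simp_all add: f2_def g2_def degree_conj)
  ultimately obtain T2 where "good_disc d f2 g2 0 (1 / c) T2"
    using d ex_good_disc by blast
  then interpret D: good_disc d f2 g2 0 "1 / c" T2 .
  have minus: "hval d P (- a) (- 1) = (- 1) ^ d * poly P a" if "degree P \<le> d" for P
    using hval_scale[of d P "- 1" a 1] that by (simp add: hval_1)
  have "coeff f2 d = (- 1) ^ d * poly g a"
    using hval_conj(1)[of d f g 0 1 1 "- a" 1 0] minus[OF degg] by (simp add: f2_def hval_0)
  moreover have "coeff g2 d = (- 1) ^ d * coeff A 0"
    using hval_conj(2)[of d f g 0 1 1 "- a" 1 0] minus[OF degf] minus[OF degg]
    by (simp add: g2_def hval_0 coeff_A_0 algebra_simps)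
  ultimately have abs: "absv (coeff f2 d) = absv (poly g a)" "absv (coeff g2 d) = absv (coeff A 0)"
    by (simp_all add: absv_mult absv_power)
  have A0: "absv (coeff A 0) < T"
    using False AB_facts(4)[of 0] by simp
  have "max_norm (poly A 0) (poly B 0) = T"
    by (rule AB_facts(7)) simp
  hence "absv (coeff B 0) = T"
    using A0 by (auto simp: poly_0_coeff_0 max_norm_def max_def split: if_splits)
  moreover have "coeff B 0 = c * poly g a"
    by (simp add: B_def pcompose_coeff_0)
  ultimately have ga: "absv c * absv (poly g a) = T"
    by (simp add: absv_mult)
  have "absv (coeff D.B d) = absv (coeff A 0) / absv c ^ Suc d"
    "absv (coeff D.A d) = absv (poly g a) / absv c ^ d"
    by (simp_all add: D.coeff_B_d D.coeff_A_d absv_mult absv_divide absv_power abs power_divide)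
  \<comment> \<open>Since \<open>coeff A 0\<close> is small and \<open>coeff B 0\<close> has size T,
    the residue class of a is fixed; in the new coordinate this says that the reduction fixes
    \<infinity>.\<close>
  moreover have "absv (coeff A 0) / absv c ^ Suc d < absv (poly g a) / absv c ^ d"
    using A0 c_pos unfolding ga[symmetric] by (simp add: field_simps)
  ultimately have "absv (coeff D.B d) < T2"
    using D.AB_facts(6) by (auto simp: max_norm_def)
  moreover have "0 \<in> L" "1 \<in> L" "- a \<in> L"
    using base_subfield aL by (auto simp: is_subfield_def)
  hence "poly_over L f2" "poly_over L g2"
    using over unfolding f2_def g2_def by (auto intro!: poly_over_conj base_subfield)
  ultimately have "attained \<iota> L (degree_bound CHAR('k residue) d) d f2 g2"
    by (intro D.attained_infinity_fixed closure L)
  then obtain M \<alpha> \<beta> \<gamma> \<delta> where M: "ext_of_degree_le \<iota> (degree_bound CHAR('k residue) d) M" "L \<subseteq> M"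
    "\<alpha> \<in> M" "\<beta> \<in> M" "\<gamma> \<in> M" "\<delta> \<in> M" "good_matrix d f2 g2 \<alpha> \<beta> \<gamma> \<delta>"
    unfolding attained_def by blast
  have "good_matrix d f g (\<alpha> * 0 + \<beta> * 1) (\<alpha> * 1 + \<beta> * - a) (\<gamma> * 0 + \<delta> * 1) (\<gamma> * 1 + \<delta> * - a)"
    using M(7) unfolding f2_def g2_def by (intro good_matrix_compose) simp_all
  moreover have "is_subfield M" "- a \<in> M"
    using ext_of_degree_le_subfield[OF M(1)] aL M(2) by (auto simp: is_subfield_def)
  hence "\<alpha> * 0 + \<beta> * 1 \<in> M" "\<alpha> * 1 + \<beta> * - a \<in> M" "\<gamma> * 0 + \<delta> * 1 \<in> M" "\<gamma> * 1 + \<delta> * - a \<in> M"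
    using M unfolding is_subfield_def by blast+
  ultimately show ?thesis
    unfolding attained_def using M(1,2) by blast
qed

lemma attained_degree_bound: "attained \<iota> L (degree_bound CHAR('k residue) d) d f g"
proof (cases "absv (coeff B d) = T")
  case False
  hence "absv (coeff B d) < T"
    using AB_facts(5)[of d] by simp
  thus ?thesis
    by (intro attained_infinity_fixed closure L over)
next
  case True
  obtain L1 b where L1: "ext_of_degree_le \<iota> 1 L1" "L \<subseteq> L1" "b \<in> L1" "absv (b - a) \<le> absv c"
    using ex_rational_center[OF True] by blast
  interpret b: good_disc d f g b c T
    using L1(4) by (rule recenter)
  have "absv (coeff b.B d) = T"
    using True by (simp add: coeff_B_d b.coeff_B_d)
  hence "attained \<iota> L1 (degree_bound CHAR('k residue) d) d f g"
    using over L1 by (intro b.attained_center closure) (auto intro: poly_over_mono)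
  thus ?thesis
    using L1(2) by (blast intro: attained_mono)
qed

end

end

section \<open>Rational coprime representations and the conclusion\<close>

text \<open>The fraction is cancelled over the base field itself; a Bezout identity there is
  preserved by \<iota> and gives coprimality over the ambient field.\<close>

lemma ratfuns_over_coprime:
  fixes \<iota> :: "'k::nonarch_field \<Rightarrow> 'a::{nonarch_field, alg_closed_field}"
  assumes closure: "is_valued_alg_closure \<iota>" and "\<phi> \<in> ratfuns_over (range \<iota>)"
  obtains f g where "poly_over (range \<iota>) f" "poly_over (range \<iota>) g" "coprime f g" "g \<noteq> 0" "\<phi> = Fract f g"
proof -
  note emb = embedding_simps[OF closure]
  let ?m = "map_poly \<iota>"
  have m_coeff: "coeff (?m P) i = \<iota> (coeff P i)" for P i
    by (simp add: coeff_map_poly emb)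
  have hom_sum: "\<iota> (sum h A) = (\<Sum>a\<in>A. \<iota> (h a))" for h and A :: "nat set"
    by (induction A rule: infinite_finite_induct) (simp_all add: emb)
  have m_mult: "?m (P * Q) = ?m P * ?m Q" for P Q
    by (rule poly_eqI) (simp add: m_coeff coeff_mult hom_sum emb)
  have m_add: "?m (P + Q) = ?m P + ?m Q" for P Q
    by (rule poly_eqI) (simp add: m_coeff emb)
  have m_1: "?m 1 = 1"
    by (rule poly_eqI) (simp add: m_coeff emb one_pCons coeff_pCons split: nat.split)
  have m_0: "?m P = 0 \<longleftrightarrow> P = 0" for P
    by (simp add: poly_eq_iff m_coeff emb)
  have lift: "\<exists>P'. P = ?m P'" if "set (coeffs P) \<subseteq> range \<iota>" for P
  proof -
    have "poly_over (range \<iota>) P"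
      using that poly_over_iff_coeffs[OF subfield_range[OF closure]] by blast
    define h where "h i = inv \<iota> (coeff P i)" for i
    have h: "coeff P i = \<iota> (h i)" for i
      using \<open>poly_over (range \<iota>) P\<close> by (simp add: h_def poly_over_def f_inv_into_f)
    define P' where "P' = (\<Sum>i\<le>degree P. monom (h i) i)"
    have "coeff P' i = h i" for i
    proof (cases "i \<le> degree P")
      case False
      hence "\<iota> (h i) = 0" by (simp add: coeff_eq_0 flip: h)
      thus ?thesis using False by (simp add: P'_def coeff_sum emb)
    qed (simp add: P'_def coeff_sum)
    hence "P = ?m P'"
      by (intro poly_eqI) (simp add: m_coeff h)
    thus ?thesis by blast
  qed
  obtain f0 g0 where \<phi>: "\<phi> = Fract f0 g0" "set (coeffs f0) \<subseteq> range \<iota>" "set (coeffs g0) \<subseteq> range \<iota>" "g0 \<noteq> 0"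
    using assms(2) unfolding ratfuns_over_def by blast
  obtain f1 g1 where f1: "f0 = ?m f1" "g0 = ?m g1"
    using lift \<phi> by blast
  obtain f g where fg: "g \<noteq> 0" "coprime f g" "Fract f1 g1 = Fract f g"
    using ex_coprime_Fract by blast
  have "g1 \<noteq> 0" using f1 \<phi>(4) m_0 by auto
  hence "f1 * g = f * g1"
    using fg by (simp add: eq_fract)
  from arg_cong[OF this, of ?m] have "?m f1 * ?m g = ?m f * ?m g1"
    by (simp only: m_mult)
  hence "\<phi> = Fract (?m f) (?m g)"
    using \<phi>(1,4) f1 fg(1) m_0 by (simp add: eq_fract)
  moreover obtain u v where "u * f + v * g = 1"
    using coprime_poly_bezout[OF fg(2)] by blast
  from arg_cong[OF this, of ?m] have uv: "?m u * ?m f + ?m v * ?m g = 1"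
    by (simp only: m_add m_mult m_1)
  have "coprime (?m f) (?m g)"
  proof (rule coprimeI)
    fix h assume "h dvd ?m f" "h dvd ?m g"
    hence "h dvd ?m u * ?m f + ?m v * ?m g" by (intro dvd_add dvd_mult)
    thus "is_unit h" using uv by simp
  qed
  moreover have "poly_over (range \<iota>) (?m P)" for P
    by (simp add: poly_over_def m_coeff)
  ultimately show ?thesis
    using that fg(1) m_0 by blast
qed

theorem theoremA:
  fixes \<iota> :: "'k::nonarch_field \<Rightarrow> 'a::{nonarch_field, alg_closed_field}"
    and \<phi> :: "'a poly fract"
    and d p :: nat
  assumes "is_valued_alg_closure \<iota>"
    and "p = CHAR('k residue)"
    and "\<phi> \<in> ratfuns_over (range \<iota>)"
    and "ratfun_degree \<phi> = d"
    and "d \<ge> 2"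
    and "potentially_good_reduction \<iota> \<phi>"
  shows "\<exists>L. finite_extension \<iota> L \<and> extension_degree \<iota> L \<le> degree_bound p d \<and>
             (\<exists>\<psi>. conjugate_over L \<phi> \<psi> \<and> good_reduction L \<psi>)"
proof -
  note closure = assms(1)
  obtain f g where fg: "poly_over (range \<iota>) f" "poly_over (range \<iota>) g" "coprime f g" "g \<noteq> 0" "\<phi> = Fract f g"
    using ratfuns_over_coprime[OF closure assms(3)] .
  have deg: "max (degree f) (degree g) = d"
    using assms(4) fg by (simp add: ratfun_degree_Fract)
  have dpos: "d > 0" using assms(5) by simp
  note conj = conjugate_Fract[OF fg(3,4) deg dpos]
  obtain L0 \<alpha> \<beta> \<gamma> \<delta> where det: "\<alpha> * \<delta> - \<beta> * \<gamma> \<noteq> 0"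
    and good: "good_reduction L0 (Fract (conj_num d f g \<alpha> \<beta> \<gamma> \<delta>) (conj_den d f g \<alpha> \<beta> \<gamma> \<delta>))"
    using assms(6) conj unfolding potentially_good_reduction_def conjugate_over_def fg(5) by metis
  note nz = conj_nonzero[OF fg(3) deg dpos det]
  \<comment> \<open>The norm identity involves the absolute value but no field of definition, so
    from here a new extension can be built up from the base field.\<close>
  obtain T0 where "good_pair d T0 (conj_num d f g \<alpha> \<beta> \<gamma> \<delta>) (conj_den d f g \<alpha> \<beta> \<gamma> \<delta>)"
    using good_reduction_imp_good_pair[OF nz(1,4,2) dpos good] .
  hence "good_matrix d f g \<alpha> \<beta> \<gamma> \<delta>"
    using det by (auto simp: good_matrix_iff_good_pair)
  then obtain a c where "good_matrix d f g 1 (- a) 0 c"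
    using good_matrix_imp_affine by blast
  moreover have degs: "degree f \<le> d" "degree g \<le> d"
    using deg by auto
  ultimately obtain T where "good_pair d T (conj_num d f g 1 (- a) 0 c) (conj_den d f g 1 (- a) 0 c)"
    and "good_matrix d f g 1 (- a) 0 c"
    by (auto simp: good_matrix_iff_good_pair)
  then interpret good_disc d f g a c T
    using assms(5) degs by unfold_locales (simp_all add: conj_affine)
  obtain L \<alpha> \<beta> \<gamma> \<delta> where L: "ext_of_degree_le \<iota> (degree_bound p d) L" "range \<iota> \<subseteq> L"
      "\<alpha> \<in> L" "\<beta> \<in> L" "\<gamma> \<in> L" "\<delta> \<in> L" and gm: "good_matrix d f g \<alpha> \<beta> \<gamma> \<delta>"
    using attained_degree_bound[OF closure ext_of_degree_le_range[OF closure] fg(1,2)]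
    unfolding attained_def assms(2) by blast
  have L': "is_subfield L"
    using L(1) by (rule ext_of_degree_le_subfield)
  define \<psi> where "\<psi> = Fract (conj_num d f g \<alpha> \<beta> \<gamma> \<delta>) (conj_den d f g \<alpha> \<beta> \<gamma> \<delta>)"
  have det: "\<alpha> * \<delta> - \<beta> * \<gamma> \<noteq> 0"
    using gm by (simp add: good_matrix_def)
  have over: "poly_over L f" "poly_over L g"
    using fg(1,2) L(2) by (auto intro: poly_over_mono)
  obtain T1 where "good_pair d T1 (conj_num d f g \<alpha> \<beta> \<gamma> \<delta>) (conj_den d f g \<alpha> \<beta> \<gamma> \<delta>)"
    using gm by (auto simp: good_matrix_iff_good_pair)
  hence "good_reduction L \<psi>"
    unfolding \<psi>_def using dpos L' over L by (intro good_pair_imp_good_reduction poly_over_conj)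
  moreover have "conjugate_over L \<phi> \<psi>"
    unfolding conjugate_over_def using L det conj[OF det] fg(5) \<psi>_def by metis
  ultimately show ?thesis
    using ext_of_degree_le_imp_finite_extension[OF closure L(1)] by blast
qed

end
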